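(* Assume: (i) the process $\{(S_t,A_t,R_t)\}_{t\ge 0}$ generating the data is strictly stationary and exponentially $\beta$-mixing; (ii) $\tau^{\pi}$ and $\omega^{\pi}$ are uniformly bounded; (iii) $\widehat{Q}_k,\widehat{\tau}_k,\widehat{\omega}_k$ ($1\le k\le\mathbb{K}$) are uniformly bounded almost surely. Let $m\ge 2$ be any fixed integer. Suppose that for every $k\in\{1,\dots,\mathbb{K}\}$ at least one of the following holds: $\widehat{Q}_k$ converges in $L_2$-norm to $Q^{\pi}$; $\widehat{\tau}_k$ converges in $L_2$-norm to $\tau^{\pi}$; $\widehat{\omega}_k$ converges in $L_2$-norm to $\omega^{\pi}$. Then, as either $n\to\infty$ or $T\to\infty$, the value estimator $\widehat{\eta}^{(m)}_{\mathrm{TR}}$ is consistent, i.e. $\widehat{\eta}^{(m)}_{\mathrm{TR}}\to\eta^{\pi}$ in probability.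
   Context: Model. A Markov decision process has discrete state space $\mathcal{S}$, action space $\mathcal{A}$ (all probabilities below are mass functions), transition kernel $p$, reward function $r$, and discount factor $\gamma\in(0,1)$. A trajectory $\{(S_t,A_t,R_t)\}_{t\ge 0}$ of states, actions, rewards satisfies $\mathbb{P}(S_{t+1}=s\mid\{S_j,A_j,R_j\}_{0\le j\le t})=p(s;A_t,S_t)$ and $\mathbb{E}(R_t\mid S_t,A_t,\{S_j,A_j,R_j\}_{0\le j<t})=r(A_t,S_t)$. Rewards are uniformly bounded. The observed data are $n$ i.i.d. trajectories $\{(S_{i,t},A_{i,t},R_{i,t},S_{i,t+1})\}_{0\le t<T,1\le i\le n}$, generated under some behavior policy. Exponentially $\beta$-mixing means the $\beta$-mixing coefficients satisfy $\beta(q)=O(\rho^q)$ for some $\rho\in(0,1)$. Target. A fixed stationary target policy $\pi(a\mid s)$ and a prespecified reference distribution $\mathbb{G}$ on $\mathcal{S}$ are given. $Q^{\pi}(a,s)=\sum_{t\ge0}\gamma^t\mathbb{E}^{\pi}(R_t\mid A_0=a,S_0=s)$, $V^{\pi}(s)=\sum_{t\ge0}\gamma^t\mathbb{E}^{\pi}(R_t\mid S_0=s)$ ($\mathbb{E}^\pi$: expectation when actions follow $\pi$), and $\eta^{\pi}=\mathbb{E}_{s\sim\mathbb{G}}V^{\pi}(s)$. Density ratios. $p_\infty$ is the limiting distribution of $\{(A_t,S_t)\}_{t\ge0}$ in the data process. $$\omega^{\pi}(a,s)=\frac{(1-\gamma)\sum_{t\ge0}\gamma^tp_t^{\pi}(a,s)}{p_\infty(a,s)},\qquad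 \tau^{\pi}(a,s,a_0,s_0)=\frac{(1-\gamma)\{\mathcal{I}(a=a_0,s=s_0)+\sum_{t\ge1}\gamma^tp_t^{\pi}(a,s\mid a_0,s_0)\}}{p_\infty(a,s)},$$ where $p_t^{\pi}(a,s)$ is the probability of $(A_t,S_t)=(a,s)$ following $\pi$ with $S_0\sim\mathbb{G}$, $p_t^\pi(a,s\mid a_0,s_0)$ is the probability of $(A_t,S_t)=(a,s)$ following $\pi$ given $(A_0,S_0)=(a_0,s_0)$, and $\mathcal{I}$ is the indicator. These are understood as genuine density ratios (numerator zero wherever $p_\infty$ is zero). Estimator. Randomly divide $\{1,\dots,n\}$ into a fixed number $\mathbb{K}\ge2$ of disjoint nonempty subsets $\mathbb{I}_1,\dots,\mathbb{I}_{\mathbb{K}}$. For each $k$, $\widehat{Q}_k,\widehat{\tau}_k,\widehat{\omega}_k$ are estimators of $Q^{\pi},\tau^{\pi},\omega^{\pi}$ computed only from trajectories outside $\mathbb{I}_k$. For $i\in\mathbb{I}_k$, $0\le t<T$, and a function $Q(a,s)$, the individual debiasing operator is $$\mathcal{D}_k^{(i,t)}Q(a,s)=Q(a,s)+\frac{1}{1-\gamma}\widehat{\tau}_k(A_{i,t},S_{i,t},a,s)\{R_{i,t}+\gamma\mathbb{E}_{a'\sim\pi(\cdot\mid S_{i,t+1})}Q(a',S_{i,t+1})-Q(A_{i,t},S_{i,t})\}.$$ $\widehat{Q}_k^{(m)}$ is the average of $\mathcal{D}_k^{(i_1,t_1)}\cdots\mathcal{D}_k^{(i_{m-1},t_{m-1})}\widehat{Q}_k$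 over all ordered $(m-1)$-tuples of pairwise distinct indices $(i_1,t_1),\dots,(i_{m-1},t_{m-1})$ in $\{(i,t):i\in\mathbb{I}_k,0\le t<T\}$ (assume $|\mathbb{I}_k|T\ge m-1$). For $i\in\mathbb{I}_k$, $$\psi^{(m)}_{i,t}=\frac{1}{1-\gamma}\widehat{\omega}_k(A_{i,t},S_{i,t})\{R_{i,t}-\widehat{Q}^{(m)}_k(A_{i,t},S_{i,t})+\gamma\mathbb{E}_{a\sim\pi(\cdot\mid S_{i,t+1})}\widehat{Q}^{(m)}_k(a,S_{i,t+1})\}+\mathbb{E}_{s\sim\mathbb{G},a\sim\pi(\cdot\mid s)}\widehat{Q}^{(m)}_k(a,s),$$ and $\widehat{\eta}^{(m)}_{\mathrm{TR}}=(nT)^{-1}\sum_{i=1}^n\sum_{t=0}^{T-1}\psi^{(m)}_{i,t}$. $L_2$-norm convergence. $\widehat{Q}_k$ (resp. $\widehat{\omega}_k$) converges in $L_2$-norm to $Q^\pi$ (resp. $\omega^{\pi}$) if $\mathbb{E}_{(a,s)\sim p_\infty}\mathbb{E}|\widehat{Q}_k(a,s)-Q^{\pi}(a,s)|^2\to0$ (resp. with $\widehat\omega_k,\omega^\pi$); $\widehat{\tau}_k$ converges in $L_2$-norm to $\tau^{\pi}$ if $\mathbb{E}_{(a,s)\sim p_\infty}\mathbb{E}_{(a^*,s^* )\sim p_\infty}\mathbb{E}|\widehat{\tau}_k(a,s,a^*,s^* )-\tau^{\pi}(a,s,a^*,s^* )|^2\to0$, where the two outer expectations are over independent draws and the inner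 one over the estimator's training data. *)

theory Defs
  imports "HOL-Probability.Probability" "HOL-Library.Landau_Symbols"
begin

type_synonym ('s, 'a) step = "'s \<times> 'a \<times> real"

definition step_space :: "('s, 'a) step measure" where
  "step_space = count_space UNIV \<Otimes>\<^sub>M (count_space UNIV \<Otimes>\<^sub>M borel)"

abbreviation St :: "('s, 'a) step \<Rightarrow> 's" where "St z \<equiv> fst z"
abbreviation Ac :: "('s, 'a) step \<Rightarrow> 'a" where "Ac z \<equiv> fst (snd z)"
abbreviation Rw :: "('s, 'a) step \<Rightarrow> real" where "Rw z \<equiv> snd (snd z)"

definition sigma_steps :: "'w measure \<Rightarrow> (nat \<Rightarrow> 'w \<Rightarrow> ('s, 'a) step) \<Rightarrow> nat set \<Rightarrow> 'w measure" where
  "sigma_steps M X J =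
     vimage_algebra (space M) (\<lambda>\<omega>. \<lambda>j\<in>J. X j \<omega>) (Pi\<^sub>M J (\<lambda>_. step_space))"

definition sigma_hist_S :: "'w measure \<Rightarrow> (nat \<Rightarrow> 'w \<Rightarrow> ('s, 'a) step) \<Rightarrow> nat \<Rightarrow> 'w measure" where
  "sigma_hist_S M X t =
     vimage_algebra (space M) (\<lambda>\<omega>. (St (X t \<omega>), \<lambda>j\<in>{..<t}. X j \<omega>))
       (count_space UNIV \<Otimes>\<^sub>M Pi\<^sub>M {..<t} (\<lambda>_. step_space))"

definition sigma_hist_SA :: "'w measure \<Rightarrow> (nat \<Rightarrow> 'w \<Rightarrow> ('s, 'a) step) \<Rightarrow> nat \<Rightarrow> 'w measure" where
  "sigma_hist_SA M X t =
     vimage_algebra (space M) (\<lambda>\<omega>. ((St (X t \<omega>), Ac (X t \<omega>)), \<lambda>j\<in>{..<t}. X j \<omega>))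
       ((count_space UNIV \<Otimes>\<^sub>M count_space UNIV) \<Otimes>\<^sub>M Pi\<^sub>M {..<t} (\<lambda>_. step_space))"

text \<open>The transition kernel is p (current action) (current state); the behavior policy b
  receives the time, the history strictly before it, and the current state. It may thus depend
  on the history.\<close>
definition mdp_trajectory ::
  "'w measure \<Rightarrow> ('a \<Rightarrow> 's \<Rightarrow> 's pmf) \<Rightarrow> ('a \<Rightarrow> 's \<Rightarrow> real)
    \<Rightarrow> (nat \<Rightarrow> (nat \<Rightarrow> ('s, 'a) step) \<Rightarrow> 's \<Rightarrow> 'a pmf)
    \<Rightarrow> (nat \<Rightarrow> 'w \<Rightarrow> ('s, 'a) step) \<Rightarrow> bool" where
  "mdp_trajectory M p r b X \<longleftrightarrow>
     (\<forall>t. X t \<in> measurable M step_space) \<and>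
     (\<forall>t a. AE \<omega> in M.
        real_cond_exp M (sigma_hist_S M X t) (indicator {\<omega> \<in> space M. Ac (X t \<omega>) = a}) \<omega>
          = pmf (b t (\<lambda>j\<in>{..<t}. X j \<omega>) (St (X t \<omega>))) a) \<and>
     (\<forall>t. AE \<omega> in M.
        real_cond_exp M (sigma_hist_SA M X t) (\<lambda>\<omega>. Rw (X t \<omega>)) \<omega>
          = r (Ac (X t \<omega>)) (St (X t \<omega>))) \<and>
     (\<forall>t s. AE \<omega> in M.
        real_cond_exp M (sigma_steps M X {..t}) (indicator {\<omega> \<in> space M. St (X (Suc t) \<omega>) = s}) \<omega>
          = pmf (p (Ac (X t \<omega>)) (St (X t \<omega>))) s)"

definition strictly_stationary :: "'w measure \<Rightarrow> (nat \<Rightarrow> 'w \<Rightarrow> ('s, 'a) step) \<Rightarrow> bool" where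
  "strictly_stationary M X \<longleftrightarrow>
     (\<forall>h. distr M (Pi\<^sub>M UNIV (\<lambda>_. step_space)) (\<lambda>\<omega> t. X (t + h) \<omega>)
        = distr M (Pi\<^sub>M UNIV (\<lambda>_. step_space)) (\<lambda>\<omega> t. X t \<omega>))"

text \<open>The absolute regularity coefficient of two sigma-algebras: the supremum over pairs of
  finite partitions. On a probability space the sums lie in the interval from 0 to 2, so the real
  supremum is the genuine one.\<close>
definition beta_coeff :: "'w measure \<Rightarrow> 'w measure \<Rightarrow> 'w measure \<Rightarrow> real" where
  "beta_coeff M F G =
     (SUP (U, V) \<in> {(U, V). finite U \<and> U \<subseteq> sets F \<and> partition_on (space M) U \<and>
                           finite V \<and> V \<subseteq> sets G \<and> partition_on (space M) V}.
        (1 / 2) * (\<Sum>A\<in>U. \<Sum>B\<in>V. \<bar>measure M (A \<inter> B) - measure M A * measure M B\<bar>))"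

definition beta_mixing :: "'w measure \<Rightarrow> (nat \<Rightarrow> 'w \<Rightarrow> ('s, 'a) step) \<Rightarrow> nat \<Rightarrow> real" where
  "beta_mixing M X q =
     (SUP t. beta_coeff M (sigma_steps M X {..t}) (sigma_steps M X {t + q..}))"

definition exponentially_beta_mixing :: "'w measure \<Rightarrow> (nat \<Rightarrow> 'w \<Rightarrow> ('s, 'a) step) \<Rightarrow> bool" where
  "exponentially_beta_mixing M X \<longleftrightarrow>
     (\<exists>\<rho>. 0 < \<rho> \<and> \<rho> < 1 \<and> (\<lambda>q. beta_mixing M X q) \<in> O(\<lambda>q. \<rho> ^ q))"

definition limiting_sa_distribution ::
  "'w measure \<Rightarrow> (nat \<Rightarrow> 'w \<Rightarrow> ('s, 'a) step) \<Rightarrow> ('a \<times> 's) pmf \<Rightarrow> bool" where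
  "limiting_sa_distribution M X p_lim \<longleftrightarrow>
     (\<forall>a s. (\<lambda>t. measure M {\<omega> \<in> space M. Ac (X t \<omega>) = a \<and> St (X t \<omega>) = s})
        \<longlonglongrightarrow> pmf p_lim (a, s))"

definition iid_trajectories :: "'w measure \<Rightarrow> (nat \<Rightarrow> nat \<Rightarrow> 'w \<Rightarrow> ('s, 'a) step) \<Rightarrow> bool" where
  "iid_trajectories M X \<longleftrightarrow>
     prob_space.indep_vars M (\<lambda>_. Pi\<^sub>M UNIV (\<lambda>_. step_space)) (\<lambda>i \<omega> t. X i t \<omega>) UNIV \<and>
     (\<forall>i. distr M (Pi\<^sub>M UNIV (\<lambda>_. step_space)) (\<lambda>\<omega> t. X i t \<omega>)
        = distr M (Pi\<^sub>M UNIV (\<lambda>_. step_space)) (\<lambda>\<omega> t. X 0 t \<omega>))"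

definition draw_action :: "('s \<Rightarrow> 'a pmf) \<Rightarrow> 's \<Rightarrow> ('a \<times> 's) pmf" where
  "draw_action \<pi> s = map_pmf (\<lambda>a. (a, s)) (\<pi> s)"

text \<open>The law of (A_t, S_t) when actions follow pi and (A_0, S_0) has law mu.\<close>
primrec sa_law ::
  "('a \<Rightarrow> 's \<Rightarrow> 's pmf) \<Rightarrow> ('s \<Rightarrow> 'a pmf) \<Rightarrow> ('a \<times> 's) pmf \<Rightarrow> nat \<Rightarrow> ('a \<times> 's) pmf" where
  "sa_law p \<pi> \<mu> 0 = \<mu>"
| "sa_law p \<pi> \<mu> (Suc t) =
     bind_pmf (sa_law p \<pi> \<mu> t) (\<lambda>(a, s). bind_pmf (p a s) (draw_action \<pi>))"

text \<open>The discounted sum over t of gamma^t times the expectation of R_t under pi, where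
  (A_0, S_0) has law mu. By the reward model, the expectation of R_t is that of r(A_t, S_t).\<close>
definition discounted_reward ::
  "('a \<Rightarrow> 's \<Rightarrow> 's pmf) \<Rightarrow> ('a \<Rightarrow> 's \<Rightarrow> real) \<Rightarrow> real \<Rightarrow> ('s \<Rightarrow> 'a pmf) \<Rightarrow> ('a \<times> 's) pmf \<Rightarrow> real" where
  "discounted_reward p r \<gamma> \<pi> \<mu> =
     (\<Sum>t. \<gamma> ^ t * measure_pmf.expectation (sa_law p \<pi> \<mu> t) (\<lambda>(a, s). r a s))"

definition Q_fun ::
  "('a \<Rightarrow> 's \<Rightarrow> 's pmf) \<Rightarrow> ('a \<Rightarrow> 's \<Rightarrow> real) \<Rightarrow> real \<Rightarrow> ('s \<Rightarrow> 'a pmf) \<Rightarrow> 'a \<Rightarrow> 's \<Rightarrow> real" where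
  "Q_fun p r \<gamma> \<pi> a s = discounted_reward p r \<gamma> \<pi> (return_pmf (a, s))"

definition V_fun ::
  "('a \<Rightarrow> 's \<Rightarrow> 's pmf) \<Rightarrow> ('a \<Rightarrow> 's \<Rightarrow> real) \<Rightarrow> real \<Rightarrow> ('s \<Rightarrow> 'a pmf) \<Rightarrow> 's \<Rightarrow> real" where
  "V_fun p r \<gamma> \<pi> s = discounted_reward p r \<gamma> \<pi> (draw_action \<pi> s)"

definition policy_value ::
  "('a \<Rightarrow> 's \<Rightarrow> 's pmf) \<Rightarrow> ('a \<Rightarrow> 's \<Rightarrow> real) \<Rightarrow> real \<Rightarrow> ('s \<Rightarrow> 'a pmf) \<Rightarrow> 's pmf \<Rightarrow> real" where
  "policy_value p r \<gamma> \<pi> \<G> = measure_pmf.expectation \<G> (V_fun p r \<gamma> \<pi>)"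

definition omega_num ::
  "('a \<Rightarrow> 's \<Rightarrow> 's pmf) \<Rightarrow> real \<Rightarrow> ('s \<Rightarrow> 'a pmf) \<Rightarrow> 's pmf \<Rightarrow> 'a \<Rightarrow> 's \<Rightarrow> real" where
  "omega_num p \<gamma> \<pi> \<G> a s =
     (1 - \<gamma>) * (\<Sum>t. \<gamma> ^ t * pmf (sa_law p \<pi> (bind_pmf \<G> (draw_action \<pi>)) t) (a, s))"

definition tau_num ::
  "('a \<Rightarrow> 's \<Rightarrow> 's pmf) \<Rightarrow> real \<Rightarrow> ('s \<Rightarrow> 'a pmf) \<Rightarrow> 'a \<Rightarrow> 's \<Rightarrow> 'a \<Rightarrow> 's \<Rightarrow> real" where
  "tau_num p \<gamma> \<pi> a s a\<^sub>0 s\<^sub>0 =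
     (1 - \<gamma>) * ((if a = a\<^sub>0 \<and> s = s\<^sub>0 then 1 else 0)
       + (\<Sum>t. \<gamma> ^ Suc t * pmf (sa_law p \<pi> (return_pmf (a\<^sub>0, s\<^sub>0)) (Suc t)) (a, s)))"

definition omega_ratio ::
  "('a \<Rightarrow> 's \<Rightarrow> 's pmf) \<Rightarrow> real \<Rightarrow> ('s \<Rightarrow> 'a pmf) \<Rightarrow> 's pmf \<Rightarrow> ('a \<times> 's) pmf
    \<Rightarrow> 'a \<Rightarrow> 's \<Rightarrow> real" where
  "omega_ratio p \<gamma> \<pi> \<G> p_lim a s = omega_num p \<gamma> \<pi> \<G> a s / pmf p_lim (a, s)"

definition tau_ratio ::
  "('a \<Rightarrow> 's \<Rightarrow> 's pmf) \<Rightarrow> real \<Rightarrow> ('s \<Rightarrow> 'a pmf) \<Rightarrow> ('a \<times> 's) pmf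
    \<Rightarrow> 'a \<Rightarrow> 's \<Rightarrow> 'a \<Rightarrow> 's \<Rightarrow> real" where
  "tau_ratio p \<gamma> \<pi> p_lim a s a\<^sub>0 s\<^sub>0 = tau_num p \<gamma> \<pi> a s a\<^sub>0 s\<^sub>0 / pmf p_lim (a, s)"

text \<open>The numerators vanish wherever the denominator does. For tau this is asked of initial pairs
  in the support of the limiting distribution: at any other initial pair the numerator is at least
  1 - gamma on the diagonal, where the denominator is zero.\<close>
definition genuine_density_ratios ::
  "('a \<Rightarrow> 's \<Rightarrow> 's pmf) \<Rightarrow> real \<Rightarrow> ('s \<Rightarrow> 'a pmf) \<Rightarrow> 's pmf \<Rightarrow> ('a \<times> 's) pmf \<Rightarrow> bool" where
  "genuine_density_ratios p \<gamma> \<pi> \<G> p_lim \<longleftrightarrow>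
     (\<forall>a s. pmf p_lim (a, s) = 0 \<longrightarrow> omega_num p \<gamma> \<pi> \<G> a s = 0) \<and>
     (\<forall>a\<^sub>0 s\<^sub>0. (a\<^sub>0, s\<^sub>0) \<in> set_pmf p_lim \<longrightarrow>
        (\<forall>a s. pmf p_lim (a, s) = 0 \<longrightarrow> tau_num p \<gamma> \<pi> a s a\<^sub>0 s\<^sub>0 = 0))"

text \<open>An observation is a tuple (S_t, A_t, R_t, S_(t+1)).\<close>
type_synonym ('s, 'a) obs = "'s \<times> 'a \<times> real \<times> 's"

definition obs_space :: "('s, 'a) obs measure" where
  "obs_space = count_space UNIV \<Otimes>\<^sub>M (count_space UNIV \<Otimes>\<^sub>M (borel \<Otimes>\<^sub>M count_space UNIV))"

definition observed :: "(nat \<Rightarrow> nat \<Rightarrow> 'w \<Rightarrow> ('s, 'a) step) \<Rightarrow> 'w \<Rightarrow> nat \<Rightarrow> nat \<Rightarrow> ('s, 'a) obs" where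
  "observed X \<omega> i t =
     (St (X i t \<omega>), Ac (X i t \<omega>), Rw (X i t \<omega>), St (X i (Suc t) \<omega>))"

text \<open>A division of the n trajectories into K labelled nonempty subsets is encoded by the map
  sending a trajectory index to the label of its subset. Indices and labels start at 0.\<close>
definition fold_assignments :: "nat \<Rightarrow> nat \<Rightarrow> (nat \<Rightarrow> nat) set" where
  "fold_assignments n K =
     {F \<in> {..<n} \<rightarrow>\<^sub>E {..<K}. \<forall>k<K. \<exists>i<n. F i = k}"

definition fold_set :: "nat \<Rightarrow> (nat \<Rightarrow> nat) \<Rightarrow> nat \<Rightarrow> nat set" where
  "fold_set n F k = {i. i < n \<and> F i = k}"

definition training_set :: "nat \<Rightarrow> (nat \<Rightarrow> nat) \<Rightarrow> nat \<Rightarrow> nat set" where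
  "training_set n F k = {i. i < n \<and> F i \<noteq> k}"

definition training_data ::
  "nat \<Rightarrow> nat \<Rightarrow> (nat \<Rightarrow> nat) \<Rightarrow> nat \<Rightarrow> (nat \<Rightarrow> nat \<Rightarrow> ('s, 'a) obs) \<Rightarrow> nat \<Rightarrow> nat \<Rightarrow> ('s, 'a) obs" where
  "training_data n T F k D = (\<lambda>i\<in>training_set n F k. \<lambda>t\<in>{..<T}. D i t)"

definition training_space ::
  "nat \<Rightarrow> nat \<Rightarrow> (nat \<Rightarrow> nat) \<Rightarrow> nat \<Rightarrow> (nat \<Rightarrow> nat \<Rightarrow> ('s, 'a) obs) measure" where
  "training_space n T F k =
     Pi\<^sub>M (training_set n F k) (\<lambda>_. Pi\<^sub>M {..<T} (\<lambda>_. obs_space))"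

text \<open>The estimator est j k f, applied to the training data of fold k under the random division F j,
  where j indexes the asymptotic regime (n j trajectories of length T j).\<close>
definition fitted ::
  "(nat \<Rightarrow> nat) \<Rightarrow> (nat \<Rightarrow> nat) \<Rightarrow> (nat \<Rightarrow> 'w \<Rightarrow> nat \<Rightarrow> nat) \<Rightarrow> (nat \<Rightarrow> nat \<Rightarrow> 'w \<Rightarrow> ('s, 'a) step)
    \<Rightarrow> (nat \<Rightarrow> nat \<Rightarrow> (nat \<Rightarrow> nat) \<Rightarrow> (nat \<Rightarrow> nat \<Rightarrow> ('s, 'a) obs) \<Rightarrow> 'b) \<Rightarrow> nat \<Rightarrow> nat \<Rightarrow> 'w \<Rightarrow> 'b" where
  "fitted n T F X est k j \<omega> =
     est j k (F j \<omega>) (training_data (n j) (T j) (F j \<omega>) k (observed X \<omega>))"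

definition random_division ::
  "'w measure \<Rightarrow> (nat \<Rightarrow> nat \<Rightarrow> 'w \<Rightarrow> ('s, 'a) step) \<Rightarrow> nat \<Rightarrow> nat \<Rightarrow> ('w \<Rightarrow> nat \<Rightarrow> nat) \<Rightarrow> bool" where
  "random_division M X n K F \<longleftrightarrow>
     F \<in> measurable M (count_space (fold_assignments n K)) \<and>
     prob_space.indep_set M
       (sets (vimage_algebra (space M) F (count_space (fold_assignments n K))))
       (sets (vimage_algebra (space M) (\<lambda>\<omega> i t. X i t \<omega>)
          (Pi\<^sub>M UNIV (\<lambda>_. Pi\<^sub>M UNIV (\<lambda>_. step_space)))))"

definition debias ::
  "real \<Rightarrow> ('s \<Rightarrow> 'a pmf) \<Rightarrow> ('a \<Rightarrow> 's \<Rightarrow> 'a \<Rightarrow> 's \<Rightarrow> real) \<Rightarrow> ('s, 'a) obs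
    \<Rightarrow> ('a \<Rightarrow> 's \<Rightarrow> real) \<Rightarrow> 'a \<Rightarrow> 's \<Rightarrow> real" where
  "debias \<gamma> \<pi> \<tau> z Q a s =
     (case z of (s', a', r', s'') \<Rightarrow>
        Q a s + 1 / (1 - \<gamma>) * \<tau> a' s' a s *
          (r' + \<gamma> * measure_pmf.expectation (\<pi> s'') (\<lambda>x. Q x s'') - Q a' s'))"

definition index_tuples :: "nat set \<Rightarrow> nat \<Rightarrow> nat \<Rightarrow> (nat \<times> nat) list set" where
  "index_tuples I T l = {xs. length xs = l \<and> distinct xs \<and> set xs \<subseteq> I \<times> {..<T}}"

definition debiased_Q ::
  "real \<Rightarrow> ('s \<Rightarrow> 'a pmf) \<Rightarrow> nat \<Rightarrow> nat set \<Rightarrow> nat \<Rightarrow> (nat \<Rightarrow> nat \<Rightarrow> ('s, 'a) obs)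
    \<Rightarrow> ('a \<Rightarrow> 's \<Rightarrow> 'a \<Rightarrow> 's \<Rightarrow> real) \<Rightarrow> ('a \<Rightarrow> 's \<Rightarrow> real) \<Rightarrow> 'a \<Rightarrow> 's \<Rightarrow> real" where
  "debiased_Q \<gamma> \<pi> m I T D \<tau> Q a s =
     (\<Sum>xs\<in>index_tuples I T (m - 1). foldr (\<lambda>(i, t). debias \<gamma> \<pi> \<tau> (D i t)) xs Q a s)
       / real (card (index_tuples I T (m - 1)))"

definition psi ::
  "real \<Rightarrow> ('s \<Rightarrow> 'a pmf) \<Rightarrow> 's pmf \<Rightarrow> ('a \<Rightarrow> 's \<Rightarrow> real) \<Rightarrow> ('a \<Rightarrow> 's \<Rightarrow> real)
    \<Rightarrow> ('s, 'a) obs \<Rightarrow> real" where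
  "psi \<gamma> \<pi> \<G> w Q z =
     (case z of (s, a, r', s') \<Rightarrow>
        1 / (1 - \<gamma>) * w a s *
          (r' - Q a s + \<gamma> * measure_pmf.expectation (\<pi> s') (\<lambda>x. Q x s'))
        + measure_pmf.expectation \<G> (\<lambda>x. measure_pmf.expectation (\<pi> x) (\<lambda>y. Q y x)))"

text \<open>The value estimator for the division F and observations D, where Qh k, th k and wh k are the
  fitted functions of fold k.\<close>
definition eta_TR ::
  "real \<Rightarrow> ('s \<Rightarrow> 'a pmf) \<Rightarrow> 's pmf \<Rightarrow> nat \<Rightarrow> nat \<Rightarrow> nat \<Rightarrow> (nat \<Rightarrow> nat) \<Rightarrow> (nat \<Rightarrow> nat \<Rightarrow> ('s, 'a) obs)
    \<Rightarrow> (nat \<Rightarrow> 'a \<Rightarrow> 's \<Rightarrow> real) \<Rightarrow> (nat \<Rightarrow> 'a \<Rightarrow> 's \<Rightarrow> 'a \<Rightarrow> 's \<Rightarrow> real) \<Rightarrow> (nat \<Rightarrow> 'a \<Rightarrow> 's \<Rightarrow> real)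
    \<Rightarrow> real" where
  "eta_TR \<gamma> \<pi> \<G> m n T F D Qh th wh =
     1 / (real n * real T) *
       (\<Sum>i<n. \<Sum>t<T. psi \<gamma> \<pi> \<G> (wh (F i))
          (debiased_Q \<gamma> \<pi> m (fold_set n F (F i)) T D (th (F i)) (Qh (F i))) (D i t))"

text \<open>The integrals are extended nonnegative ones, so that an infinite error is not read as 0.\<close>
definition L2_converges ::
  "'w measure \<Rightarrow> ('a \<times> 's) pmf \<Rightarrow> (nat \<Rightarrow> 'w \<Rightarrow> 'a \<Rightarrow> 's \<Rightarrow> real) \<Rightarrow> ('a \<Rightarrow> 's \<Rightarrow> real) \<Rightarrow> bool" where
  "L2_converges M p_lim f g \<longleftrightarrow>
     (\<lambda>j. \<integral>\<^sup>+ x. (case x of (a, s) \<Rightarrow> \<integral>\<^sup>+ \<omega>. ennreal (\<bar>f j \<omega> a s - g a s\<bar>\<^sup>2) \<partial>M)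
        \<partial>measure_pmf p_lim) \<longlonglongrightarrow> 0"

definition L2_converges_pair ::
  "'w measure \<Rightarrow> ('a \<times> 's) pmf \<Rightarrow> (nat \<Rightarrow> 'w \<Rightarrow> 'a \<Rightarrow> 's \<Rightarrow> 'a \<Rightarrow> 's \<Rightarrow> real)
    \<Rightarrow> ('a \<Rightarrow> 's \<Rightarrow> 'a \<Rightarrow> 's \<Rightarrow> real) \<Rightarrow> bool" where
  "L2_converges_pair M p_lim f g \<longleftrightarrow>
     (\<lambda>j. \<integral>\<^sup>+ x. (case x of (a, s) \<Rightarrow> \<integral>\<^sup>+ y. (case y of (a', s') \<Rightarrow>
          \<integral>\<^sup>+ \<omega>. ennreal (\<bar>f j \<omega> a s a' s' - g a s a' s'\<bar>\<^sup>2) \<partial>M) \<partial>measure_pmf p_lim)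
        \<partial>measure_pmf p_lim) \<longlonglongrightarrow> 0"

definition converges_in_probability :: "'w measure \<Rightarrow> (nat \<Rightarrow> 'w \<Rightarrow> real) \<Rightarrow> real \<Rightarrow> bool" where
  "converges_in_probability M Y c \<longleftrightarrow>
     (\<forall>j. Y j \<in> borel_measurable M) \<and>
     (\<forall>\<epsilon>>0. (\<lambda>j. measure M {\<omega> \<in> space M. \<bar>Y j \<omega> - c\<bar> > \<epsilon>}) \<longlonglongrightarrow> 0)"

end

theory Submission
  imports Defs
begin

text \<open>
  Since \<open>\<tau>\<close> is at least \<open>(1 - \<gamma>) / p_lim x\<close> on the diagonal, boundedness of \<open>\<tau>\<close> forces
  \<open>p_lim\<close> to have finite support. As the density ratios are genuine, this support is closed
  under steps of the target policy and carries its initial law, so everything takes place in a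
  finite-dimensional space, and the estimators enter only through finitely many bounded numbers.

  Averaging the debiasing operator over the data gives an affine map \<open>Q \<mapsto> Q + mean of (\<tau>-weighted
  temporal-difference errors)\<close>. Its deviation from the population map is controlled, uniformly in the
  bounded estimators, by the sums of finitely many noises: reward noise, transition noise
  (both martingale differences) and visit noise (covariances bounded by the \<open>\<beta>\<close>-mixing
  coefficients). The population map fixes \<open>Q\<^sup>\<pi>\<close>, whatever the weight, and sends everything to
  \<open>Q\<^sup>\<pi>\<close> if the weight is \<open>\<tau>\<close>; the population value functional is \<open>\<eta>\<^sup>\<pi>\<close> at \<open>Q\<^sup>\<pi>\<close> for every weight
  and \<open>\<eta>\<^sup>\<pi>\<close> everywhere if the weight is \<open>\<omega>\<close>. Restricting to pairwise distinct indices costs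
  \<open>O(1 / N)\<close>. A fold may stay small when \<open>n\<close> grows, but then its share of the estimator vanishes:
  the noise of a fold is compared with \<open>n T\<close>, not with the size of the fold.
\<close>

section \<open>Evaluation on a finite support\<close>

text \<open>The obstacle is that \<open>debiased_Q\<close> averages compositions of operators that
  share random fitted functions. The deterministic half, ending in \<open>eta_TR_close\<close>,
  therefore works at one sample point: it bounds the error for all fitted functions bounded by
  \<open>C\<close> at once, in terms of sums of a finite family \<open>noises\<close> of fixed
  functions of an observation. Fitted functions can then be inserted pointwise, and probability is
  needed only for the sums of the noises over a fold. Compositions become tractable through means
  over all tuples, repetitions allowed: the outermost index is then free, and since a
  temporal-difference error is affine in \<open>Q\<close>, the mean over the inner indices moves
  inside it. This gives an exact recursion. Each robustness case supplies an error \<open>e\<close>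
  on the support, and the three cases share their constants, so different folds may fall under
  different cases. Convergence is in mean square until the last step, because the noise bounds and
  the assumed convergences come in this form and it survives finite sums.\<close>

locale finite_support_evaluation =
  fixes p :: "'a \<Rightarrow> 's \<Rightarrow> 's pmf" and r :: "'a \<Rightarrow> 's \<Rightarrow> real" and \<gamma> :: real
    and \<pi> :: "'s \<Rightarrow> 'a pmf" and \<G> :: "'s pmf" and p_lim :: "('a \<times> 's) pmf" and Cr :: real
  assumes gamma_pos: "0 < \<gamma>" and gamma_less_1: "\<gamma> < 1"
    and r_bound: "\<And>a s. \<bar>r a s\<bar> \<le> Cr"
    and genuine: "genuine_density_ratios p \<gamma> \<pi> \<G> p_lim"
    and tau_bounded: "\<exists>C. \<forall>a s a\<^sub>0 s\<^sub>0. \<bar>tau_ratio p \<gamma> \<pi> p_lim a s a\<^sub>0 s\<^sub>0\<bar> \<le> C"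
begin

section \<open>The target chain, its occupancies, and the support of \<open>p_lim\<close>\<close>

definition step_law :: "'a \<times> 's \<Rightarrow> ('a \<times> 's) pmf" where
  "step_law x = bind_pmf (p (fst x) (snd x)) (draw_action \<pi>)"

text \<open>Up to the factor \<open>1 - \<gamma>\<close>, the numerators of both density ratios are
  occupancies: of the initial law for \<omega>, of a point mass for \<tau>.\<close>

definition occupancy :: "('a \<times> 's) pmf \<Rightarrow> 'a \<times> 's \<Rightarrow> real" where
  "occupancy \<mu> x = (\<Sum>t. \<gamma> ^ t * pmf (sa_law p \<pi> \<mu> t) x)"

lemma sa_law_Suc: "sa_law p \<pi> \<mu> (Suc t) = bind_pmf (sa_law p \<pi> \<mu> t) step_law"
  by (simp add: step_law_def [abs_def] case_prod_beta')

text \<open>The recursion of \<open>sa_law\<close> appends a step at the end; here the extra step is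
  moved to the front. This form peels off the first step in the Bellman equation.\<close>

lemma sa_law_Suc': "sa_law p \<pi> \<mu> (Suc t) = sa_law p \<pi> (bind_pmf \<mu> step_law) t"
  by (induction t) (simp_all add: sa_law_Suc del: sa_law.simps(2))

lemma sa_law_bind: "sa_law p \<pi> \<mu> t = bind_pmf \<mu> (\<lambda>x. sa_law p \<pi> (return_pmf x) t)"
  by (induction t) (simp_all add: sa_law_Suc bind_return_pmf' bind_assoc_pmf del: sa_law.simps(2))

lemma summable_geometric_bounded:
  assumes "\<And>t. \<bar>f t\<bar> \<le> (c::real)"
  shows "summable (\<lambda>t. \<gamma> ^ t * f t)"
proof (rule summable_comparison_test[OF _ summable_mult2])
  show "\<exists>N. \<forall>n\<ge>N. norm (\<gamma> ^ n * f n) \<le> \<gamma> ^ n * c"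
    using assms gamma_pos by (auto simp: abs_mult intro!: mult_left_mono)
  show "summable (\<lambda>n. \<gamma> ^ n)"
    using gamma_pos gamma_less_1 by (intro summable_geometric) auto
qed

lemma summable_occupancy: "summable (\<lambda>t. \<gamma> ^ t * pmf (sa_law p \<pi> \<mu> t) x)"
  by (rule summable_geometric_bounded[of _ 1]) (simp add: pmf_le_1)

text \<open>A series of nonnegative terms dominates each of them. The term \<open>t = 0\<close>
  yields the bound on the diagonal of \<tau> and the support of the initial law;
  \<open>t = 1\<close> yields closure under a step.\<close>

lemma occupancy_ge: "\<gamma> ^ t * pmf (sa_law p \<pi> \<mu> t) x \<le> occupancy \<mu> x"
proof -
  have "(\<Sum>t\<in>{t}. \<gamma> ^ t * pmf (sa_law p \<pi> \<mu> t) x) \<le> occupancy \<mu> x"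
    unfolding occupancy_def by (rule sum_le_suminf[OF summable_occupancy]) (use gamma_pos in auto)
  then show ?thesis by simp
qed

lemma tau_num_eq_occupancy:
  "tau_num p \<gamma> \<pi> a s a\<^sub>0 s\<^sub>0 = (1 - \<gamma>) * occupancy (return_pmf (a\<^sub>0, s\<^sub>0)) (a, s)"
proof -
  have "occupancy (return_pmf (a\<^sub>0, s\<^sub>0)) (a, s) =
    pmf (return_pmf (a\<^sub>0, s\<^sub>0)) (a, s) + (\<Sum>t. \<gamma> ^ Suc t * pmf (sa_law p \<pi> (return_pmf (a\<^sub>0, s\<^sub>0)) (Suc t)) (a, s))"
    unfolding occupancy_def using suminf_split_head[OF summable_occupancy, of "return_pmf (a\<^sub>0, s\<^sub>0)" "(a, s)"]
    by simp
  then show ?thesis unfolding tau_num_def by (auto simp: indicator_def)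
qed

lemma omega_num_eq_occupancy:
  "omega_num p \<gamma> \<pi> \<G> a s = (1 - \<gamma>) * occupancy (bind_pmf \<G> (draw_action \<pi>)) (a, s)"
  unfolding omega_num_def occupancy_def ..

text \<open>On the diagonal the ratio \<open>\<tau>\<close> is at least \<open>(1 - \<gamma>) / p_lim x\<close>, so its boundedness keeps the
  atoms of \<open>p_lim\<close> away from zero.\<close>
lemma finite_support: "finite (set_pmf p_lim)"
proof -
  obtain C where C: "\<And>a s a\<^sub>0 s\<^sub>0. \<bar>tau_ratio p \<gamma> \<pi> p_lim a s a\<^sub>0 s\<^sub>0\<bar> \<le> C"
    using tau_bounded by blast
  have lower: "1 - \<gamma> \<le> C * pmf p_lim x" if "x \<in> set_pmf p_lim" for x
  proof -
    obtain a s where x: "x = (a, s)" by (cases x)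
    have pos: "0 < pmf p_lim x" using that by (simp add: pmf_positive)
    have "1 \<le> occupancy (return_pmf x) x" using occupancy_ge[of 0 "return_pmf x" x] by simp
    then have "1 - \<gamma> \<le> (1 - \<gamma>) * occupancy (return_pmf x) x" using gamma_less_1 by simp
    also have "\<dots> = tau_ratio p \<gamma> \<pi> p_lim a s a s * pmf p_lim x"
      using pos by (simp add: tau_ratio_def tau_num_eq_occupancy x)
    also have "\<dots> \<le> C * pmf p_lim x"
      using C[of a s a s] pos by (intro mult_right_mono) auto
    finally show ?thesis .
  qed
  have bound: "real (card A) * (1 - \<gamma>) \<le> C" if "finite A" "A \<subseteq> set_pmf p_lim" for A
  proof -
    have C0: "0 \<le> C" using C[of undefined undefined undefined undefined] by linarith
    have "real (card A) * (1 - \<gamma>) = (\<Sum>x\<in>A. 1 - \<gamma>)" by simp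
    also have "\<dots> \<le> (\<Sum>x\<in>A. C * pmf p_lim x)" by (rule sum_mono) (use lower that in auto)
    also have "\<dots> = C * measure p_lim A"
      using that by (simp add: sum_distrib_left measure_measure_pmf_finite)
    also have "\<dots> \<le> C * 1" by (intro mult_left_mono C0) simp
    finally show ?thesis by simp
  qed
  show ?thesis
  proof (rule ccontr)
    assume inf: "infinite (set_pmf p_lim)"
    obtain k :: nat where k: "C / (1 - \<gamma>) < real k" using reals_Archimedean2 by blast
    obtain A where "finite A" "A \<subseteq> set_pmf p_lim" "card A = k"
      using infinite_arbitrarily_large[OF inf, of k] by blast
    then show False using bound[of A] k gamma_less_1 by (simp add: field_simps)
  qed
qed

text \<open>Outside the support the numerator of \<tau> started at \<open>x\<close> vanishes, hence
  so does its term at time 1, which is a positive multiple of the probability of stepping from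
  \<open>x\<close> to \<open>y\<close>.\<close>

lemma step_in_support:
  assumes x: "x \<in> set_pmf p_lim" and y: "y \<in> set_pmf (step_law x)"
  shows "y \<in> set_pmf p_lim"
proof (rule ccontr)
  assume "y \<notin> set_pmf p_lim"
  then have "tau_num p \<gamma> \<pi> (fst y) (snd y) (fst x) (snd x) = 0"
    using genuine x unfolding genuine_density_ratios_def by (metis pmf_eq_0_set_pmf prod.collapse)
  then have "occupancy (return_pmf x) y = 0"
    using gamma_less_1 by (simp add: tau_num_eq_occupancy)
  moreover have "\<gamma> ^ 1 * pmf (sa_law p \<pi> (return_pmf x) 1) y = \<gamma> * pmf (step_law x) y"
    by (simp add: sa_law_Suc bind_return_pmf del: sa_law.simps(2))
  moreover have "0 < \<gamma> * pmf (step_law x) y"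
    using y gamma_pos by (simp add: pmf_positive)
  ultimately show False using occupancy_ge[of 1 "return_pmf x" y] by linarith
qed

text \<open>The same argument with the numerator of \<omega> and its term at time 0.\<close>

lemma initial_in_support:
  assumes "s \<in> set_pmf \<G>" and "a \<in> set_pmf (\<pi> s)"
  shows "(a, s) \<in> set_pmf p_lim"
proof (rule ccontr)
  assume "(a, s) \<notin> set_pmf p_lim"
  then have "omega_num p \<gamma> \<pi> \<G> a s = 0"
    using genuine unfolding genuine_density_ratios_def by (metis pmf_eq_0_set_pmf)
  then have "occupancy (bind_pmf \<G> (draw_action \<pi>)) (a, s) = 0"
    using gamma_less_1 by (simp add: omega_num_eq_occupancy)
  moreover have "(a, s) \<in> set_pmf (bind_pmf \<G> (draw_action \<pi>))"
    using assms by (auto simp: draw_action_def)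
  then have "0 < pmf (bind_pmf \<G> (draw_action \<pi>)) (a, s)" by (rule pmf_positive)
  ultimately show False using occupancy_ge[of 0 "bind_pmf \<G> (draw_action \<pi>)" "(a, s)"] by simp
qed

text \<open>The kernel does not depend on the policy, so these are also the next states seen in the
  data, up to a null set. They index the transition noises.\<close>

definition succ_states :: "'s set" where
  "succ_states = (\<Union>x\<in>set_pmf p_lim. set_pmf (p (fst x) (snd x)))"

lemma succ_in_support:
  assumes "s \<in> succ_states" and "a \<in> set_pmf (\<pi> s)"
  shows "(a, s) \<in> set_pmf p_lim"
proof -
  obtain x where x: "x \<in> set_pmf p_lim" "s \<in> set_pmf (p (fst x) (snd x))"
    using assms(1) by (auto simp: succ_states_def)
  have "(a, s) \<in> set_pmf (step_law x)"
    using x(2) assms(2) by (auto simp: step_law_def draw_action_def)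
  then show ?thesis using step_in_support x(1) by blast
qed

text \<open>Some target action has positive probability in each successor state, and the resulting
  pair lies in the finite support.\<close>

lemma finite_succ_states: "finite succ_states"
proof (rule finite_subset)
  show "succ_states \<subseteq> snd ` set_pmf p_lim"
  proof
    fix s assume s: "s \<in> succ_states"
    obtain a where "a \<in> set_pmf (\<pi> s)" using set_pmf_not_empty[of "\<pi> s"] by blast
    then show "s \<in> snd ` set_pmf p_lim" using succ_in_support[OF s] by force
  qed
qed (simp add: finite_support)

lemma sa_law_in_support:
  assumes "set_pmf \<mu> \<subseteq> set_pmf p_lim"
  shows "set_pmf (sa_law p \<pi> \<mu> t) \<subseteq> set_pmf p_lim"
proof (induction t)
  case (Suc t)
  then show ?case by (auto simp: sa_law_Suc simp del: sa_law.simps(2) dest: step_in_support)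
qed (use assms in simp)

text \<open>On a finite support every expectation is a finite sum, so an unbounded \<open>f\<close>
  raises no question of integrability.\<close>

lemma expectation_support:
  fixes f :: "'a \<times> 's \<Rightarrow> real"
  assumes "set_pmf \<mu> \<subseteq> set_pmf p_lim"
  shows "measure_pmf.expectation \<mu> f = (\<Sum>x\<in>set_pmf p_lim. pmf \<mu> x * f x)"
  using assms by (subst integral_measure_pmf[OF finite_support]) auto

section \<open>State values and the one-step operator\<close>

definition state_value :: "('a \<Rightarrow> 's \<Rightarrow> real) \<Rightarrow> 's \<Rightarrow> real" where
  "state_value Q s = measure_pmf.expectation (\<pi> s) (\<lambda>a. Q a s)"

text \<open>The one-step operator of the target chain, written as a sum over
  \<open>succ_states\<close> so that it can be matched term by term with the transition noises. It
  is an expectation under \<open>step_law x\<close> once \<open>x\<close> lies in the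
  support.\<close>

definition next_value :: "('a \<Rightarrow> 's \<Rightarrow> real) \<Rightarrow> 'a \<times> 's \<Rightarrow> real" where
  "next_value Q x = (\<Sum>s\<in>succ_states. pmf (p (fst x) (snd x)) s * state_value Q s)"

lemma state_value_sum:
  assumes "\<And>a. a \<in> set_pmf (\<pi> s) \<Longrightarrow> (a, s) \<in> set_pmf p_lim"
  shows "state_value Q s = (\<Sum>a\<in>fst ` set_pmf p_lim. pmf (\<pi> s) a * Q a s)"
  unfolding state_value_def using assms
  by (subst integral_measure_pmf[where A = "fst ` set_pmf p_lim"]) (auto simp: finite_support image_iff Bex_def)

lemma expectation_draw_action:
  "measure_pmf.expectation (draw_action \<pi> s) (\<lambda>x. Q (fst x) (snd x)) = state_value Q s"
  unfolding draw_action_def state_value_def by simp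

text \<open>A tower rule without a bound on \<open>f\<close>: the inner expectation is a finite sum,
  and only the bounded weights \<open>pmf (K y) x\<close> are integrated over
  \<open>y\<close>.\<close>

lemma expectation_bind_support:
  fixes f :: "'a \<times> 's \<Rightarrow> real"
  assumes "set_pmf (bind_pmf \<mu> K) \<subseteq> set_pmf p_lim"
  shows "measure_pmf.expectation (bind_pmf \<mu> K) f
    = measure_pmf.expectation \<mu> (\<lambda>y. measure_pmf.expectation (K y) f)"
proof -
  have K: "set_pmf (K y) \<subseteq> set_pmf p_lim" if "y \<in> set_pmf \<mu>" for y
    using assms that by auto
  have "measure_pmf.expectation \<mu> (\<lambda>y. measure_pmf.expectation (K y) f)
    = measure_pmf.expectation \<mu> (\<lambda>y. \<Sum>x\<in>set_pmf p_lim. pmf (K y) x * f x)"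
    by (rule integral_cong_AE) (auto simp: AE_measure_pmf_iff expectation_support[OF K])
  also have "\<dots> = (\<Sum>x\<in>set_pmf p_lim. measure_pmf.expectation \<mu> (\<lambda>y. pmf (K y) x * f x))"
    by (rule Bochner_Integration.integral_sum, rule integrable_mult_left,
        rule measure_pmf.integrable_const_bound[of _ 1]) (auto simp: pmf_le_1)
  also have "\<dots> = (\<Sum>x\<in>set_pmf p_lim. pmf (bind_pmf \<mu> K) x * f x)"
    by (simp add: pmf_bind)
  finally show ?thesis using expectation_support[OF assms] by simp
qed

lemma expectation_step_law:
  assumes "x \<in> set_pmf p_lim"
  shows "measure_pmf.expectation (step_law x) (\<lambda>y. Q (fst y) (snd y)) = next_value Q x"
proof -
  have "set_pmf (bind_pmf (p (fst x) (snd x)) (draw_action \<pi>)) \<subseteq> set_pmf p_lim"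
    using step_in_support[OF assms] by (auto simp: step_law_def)
  then have "measure_pmf.expectation (step_law x) (\<lambda>y. Q (fst y) (snd y))
    = measure_pmf.expectation (p (fst x) (snd x)) (state_value Q)"
    unfolding step_law_def by (simp add: expectation_bind_support expectation_draw_action)
  also have "\<dots> = next_value Q x"
    unfolding next_value_def using assms
    by (subst integral_measure_pmf[OF finite_succ_states]) (auto simp: succ_states_def)
  finally show ?thesis .
qed

section \<open>Bellman residuals and the telescoping identity\<close>

definition mean_at :: "('a \<times> 's) pmf \<Rightarrow> nat \<Rightarrow> ('a \<times> 's \<Rightarrow> real) \<Rightarrow> real" where
  "mean_at \<mu> t f = (\<Sum>x\<in>set_pmf p_lim. pmf (sa_law p \<pi> \<mu> t) x * f x)"

lemma mean_at_bounded:
  "\<bar>mean_at \<mu> t f\<bar> \<le> (\<Sum>x\<in>set_pmf p_lim. \<bar>f x\<bar>)"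
proof -
  have "\<bar>mean_at \<mu> t f\<bar> \<le> (\<Sum>x\<in>set_pmf p_lim. \<bar>pmf (sa_law p \<pi> \<mu> t) x * f x\<bar>)"
    unfolding mean_at_def by (rule sum_abs)
  also have "\<dots> \<le> (\<Sum>x\<in>set_pmf p_lim. \<bar>f x\<bar>)"
    by (rule sum_mono) (simp add: abs_mult pmf_le_1 mult_left_le_one_le)
  finally show ?thesis .
qed

lemma mean_at_eq_expectation:
  assumes "set_pmf \<mu> \<subseteq> set_pmf p_lim"
  shows "measure_pmf.expectation (sa_law p \<pi> \<mu> t) f = mean_at \<mu> t f"
  unfolding mean_at_def by (rule expectation_support) (rule sa_law_in_support[OF assms])

text \<open>Looking one step ahead at time \<open>t\<close> is the same as looking at time
  \<open>t + 1\<close>. This is what makes discounted residuals telescope.\<close>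

lemma mean_at_Suc:
  assumes "set_pmf \<mu> \<subseteq> set_pmf p_lim"
  shows "mean_at \<mu> t (next_value Q) = mean_at \<mu> (Suc t) (\<lambda>x. Q (fst x) (snd x))"
proof -
  have "mean_at \<mu> (Suc t) (\<lambda>x. Q (fst x) (snd x))
    = measure_pmf.expectation (sa_law p \<pi> \<mu> t) (\<lambda>x. measure_pmf.expectation (step_law x) (\<lambda>x. Q (fst x) (snd x)))"
    unfolding mean_at_eq_expectation[OF assms, symmetric] sa_law_Suc
    using sa_law_in_support[OF assms, of "Suc t"] unfolding sa_law_Suc
    by (rule expectation_bind_support)
  also have "\<dots> = measure_pmf.expectation (sa_law p \<pi> \<mu> t) (next_value Q)"
    by (rule integral_cong_AE)
      (use sa_law_in_support[OF assms] in \<open>auto simp: AE_measure_pmf_iff intro!: expectation_step_law\<close>)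
  finally show ?thesis using mean_at_eq_expectation[OF assms] by simp
qed

lemma occupancy_sums:
  "(\<lambda>t. \<gamma> ^ t * mean_at \<mu> t f) sums (\<Sum>x\<in>set_pmf p_lim. occupancy \<mu> x * f x)"
proof -
  have "(\<lambda>t. \<Sum>x\<in>set_pmf p_lim. (\<gamma> ^ t * pmf (sa_law p \<pi> \<mu> t) x) * f x)
      sums (\<Sum>x\<in>set_pmf p_lim. occupancy \<mu> x * f x)"
    unfolding occupancy_def by (intro sums_sum sums_mult2 summable_sums summable_occupancy)
  then show ?thesis by (simp add: mean_at_def sum_distrib_left mult.assoc)
qed

lemma discounted_reward_occupancy:
  assumes "set_pmf \<mu> \<subseteq> set_pmf p_lim"
  shows "discounted_reward p r \<gamma> \<pi> \<mu> = (\<Sum>x\<in>set_pmf p_lim. occupancy \<mu> x * r (fst x) (snd x))"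
proof -
  have "discounted_reward p r \<gamma> \<pi> \<mu> = (\<Sum>t. \<gamma> ^ t * mean_at \<mu> t (\<lambda>x. r (fst x) (snd x)))"
    unfolding discounted_reward_def mean_at_eq_expectation[OF assms, symmetric]
    by (simp add: case_prod_beta')
  then show ?thesis using sums_unique[OF occupancy_sums] by simp
qed

text \<open>In the data this is the conditional mean of the temporal-difference error at a visit to
  \<open>x\<close>.\<close>

definition bellman_residual :: "('a \<Rightarrow> 's \<Rightarrow> real) \<Rightarrow> 'a \<times> 's \<Rightarrow> real" where
  "bellman_residual Q x = r (fst x) (snd x) + \<gamma> * next_value Q x - Q (fst x) (snd x)"

text \<open>Along the target chain the terms of the residual other than the reward form
  \<open>q (Suc t) - q t\<close>, where \<open>q\<close> is the discounted mean of \<open>Q\<close>.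
  The sum telescopes and leaves only the initial mean. Both population identities, for \<tau> and
  for \<omega>, are instances.\<close>

lemma occupancy_bellman_residual:
  assumes "set_pmf \<mu> \<subseteq> set_pmf p_lim"
  shows "(\<Sum>x\<in>set_pmf p_lim. occupancy \<mu> x * bellman_residual Q x)
    = discounted_reward p r \<gamma> \<pi> \<mu> - (\<Sum>x\<in>set_pmf p_lim. pmf \<mu> x * Q (fst x) (snd x))"
proof -
  define q where "q t = \<gamma> ^ t * mean_at \<mu> t (\<lambda>x. Q (fst x) (snd x))" for t
  define B where "B = (\<Sum>x\<in>set_pmf p_lim. \<bar>Q (fst x) (snd x)\<bar>)"
  have "q \<longlonglongrightarrow> 0"
    unfolding q_def
    by (rule summable_LIMSEQ_zero, rule summable_geometric_bounded[of _ B])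
      (simp add: mean_at_bounded B_def)
  then have "(\<lambda>t. q (Suc t) - q t) sums (0 - q 0)" by (rule telescope_sums)
  then have "(\<lambda>t. \<gamma> ^ t * mean_at \<mu> t (\<lambda>x. r (fst x) (snd x)) + (q (Suc t) - q t))
     sums (discounted_reward p r \<gamma> \<pi> \<mu> + (0 - q 0))"
    unfolding discounted_reward_occupancy[OF assms] by (intro sums_add occupancy_sums)
  moreover have "\<gamma> ^ t * mean_at \<mu> t (\<lambda>x. r (fst x) (snd x)) + (q (Suc t) - q t)
    = \<gamma> ^ t * mean_at \<mu> t (bellman_residual Q)" for t
  proof -
    have "mean_at \<mu> t (bellman_residual Q) = mean_at \<mu> t (\<lambda>x. r (fst x) (snd x))
      + \<gamma> * mean_at \<mu> t (next_value Q) - mean_at \<mu> t (\<lambda>x. Q (fst x) (snd x))"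
      by (simp add: mean_at_def bellman_residual_def sum_distrib_left algebra_simps sum.distrib sum_subtractf)
    then show ?thesis unfolding q_def mean_at_Suc[OF assms] by (simp add: right_diff_distrib distrib_left)
  qed
  ultimately have "(\<lambda>t. \<gamma> ^ t * mean_at \<mu> t (bellman_residual Q))
     sums (discounted_reward p r \<gamma> \<pi> \<mu> - q 0)" by simp
  moreover have "q 0 = (\<Sum>x\<in>set_pmf p_lim. pmf \<mu> x * Q (fst x) (snd x))"
    by (simp add: q_def mean_at_def)
  ultimately show ?thesis using sums_unique2[OF occupancy_sums[of \<mu> "bellman_residual Q"]] by auto
qed

abbreviation "Q_pi \<equiv> Q_fun p r \<gamma> \<pi>"

text \<open>Conditioning on the first pair: by \<open>sa_law_bind\<close> the law at each time is a
  mixture of the laws started from single pairs.\<close>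

lemma discounted_reward_eq_mean_Q:
  assumes "set_pmf \<mu> \<subseteq> set_pmf p_lim"
  shows "discounted_reward p r \<gamma> \<pi> \<mu> = (\<Sum>x\<in>set_pmf p_lim. pmf \<mu> x * Q_pi (fst x) (snd x))"
proof -
  define f where "f = (\<lambda>x. r (fst x) (snd x))"
  have ret: "set_pmf (return_pmf x) \<subseteq> set_pmf p_lim" if "x \<in> set_pmf p_lim" for x
    using that by simp
  have mix: "mean_at \<mu> t f = (\<Sum>x\<in>set_pmf p_lim. pmf \<mu> x * mean_at (return_pmf x) t f)" for t
  proof -
    have "mean_at \<mu> t f = measure_pmf.expectation (bind_pmf \<mu> (\<lambda>x. sa_law p \<pi> (return_pmf x) t)) f"
      by (simp add: mean_at_eq_expectation[OF assms, symmetric] flip: sa_law_bind)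
    also have "\<dots> = measure_pmf.expectation \<mu> (\<lambda>x. measure_pmf.expectation (sa_law p \<pi> (return_pmf x) t) f)"
      by (rule expectation_bind_support)
        (use sa_law_in_support[OF assms, of t] in \<open>simp flip: sa_law_bind\<close>)
    also have "\<dots> = (\<Sum>x\<in>set_pmf p_lim. pmf \<mu> x * measure_pmf.expectation (sa_law p \<pi> (return_pmf x) t) f)"
      by (rule expectation_support[OF assms])
    also have "\<dots> = (\<Sum>x\<in>set_pmf p_lim. pmf \<mu> x * mean_at (return_pmf x) t f)"
      by (rule sum.cong) (auto simp: mean_at_eq_expectation[OF ret])
    finally show ?thesis .
  qed
  have "(\<lambda>t. \<Sum>x\<in>set_pmf p_lim. pmf \<mu> x * (\<gamma> ^ t * mean_at (return_pmf x) t f))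
    sums (\<Sum>x\<in>set_pmf p_lim. pmf \<mu> x * Q_pi (fst x) (snd x))"
    by (intro sums_sum sums_mult)
      (use occupancy_sums in \<open>auto simp: Q_fun_def f_def discounted_reward_occupancy[OF ret]\<close>)
  moreover have "(\<Sum>x\<in>set_pmf p_lim. pmf \<mu> x * (\<gamma> ^ t * mean_at (return_pmf x) t f)) = \<gamma> ^ t * mean_at \<mu> t f" for t
    by (simp add: mix sum_distrib_left algebra_simps)
  ultimately have "(\<lambda>t. \<gamma> ^ t * mean_at \<mu> t f) sums (\<Sum>x\<in>set_pmf p_lim. pmf \<mu> x * Q_pi (fst x) (snd x))"
    by simp
  with occupancy_sums[of \<mu> f] show ?thesis
    unfolding discounted_reward_occupancy[OF assms] f_def by (rule sums_unique2)
qed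

text \<open>The Bellman equation. After the reward at time 0 is removed, the rest of the series is
  \<gamma> times the discounted reward of the chain started from \<open>step_law x\<close>, that is,
  \<gamma> times the mean of \<open>Q_pi\<close> after one step.\<close>

lemma bellman_residual_Q_pi:
  assumes x: "x \<in> set_pmf p_lim"
  shows "bellman_residual Q_pi x = 0"
proof -
  have sub: "set_pmf (return_pmf x) \<subseteq> set_pmf p_lim" and sub': "set_pmf (step_law x) \<subseteq> set_pmf p_lim"
    using x step_in_support[OF x] by auto
  define f where "f = (\<lambda>x. r (fst x) (snd x))"
  have s: "(\<lambda>t. \<gamma> ^ t * mean_at (return_pmf x) t f) sums Q_pi (fst x) (snd x)"
    using occupancy_sums[of "return_pmf x" f] by (simp add: Q_fun_def discounted_reward_occupancy[OF sub] f_def)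
  have "mean_at (return_pmf x) 0 f = f x"
    using mean_at_eq_expectation[OF sub, of 0 f] by simp
  then have "(\<lambda>t. \<gamma> ^ Suc t * mean_at (return_pmf x) (Suc t) f) sums (Q_pi (fst x) (snd x) - f x)"
    using s by (subst sums_Suc_iff) simp
  moreover have "\<gamma> ^ Suc t * mean_at (return_pmf x) (Suc t) f = \<gamma> * (\<gamma> ^ t * mean_at (step_law x) t f)" for t
    by (simp add: mean_at_def sa_law_Suc' bind_return_pmf del: sa_law.simps(2))
  ultimately have "(\<lambda>t. \<gamma> * (\<gamma> ^ t * mean_at (step_law x) t f)) sums (Q_pi (fst x) (snd x) - f x)"
    by (simp only:)
  moreover have "(\<lambda>t. \<gamma> * (\<gamma> ^ t * mean_at (step_law x) t f)) sums (\<gamma> * discounted_reward p r \<gamma> \<pi> (step_law x))"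
    unfolding discounted_reward_occupancy[OF sub'] f_def by (intro sums_mult occupancy_sums)
  ultimately have "Q_pi (fst x) (snd x) - f x = \<gamma> * discounted_reward p r \<gamma> \<pi> (step_law x)"
    by (rule sums_unique2)
  also have "discounted_reward p r \<gamma> \<pi> (step_law x) = next_value Q_pi x"
    by (simp add: discounted_reward_eq_mean_Q[OF sub'] expectation_support[OF sub'] flip: expectation_step_law[OF x])
  finally show ?thesis by (simp add: bellman_residual_def f_def)
qed

section \<open>Population functionals\<close>

definition initial_value :: "('a \<Rightarrow> 's \<Rightarrow> real) \<Rightarrow> real" where
  "initial_value Q = measure_pmf.expectation \<G> (state_value Q)"

lemma initial_law_support: "set_pmf (bind_pmf \<G> (draw_action \<pi>)) \<subseteq> set_pmf p_lim"
  using initial_in_support by (auto simp: draw_action_def)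

lemma initial_value_sum:
  "initial_value Q = (\<Sum>x\<in>set_pmf p_lim. pmf (bind_pmf \<G> (draw_action \<pi>)) x * Q (fst x) (snd x))"
  unfolding expectation_support[OF initial_law_support, symmetric] initial_value_def
  by (subst expectation_bind_support[OF initial_law_support]) (simp add: expectation_draw_action)

lemma policy_value_eq: "policy_value p r \<gamma> \<pi> \<G> = initial_value Q_pi"
  unfolding policy_value_def initial_value_def
proof (rule integral_cong_AE)
  have "V_fun p r \<gamma> \<pi> s = state_value Q_pi s" if "s \<in> set_pmf \<G>" for s
  proof -
    have sub: "set_pmf (draw_action \<pi> s) \<subseteq> set_pmf p_lim"
      using initial_in_support[OF that] by (auto simp: draw_action_def)
    show ?thesis
      by (simp add: V_fun_def discounted_reward_eq_mean_Q[OF sub] expectation_support[OF sub]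
          flip: expectation_draw_action)
  qed
  then show "AE s in measure_pmf \<G>. V_fun p r \<gamma> \<pi> s = state_value Q_pi s"
    by (auto simp: AE_measure_pmf_iff)
qed auto

text \<open>The population counterpart of the sample mean of \<open>td g Q\<close> below.\<close>
definition mean_residual :: "('a \<times> 's \<Rightarrow> real) \<Rightarrow> ('a \<Rightarrow> 's \<Rightarrow> real) \<Rightarrow> real" where
  "mean_residual g Q = (\<Sum>x\<in>set_pmf p_lim. pmf p_lim x * g x * bellman_residual Q x)"

text \<open>The denominator of \<tau> cancels against the weight \<open>pmf p_lim\<close>, leaving
  the occupancy of a point mass, to which the telescoping identity applies. So one exact debiasing
  step turns any \<open>Q\<close> into \<open>Q_pi\<close>.\<close>

lemma mean_residual_tau:
  assumes "x \<in> set_pmf p_lim"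
  shows "1 / (1 - \<gamma>) * mean_residual (\<lambda>y. tau_ratio p \<gamma> \<pi> p_lim (fst y) (snd y) (fst x) (snd x)) Q
    = Q_pi (fst x) (snd x) - Q (fst x) (snd x)"
proof -
  have sub: "set_pmf (return_pmf x) \<subseteq> set_pmf p_lim" using assms by simp
  have "1 / (1 - \<gamma>) * mean_residual (\<lambda>y. tau_ratio p \<gamma> \<pi> p_lim (fst y) (snd y) (fst x) (snd x)) Q
    = (\<Sum>y\<in>set_pmf p_lim. occupancy (return_pmf x) y * bellman_residual Q y)"
    unfolding mean_residual_def sum_distrib_left
    by (rule sum.cong)
      (use gamma_less_1 in \<open>auto simp: tau_ratio_def tau_num_eq_occupancy set_pmf_iff\<close>)
  also have "\<dots> = Q_pi (fst x) (snd x) - (\<Sum>y\<in>set_pmf p_lim. pmf (return_pmf x) y * Q (fst y) (snd y))"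
    by (simp add: occupancy_bellman_residual[OF sub] Q_fun_def)
  also have "(\<Sum>y\<in>set_pmf p_lim. pmf (return_pmf x) y * Q (fst y) (snd y)) = Q (fst x) (snd x)"
    using expectation_support[OF sub, of "\<lambda>y. Q (fst y) (snd y)"] by simp
  finally show ?thesis .
qed

text \<open>The same cancellation with the occupancy of the initial law; the initial mean of
  \<open>Q\<close> left by telescoping is just what \<open>initial_value\<close> adds back.\<close>

lemma mean_residual_omega:
  "1 / (1 - \<gamma>) * mean_residual (\<lambda>y. omega_ratio p \<gamma> \<pi> \<G> p_lim (fst y) (snd y)) Q + initial_value Q
    = policy_value p r \<gamma> \<pi> \<G>"
proof -
  let ?\<mu> = "bind_pmf \<G> (draw_action \<pi>)"
  have "1 / (1 - \<gamma>) * mean_residual (\<lambda>y. omega_ratio p \<gamma> \<pi> \<G> p_lim (fst y) (snd y)) Q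
    = (\<Sum>y\<in>set_pmf p_lim. occupancy ?\<mu> y * bellman_residual Q y)"
    unfolding mean_residual_def sum_distrib_left
    by (rule sum.cong)
      (use gamma_less_1 in \<open>auto simp: omega_ratio_def omega_num_eq_occupancy set_pmf_iff\<close>)
  also have "\<dots> = discounted_reward p r \<gamma> \<pi> ?\<mu> - initial_value Q"
    by (simp add: occupancy_bellman_residual[OF initial_law_support] initial_value_sum)
  also have "discounted_reward p r \<gamma> \<pi> ?\<mu> = policy_value p r \<gamma> \<pi> \<G>"
    by (simp add: discounted_reward_eq_mean_Q[OF initial_law_support] policy_value_eq initial_value_sum)
  finally show ?thesis by simp
qed

lemma mean_residual_Q_pi: "mean_residual g Q_pi = 0"
  unfolding mean_residual_def by (rule sum.neutral) (simp add: bellman_residual_Q_pi)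

end

section \<open>Stability of the debiased estimator\<close>

text \<open>Changing the normalisation of the sum over \<open>A\<close> and leaving out the terms of
  \<open>B - A\<close> each cost \<open>M * (1 - card A / card B)\<close>.\<close>

lemma mean_subset_diff:
  fixes f :: "'b \<Rightarrow> real"
  assumes fin: "finite B" and sub: "A \<subseteq> B" and ne: "A \<noteq> {}" and bound: "\<And>x. x \<in> B \<Longrightarrow> \<bar>f x\<bar> \<le> M"
  shows "\<bar>sum f A / real (card A) - sum f B / real (card B)\<bar> \<le> 2 * M * (1 - real (card A) / real (card B))"
proof -
  have finA: "finite A" using fin sub finite_subset by blast
  have cA: "0 < card A" using ne finA by (simp add: card_gt_0_iff)
  have AB: "card A \<le> card B" by (rule card_mono[OF fin sub])
  define a b where "a = real (card A)" and "b = real (card B)"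
  have ab: "0 < a" "a \<le> b" using cA AB by (auto simp: a_def b_def)
  have "\<bar>sum f A\<bar> \<le> a * M"
    unfolding a_def using bound sub by (intro order_trans[OF sum_abs] sum_bounded_above) auto
  then have *: "\<bar>sum f A * (1 / a - 1 / b)\<bar> \<le> a * M * (1 / a - 1 / b)"
    using ab by (simp add: abs_mult frac_le mult_right_mono)
  have "\<bar>sum f (B - A)\<bar> \<le> real (card (B - A)) * M"
    using bound by (intro order_trans[OF sum_abs] sum_bounded_above) auto
  also have "real (card (B - A)) = b - a"
    using AB by (simp add: card_Diff_subset[OF finA sub] a_def b_def of_nat_diff)
  finally have **: "\<bar>sum f (B - A) / b\<bar> \<le> (b - a) * M / b"
    using ab by (simp add: divide_right_mono)
  have "sum f A / a - sum f B / b = sum f A * (1 / a - 1 / b) - sum f (B - A) / b"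
    by (simp add: sum.subset_diff[OF sub fin] right_diff_distrib add_divide_distrib)
  then have "\<bar>sum f A / a - sum f B / b\<bar> \<le> a * M * (1 / a - 1 / b) + (b - a) * M / b"
    using * ** by linarith
  also have "\<dots> = 2 * M * (1 - a / b)" using ab by (simp add: field_simps)
  finally show ?thesis unfolding a_def b_def .
qed

text \<open>A birthday estimate: a further entry collides with one of \<open>l\<close> distinct
  earlier entries for a proportion \<open>l / N\<close> of the choices, and since
  \<open>l ^ 2 + l \<le> (l + 1) ^ 2\<close>, these losses add up to at most the stated one.\<close>

lemma card_distinct_lists_ge:
  assumes fin: "finite J" and le: "l \<le> card J"
  shows "1 - real l ^ 2 / real (card J)
    \<le> real (card {xs. length xs = l \<and> distinct xs \<and> set xs \<subseteq> J}) / real (card J) ^ l"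
  using le
proof (induction l)
  case (Suc l)
  let ?D = "\<lambda>l. card {xs. length xs = l \<and> distinct xs \<and> set xs \<subseteq> J}"
  define N where "N = real (card J)"
  have N: "0 < N" using Suc.prems by (simp add: N_def)
  have "?D (Suc l) = (card J - l) * ?D l"
  proof -
    have "{card J - Suc l + 1..card J} = insert (card J - l) {card J - l + 1..card J}"
      using Suc.prems by auto
    then show ?thesis
      using Suc.prems by (simp add: card_lists_distinct_length_eq[OF fin])
  qed
  then have eq: "real (?D (Suc l)) / N ^ Suc l = (real (?D l) / N ^ l) * (1 - real l / N)"
    using Suc.prems N by (simp add: N_def of_nat_diff field_simps)
  have "?D l \<le> card {xs. set xs \<subseteq> J \<and> length xs = l}"
    by (rule card_mono[OF finite_lists_length_eq[OF fin]]) auto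
  then have "real (?D l) \<le> N ^ l"
    by (simp add: card_lists_length_eq[OF fin] N_def flip: of_nat_power)
  then have "real (?D l) / N ^ l * (real l / N) \<le> 1 * (real l / N)"
    using N by (intro mult_right_mono) (auto simp: divide_le_eq)
  then have "(real (?D l) / N ^ l) * (1 - real l / N) \<ge> real (?D l) / N ^ l - real l / N"
    by (simp add: right_diff_distrib)
  moreover have "real (?D l) / N ^ l \<ge> 1 - real l ^ 2 / N"
    using Suc N_def by simp
  moreover have "real (Suc l) ^ 2 / N \<ge> real l ^ 2 / N + real l / N"
    using N by (simp add: power2_eq_square field_simps)
  ultimately have "real (?D (Suc l)) / N ^ Suc l \<ge> 1 - real (Suc l) ^ 2 / N"
    unfolding eq by linarith
  then show ?case unfolding N_def .
next
  case 0
  have "{xs. length xs = 0 \<and> distinct xs \<and> set xs \<subseteq> J} = {[]}" by auto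
  then show ?case by simp
qed

section \<open>Bounds and Lipschitz estimates on the support\<close>

context finite_support_evaluation
begin

text \<open>Convergence under \<open>p_lim\<close> controls errors only at its atoms. As the support
  is closed under target steps, temporal-difference errors at regular observations see nothing
  else.\<close>

definition bounded_on_support :: "('a \<Rightarrow> 's \<Rightarrow> real) \<Rightarrow> real \<Rightarrow> bool" where
  "bounded_on_support Q B \<longleftrightarrow> (\<forall>(a, s)\<in>set_pmf p_lim. \<bar>Q a s\<bar> \<le> B)"

lemma bounded_on_supportD: "bounded_on_support Q B \<Longrightarrow> x \<in> set_pmf p_lim \<Longrightarrow> \<bar>Q (fst x) (snd x)\<bar> \<le> B"
  by (auto simp: bounded_on_support_def)

lemma state_value_succ:
  "s \<in> succ_states \<Longrightarrow> state_value Q s = (\<Sum>a\<in>fst ` set_pmf p_lim. pmf (\<pi> s) a * Q a s)"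
  by (rule state_value_sum) (rule succ_in_support)

lemma abs_state_value_le:
  assumes Q: "bounded_on_support Q B" and s: "\<And>a. a \<in> set_pmf (\<pi> s) \<Longrightarrow> (a, s) \<in> set_pmf p_lim"
  shows "\<bar>state_value Q s\<bar> \<le> B"
proof -
  have le: "\<bar>pmf (\<pi> s) a * Q a s\<bar> \<le> pmf (\<pi> s) a * B" for a
  proof (cases "a \<in> set_pmf (\<pi> s)")
    case True
    then show ?thesis using bounded_on_supportD[OF Q s] by (simp add: abs_mult mult_left_mono)
  qed (simp add: set_pmf_iff)
  have "\<bar>state_value Q s\<bar> \<le> (\<Sum>a\<in>fst ` set_pmf p_lim. pmf (\<pi> s) a * B)"
    using le by (subst state_value_sum) (auto intro!: s order_trans[OF sum_abs] sum_mono)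
  also have "\<dots> = state_value (\<lambda>_ _. B) s" using s by (subst state_value_sum) auto
  also have "\<dots> = B" by (simp add: state_value_def)
  finally show ?thesis .
qed

lemma state_value_mean:
  assumes "s \<in> succ_states"
  shows "state_value (\<lambda>a s. (\<Sum>i\<in>I. Q i a s) / c) s = (\<Sum>i\<in>I. state_value (Q i) s) / c"
  unfolding state_value_succ[OF assms] sum_divide_distrib sum_distrib_left
  by (subst sum.swap) simp

lemma state_value_diff:
  assumes "s \<in> succ_states"
  shows "state_value (\<lambda>a s. Q a s - Q' a s) s = state_value Q s - state_value Q' s"
  unfolding state_value_succ[OF assms] by (simp add: right_diff_distrib sum_subtractf)

lemma sum_pmf_succ_states: "x \<in> set_pmf p_lim \<Longrightarrow> (\<Sum>s\<in>succ_states. pmf (p (fst x) (snd x)) s) = 1"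
  by (rule sum_pmf_eq_1) (use finite_succ_states in \<open>auto simp: succ_states_def\<close>)

lemma abs_next_value_le:
  assumes Q: "bounded_on_support Q B" and x: "x \<in> set_pmf p_lim"
  shows "\<bar>next_value Q x\<bar> \<le> B"
proof -
  have "\<bar>next_value Q x\<bar> \<le> (\<Sum>s\<in>succ_states. pmf (p (fst x) (snd x)) s * B)"
    unfolding next_value_def using abs_state_value_le[OF Q succ_in_support]
    by (intro order_trans[OF sum_abs] sum_mono) (auto simp: abs_mult intro!: mult_left_mono)
  also have "\<dots> = B" by (simp add: sum_pmf_succ_states[OF x] flip: sum_distrib_right)
  finally show ?thesis .
qed

lemma abs_bellman_residual_le:
  assumes Q: "bounded_on_support Q B" and x: "x \<in> set_pmf p_lim"
  shows "\<bar>bellman_residual Q x\<bar> \<le> Cr + 2 * B"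
proof -
  have "\<bar>\<gamma> * next_value Q x\<bar> \<le> 1 * B"
    unfolding abs_mult using abs_next_value_le[OF Q x] gamma_pos gamma_less_1 by (intro mult_mono) auto
  then show ?thesis
    using r_bound[of "fst x" "snd x"] bounded_on_supportD[OF Q x] unfolding bellman_residual_def by linarith
qed

text \<open>One \<open>e\<close> comes from \<open>Q\<close> itself and one, damped by
  \<open>\<gamma> < 1\<close>, from \<open>next_value\<close>. This is the origin of the term
  \<open>2 * C / (1 - \<gamma>)\<close> in the error constants.\<close>

lemma bellman_residual_diff:
  assumes e: "bounded_on_support (\<lambda>a s. Q a s - Q' a s) e" and x: "x \<in> set_pmf p_lim"
  shows "\<bar>bellman_residual Q x - bellman_residual Q' x\<bar> \<le> 2 * e"
proof -
  have "next_value Q x - next_value Q' x = next_value (\<lambda>a s. Q a s - Q' a s) x"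
    by (simp add: next_value_def state_value_diff right_diff_distrib sum_subtractf)
  then have "\<bar>\<gamma> * (next_value Q x - next_value Q' x)\<bar> \<le> 1 * e"
    unfolding abs_mult using abs_next_value_le[OF e x] gamma_pos gamma_less_1 by (intro mult_mono) auto
  then show ?thesis
    using bounded_on_supportD[OF e x] unfolding bellman_residual_def right_diff_distrib by linarith
qed

lemma abs_mean_residual_le:
  assumes "\<And>x. x \<in> set_pmf p_lim \<Longrightarrow> \<bar>g x * bellman_residual Q x\<bar> \<le> c"
  shows "\<bar>mean_residual g Q\<bar> \<le> c"
proof -
  have "\<bar>mean_residual g Q\<bar> \<le> (\<Sum>x\<in>set_pmf p_lim. pmf p_lim x * c)"
    unfolding mean_residual_def using assms
    by (intro order_trans[OF sum_abs] sum_mono) (auto simp: abs_mult mult.assoc intro!: mult_left_mono)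
  also have "\<dots> = c"
    by (simp add: sum_pmf_eq_1[OF finite_support] flip: sum_distrib_right)
  finally show ?thesis .
qed

lemma mean_residual_diff:
  assumes g: "\<And>x. x \<in> set_pmf p_lim \<Longrightarrow> \<bar>g x\<bar> \<le> C" and e: "bounded_on_support (\<lambda>a s. Q a s - Q' a s) e"
  shows "\<bar>mean_residual g Q - mean_residual g Q'\<bar> \<le> 2 * C * e"
proof -
  have "\<bar>mean_residual g Q - mean_residual g Q'\<bar>
    = \<bar>\<Sum>x\<in>set_pmf p_lim. pmf p_lim x * (g x * (bellman_residual Q x - bellman_residual Q' x))\<bar>"
    by (simp add: mean_residual_def algebra_simps sum_subtractf)
  also have "\<dots> \<le> (\<Sum>x\<in>set_pmf p_lim. pmf p_lim x * (C * (2 * e)))"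
  proof (intro order_trans[OF sum_abs] sum_mono)
    fix x assume x: "x \<in> set_pmf p_lim"
    have "\<bar>g x * (bellman_residual Q x - bellman_residual Q' x)\<bar> \<le> C * (2 * e)"
      unfolding abs_mult using g[OF x] bellman_residual_diff[OF e x] by (intro mult_mono) auto
    then show "\<bar>pmf p_lim x * (g x * (bellman_residual Q x - bellman_residual Q' x))\<bar> \<le> pmf p_lim x * (C * (2 * e))"
      unfolding abs_mult[of "pmf p_lim x"] by (intro mult_mono) auto
  qed
  also have "\<dots> = 2 * C * e"
    by (simp add: sum_pmf_eq_1[OF finite_support] flip: sum_distrib_right)
  finally show ?thesis .
qed

lemma mean_residual_weight_diff:
  assumes g: "\<And>x. x \<in> set_pmf p_lim \<Longrightarrow> \<bar>g x - h x\<bar> \<le> e" and Q: "bounded_on_support Q B"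
  shows "\<bar>mean_residual g Q - mean_residual h Q\<bar> \<le> e * (Cr + 2 * B)"
proof -
  have "mean_residual g Q - mean_residual h Q = mean_residual (\<lambda>x. g x - h x) Q"
    by (simp add: mean_residual_def algebra_simps sum_subtractf)
  also have "\<bar>\<dots>\<bar> \<le> e * (Cr + 2 * B)"
  proof (rule abs_mean_residual_le)
    fix x assume x: "x \<in> set_pmf p_lim"
    show "\<bar>(g x - h x) * bellman_residual Q x\<bar> \<le> e * (Cr + 2 * B)"
      unfolding abs_mult using g[OF x] abs_bellman_residual_le[OF Q x] by (intro mult_mono) auto
  qed
  finally show ?thesis .
qed

lemma initial_value_diff:
  assumes "bounded_on_support (\<lambda>a s. Q a s - Q' a s) e"
  shows "\<bar>initial_value Q - initial_value Q'\<bar> \<le> e"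
proof -
  let ?\<mu> = "bind_pmf \<G> (draw_action \<pi>)"
  have "\<bar>initial_value Q - initial_value Q'\<bar>
    = \<bar>\<Sum>x\<in>set_pmf p_lim. pmf ?\<mu> x * (Q (fst x) (snd x) - Q' (fst x) (snd x))\<bar>"
    by (simp add: initial_value_sum right_diff_distrib sum_subtractf)
  also have "\<dots> \<le> (\<Sum>x\<in>set_pmf p_lim. pmf ?\<mu> x * e)"
    using bounded_on_supportD[OF assms]
    by (intro order_trans[OF sum_abs] sum_mono) (auto simp: abs_mult intro!: mult_left_mono)
  also have "\<dots> = e"
    by (simp add: sum_pmf_eq_1[OF finite_support initial_law_support] flip: sum_distrib_right)
  finally show ?thesis .
qed

subsection \<open>Temporal-difference errors and their noise\<close>

text \<open>The common core of the two operators: \<open>debias\<close> uses it with the weight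
  \<tau> at a fixed second pair, \<open>psi\<close> with the weight \<omega>.\<close>

definition td :: "('a \<times> 's \<Rightarrow> real) \<Rightarrow> ('a \<Rightarrow> 's \<Rightarrow> real) \<Rightarrow> ('s, 'a) obs \<Rightarrow> real" where
  "td g Q z = (case z of (s, a, r', s') \<Rightarrow> g (a, s) * (r' + \<gamma> * state_value Q s' - Q a s))"

lemma debias_eq_td:
  "debias \<gamma> \<pi> \<tau> z Q a s = Q a s + 1 / (1 - \<gamma>) * td (\<lambda>x. \<tau> (fst x) (snd x) a s) Q z"
  by (simp add: debias_def td_def state_value_def split: prod.split)

lemma psi_eq_td:
  "psi \<gamma> \<pi> \<G> w Q z = 1 / (1 - \<gamma>) * td (\<lambda>x. w (fst x) (snd x)) Q z + initial_value Q"
  using gamma_less_1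
  by (cases z) (simp add: psi_def td_def state_value_def [abs_def] initial_value_def field_simps)

text \<open>The properties that an observation has almost surely, collected so that the estimates
  below can be stated for a fixed sample.\<close>

definition regular_obs :: "('s, 'a) obs \<Rightarrow> bool" where
  "regular_obs z \<longleftrightarrow> (case z of (s, a, r', s') \<Rightarrow>
     (a, s) \<in> set_pmf p_lim \<and> s' \<in> succ_states \<and> \<bar>r'\<bar> \<le> Cr)"

definition reward_noise :: "'a \<times> 's \<Rightarrow> ('s, 'a) obs \<Rightarrow> real" where
  "reward_noise x z = (case z of (s, a, r', s') \<Rightarrow> of_bool ((a, s) = x) * (r' - r a s))"

definition transition_noise :: "'a \<times> 's \<Rightarrow> 's \<Rightarrow> ('s, 'a) obs \<Rightarrow> real" where
  "transition_noise x y z = (case z of (s, a, r', s') \<Rightarrow>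
     of_bool ((a, s) = x) * (of_bool (s' = y) - pmf (p a s) y))"

definition visit_noise :: "'a \<times> 's \<Rightarrow> ('s, 'a) obs \<Rightarrow> real" where
  "visit_noise x z = (case z of (s, a, r', s') \<Rightarrow> of_bool ((a, s) = x) - pmf p_lim x)"

text \<open>No member of this family involves an estimator, so mean-square bounds for its finitely
  many members suffice for all fitted functions.\<close>

definition noises :: "(('s, 'a) obs \<Rightarrow> real) set" where
  "noises = reward_noise ` set_pmf p_lim
     \<union> (\<lambda>(x, y). transition_noise x y) ` (set_pmf p_lim \<times> succ_states)
     \<union> visit_noise ` set_pmf p_lim"

lemma finite_noises: "finite noises"
  by (simp add: noises_def finite_support finite_succ_states)

text \<open>Only the summand at the visited pair sees the reward and the next state. There the first
  two noises turn the temporal-difference error into its conditional mean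
  \<open>bellman_residual\<close>, and the visit noise recentres the indicator of the visit. The
  coefficients depend on \<open>g\<close> and \<open>Q\<close> but not on \<open>z\<close>.\<close>

lemma td_decomposition:
  assumes "regular_obs z"
  shows "td g Q z - mean_residual g Q = (\<Sum>x\<in>set_pmf p_lim. g x * (reward_noise x z
    + \<gamma> * (\<Sum>y\<in>succ_states. transition_noise x y z * state_value Q y)
    + visit_noise x z * bellman_residual Q x))"
proof -
  obtain s a r' s' where z: "z = (s, a, r', s')" by (cases z)
  have sa: "(a, s) \<in> set_pmf p_lim" and s': "s' \<in> succ_states"
    using assms by (auto simp: regular_obs_def z)
  have *: "(\<Sum>y\<in>succ_states. transition_noise x y z * state_value Q y)
    = of_bool (x = (a, s)) * (state_value Q s' - next_value Q (a, s))" for x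
  proof (cases "x = (a, s)")
    case True
    have "(\<Sum>y\<in>succ_states. of_bool (s' = y) * state_value Q y) = state_value Q s'"
      using s' by (simp add: of_bool_def if_distrib[of "\<lambda>c. c * _"] finite_succ_states cong: if_cong)
    then show ?thesis
      using True by (simp add: z transition_noise_def next_value_def left_diff_distrib sum_subtractf)
  qed (auto simp: z transition_noise_def)
  have "(\<Sum>x\<in>set_pmf p_lim. g x * (reward_noise x z
    + \<gamma> * (\<Sum>y\<in>succ_states. transition_noise x y z * state_value Q y)
    + visit_noise x z * bellman_residual Q x))
    = (\<Sum>x\<in>set_pmf p_lim. (if x = (a, s) then td g Q z else 0)
         - pmf p_lim x * g x * bellman_residual Q x)"
    unfolding *
    by (rule sum.cong)
      (auto simp: z td_def reward_noise_def visit_noise_def bellman_residual_def algebra_simps)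
  also have "\<dots> = td g Q z - mean_residual g Q"
    using sa by (simp add: sum_subtractf finite_support mean_residual_def)
  finally show ?thesis by simp
qed

text \<open>The decomposition is summed over \<open>J\<close> before absolute values are taken, so
  the coefficients come out and only noise sums remain. At each support point reward, transition and
  visit noise contribute 1, \<open>card succ_states * B\<close> and \<open>Cr + 2 * B\<close> to the
  constant.\<close>

lemma sum_td_close:
  assumes fin: "finite J" and reg: "\<And>i. i \<in> J \<Longrightarrow> regular_obs (z i)"
    and g: "\<And>x. x \<in> set_pmf p_lim \<Longrightarrow> \<bar>g x\<bar> \<le> C" and Q: "bounded_on_support Q B"
    and noise: "\<And>\<phi>. \<phi> \<in> noises \<Longrightarrow> \<bar>\<Sum>i\<in>J. \<phi> (z i)\<bar> \<le> \<Delta>" and "0 \<le> C" "0 \<le> B" "0 \<le> \<Delta>"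
  shows "\<bar>(\<Sum>i\<in>J. td g Q (z i)) - real (card J) * mean_residual g Q\<bar>
    \<le> real (card (set_pmf p_lim)) * (C * (1 + real (card succ_states) * B + (Cr + 2 * B))) * \<Delta>"
proof -
  define S where "S \<phi> = (\<Sum>i\<in>J. \<phi> (z i))" for \<phi> :: "('s, 'a) obs \<Rightarrow> real"
  have "(\<Sum>i\<in>J. td g Q (z i)) - real (card J) * mean_residual g Q
    = (\<Sum>i\<in>J. td g Q (z i) - mean_residual g Q)"
    by (simp add: sum_subtractf)
  also have "\<dots> = (\<Sum>i\<in>J. \<Sum>x\<in>set_pmf p_lim. g x * (reward_noise x (z i)
    + \<gamma> * (\<Sum>y\<in>succ_states. transition_noise x y (z i) * state_value Q y)
    + visit_noise x (z i) * bellman_residual Q x))"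
    using td_decomposition[OF reg] by (rule sum.cong[OF refl])
  also have "\<dots> = (\<Sum>x\<in>set_pmf p_lim. \<Sum>i\<in>J. g x * (reward_noise x (z i)
    + \<gamma> * (\<Sum>y\<in>succ_states. transition_noise x y (z i) * state_value Q y)
    + visit_noise x (z i) * bellman_residual Q x))"
    by (rule sum.swap)
  also have "\<dots> = (\<Sum>x\<in>set_pmf p_lim. g x * (S (reward_noise x)
    + \<gamma> * (\<Sum>y\<in>succ_states. S (transition_noise x y) * state_value Q y)
    + S (visit_noise x) * bellman_residual Q x))"
  proof (rule sum.cong[OF refl])
    fix x
    have "(\<Sum>i\<in>J. \<Sum>y\<in>succ_states. transition_noise x y (z i) * state_value Q y)
      = (\<Sum>y\<in>succ_states. S (transition_noise x y) * state_value Q y)"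
      unfolding S_def sum_distrib_right by (rule sum.swap)
    then show "(\<Sum>i\<in>J. g x * (reward_noise x (z i)
        + \<gamma> * (\<Sum>y\<in>succ_states. transition_noise x y (z i) * state_value Q y)
        + visit_noise x (z i) * bellman_residual Q x)) = g x * (S (reward_noise x)
        + \<gamma> * (\<Sum>y\<in>succ_states. S (transition_noise x y) * state_value Q y)
        + S (visit_noise x) * bellman_residual Q x)"
      by (simp add: S_def sum.distrib flip: sum_distrib_left sum_distrib_right)
  qed
  also have "\<bar>\<dots>\<bar> \<le> (\<Sum>x\<in>set_pmf p_lim. C * ((1 + real (card succ_states) * B + (Cr + 2 * B)) * \<Delta>))"
  proof (intro order_trans[OF sum_abs] sum_mono)
    fix x assume x: "x \<in> set_pmf p_lim"
    have S: "\<bar>S \<phi>\<bar> \<le> \<Delta>" if "\<phi> \<in> noises" for \<phi> using noise that by (simp add: S_def)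
    have 1: "\<bar>S (reward_noise x)\<bar> \<le> \<Delta>" and 3: "\<bar>S (visit_noise x)\<bar> \<le> \<Delta>"
      using x by (auto intro!: S simp: noises_def)
    have "\<bar>\<Sum>y\<in>succ_states. S (transition_noise x y) * state_value Q y\<bar> \<le> (\<Sum>y\<in>succ_states. \<Delta> * B)"
    proof (intro order_trans[OF sum_abs] sum_mono)
      fix y assume y: "y \<in> succ_states"
      have "\<bar>S (transition_noise x y)\<bar> \<le> \<Delta>" using x y by (auto intro!: S simp: noises_def)
      then show "\<bar>S (transition_noise x y) * state_value Q y\<bar> \<le> \<Delta> * B"
        unfolding abs_mult using abs_state_value_le[OF Q succ_in_support[OF y]] by (intro mult_mono) auto
    qed
    then have "\<bar>\<gamma> * (\<Sum>y\<in>succ_states. S (transition_noise x y) * state_value Q y)\<bar>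
      \<le> 1 * (real (card succ_states) * (\<Delta> * B))"
      unfolding abs_mult[of \<gamma>] using gamma_pos gamma_less_1 by (intro mult_mono) auto
    moreover have "\<bar>S (visit_noise x) * bellman_residual Q x\<bar> \<le> \<Delta> * (Cr + 2 * B)"
      unfolding abs_mult using 3 abs_bellman_residual_le[OF Q x] by (intro mult_mono) auto
    ultimately have "\<bar>S (reward_noise x)
      + \<gamma> * (\<Sum>y\<in>succ_states. S (transition_noise x y) * state_value Q y)
      + S (visit_noise x) * bellman_residual Q x\<bar> \<le> \<Delta> + real (card succ_states) * (\<Delta> * B) + \<Delta> * (Cr + 2 * B)"
      using 1 by linarith
    also have "\<dots> = (1 + real (card succ_states) * B + (Cr + 2 * B)) * \<Delta>"
      by (simp add: algebra_simps)
    finally have sum_le: "\<bar>S (reward_noise x)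
      + \<gamma> * (\<Sum>y\<in>succ_states. S (transition_noise x y) * state_value Q y)
      + S (visit_noise x) * bellman_residual Q x\<bar> \<le> (1 + real (card succ_states) * B + (Cr + 2 * B)) * \<Delta>" .
    show "\<bar>g x * (S (reward_noise x)
      + \<gamma> * (\<Sum>y\<in>succ_states. S (transition_noise x y) * state_value Q y)
      + S (visit_noise x) * bellman_residual Q x)\<bar> \<le> C * ((1 + real (card succ_states) * B + (Cr + 2 * B)) * \<Delta>)"
      unfolding abs_mult[of "g x"] by (intro mult_mono g[OF x] sum_le \<open>0 \<le> C\<close> abs_ge_zero)
  qed
  finally show ?thesis by (simp add: mult.assoc)
qed

lemma abs_td_le:
  assumes reg: "regular_obs z" and g: "\<And>x. x \<in> set_pmf p_lim \<Longrightarrow> \<bar>g x\<bar> \<le> C" and Q: "bounded_on_support Q B"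
  shows "\<bar>td g Q z\<bar> \<le> C * (Cr + 2 * B)"
proof -
  obtain s a r' s' where z: "z = (s, a, r', s')" by (cases z)
  have sa: "(a, s) \<in> set_pmf p_lim" and s': "s' \<in> succ_states" and r': "\<bar>r'\<bar> \<le> Cr"
    using reg by (auto simp: regular_obs_def z)
  have "\<bar>\<gamma> * state_value Q s'\<bar> \<le> 1 * B"
    unfolding abs_mult using abs_state_value_le[OF Q succ_in_support[OF s']] gamma_pos gamma_less_1
    by (intro mult_mono) auto
  then have "\<bar>r' + \<gamma> * state_value Q s' - Q a s\<bar> \<le> Cr + 2 * B"
    using bounded_on_supportD[OF Q sa] r' by (simp add: abs_if split: if_splits)
  then show ?thesis
    unfolding td_def z using g[OF sa] by (auto simp: abs_mult intro!: mult_mono)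
qed

text \<open>A function bounded by \<open>B\<close> is moved by one debiasing by at most
  \<open>1 / (1 - \<gamma>)\<close> times the bound of \<open>abs_td_le\<close>; the recursion
  starts from the bound on the fitted \<open>Q\<close>.\<close>

primrec debias_bound :: "real \<Rightarrow> nat \<Rightarrow> real" where
  "debias_bound C 0 = C"
| "debias_bound C (Suc l) = debias_bound C l + C / (1 - \<gamma>) * (Cr + 2 * debias_bound C l)"

lemma Cr_nonneg: "0 \<le> Cr"
  using r_bound[of undefined undefined] by linarith

lemma debias_bound_nonneg: "0 \<le> C \<Longrightarrow> 0 \<le> debias_bound C l"
  using gamma_less_1 Cr_nonneg by (induction l) auto

text \<open>The constant of \<open>sum_td_close\<close> for functions debiased \<open>l\<close>
  times, with the prefactor of the debiasing operator.\<close>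

definition noise_factor :: "real \<Rightarrow> nat \<Rightarrow> real" where
  "noise_factor C l = 1 / (1 - \<gamma>) * (real (card (set_pmf p_lim)) *
     (C * (1 + real (card succ_states) * debias_bound C l + (Cr + 2 * debias_bound C l))))"

lemma noise_factor_nonneg: "0 \<le> C \<Longrightarrow> 0 \<le> noise_factor C l"
  unfolding noise_factor_def using gamma_less_1 Cr_nonneg debias_bound_nonneg[of C l]
  by (intro mult_nonneg_nonneg add_nonneg_nonneg) auto

text \<open>The error after \<open>l\<close> debiasings in units of \<open>\<Delta> / N + e\<close>.
  In a step, the first summand is the noise, the second carries the old error through the population
  map, and the third replaces the fitted \<tau> by the true ratio. The cases of \<open>Q\<close> and
  \<tau> each need only part of this sum.\<close>

primrec debias_factor :: "real \<Rightarrow> nat \<Rightarrow> real" where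
  "debias_factor C 0 = 1"
| "debias_factor C (Suc l) = noise_factor C l + (1 + 2 * C / (1 - \<gamma>)) * debias_factor C l
     + 1 / (1 - \<gamma>) * (Cr + 2 * debias_bound C l)"

lemma debias_factor_ge_0: "0 \<le> C \<Longrightarrow> 0 \<le> debias_factor C l"
proof (induction l)
  case (Suc l)
  then show ?case
    using gamma_less_1 Cr_nonneg debias_bound_nonneg[of C l] noise_factor_nonneg[of C l] by auto
qed auto

text \<open>Noise, the replacement of the fitted \<omega>, and the error of the debiased function
  with the cost of distinct indices included. The last is multiplied by the Lipschitz constant of
  the value functional: 1 from \<open>initial_value\<close> and
  \<open>2 * C / (1 - \<gamma>)\<close> from the weighted residual.\<close>

definition value_factor :: "real \<Rightarrow> nat \<Rightarrow> real" where
  "value_factor C l = noise_factor C l + 1 / (1 - \<gamma>) * (Cr + 2 * debias_bound C l)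
     + (1 + 2 * C / (1 - \<gamma>)) * (debias_factor C l + 2 * debias_bound C l * real l ^ 2)"

end

text \<open>One fold at one sample point: \<open>J\<close> will be the set of index pairs of the
  fold, and the three fitted functions are arbitrary apart from the bound \<open>C\<close>.\<close>

locale evaluation_sample = finite_support_evaluation p r \<gamma> \<pi> \<G> p_lim Cr
  for p :: "'a \<Rightarrow> 's \<Rightarrow> 's pmf" and r \<gamma> \<pi> \<G> p_lim Cr +
  fixes J :: "'i set" and z :: "'i \<Rightarrow> ('s, 'a) obs" and C \<Delta> :: real
    and \<tau> :: "'a \<Rightarrow> 's \<Rightarrow> 'a \<Rightarrow> 's \<Rightarrow> real" and Q w :: "'a \<Rightarrow> 's \<Rightarrow> real"
  assumes finite_J: "finite J" and J_nonempty: "J \<noteq> {}"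
    and regular: "\<And>i. i \<in> J \<Longrightarrow> regular_obs (z i)"
    and \<tau>_bound: "\<And>a s a\<^sub>0 s\<^sub>0. \<bar>\<tau> a s a\<^sub>0 s\<^sub>0\<bar> \<le> C"
    and Q_bound: "\<And>a s. \<bar>Q a s\<bar> \<le> C"
    and w_bound: "\<And>a s. \<bar>w a s\<bar> \<le> C"
    and noise_bound: "\<And>\<phi>. \<phi> \<in> noises \<Longrightarrow> \<bar>\<Sum>i\<in>J. \<phi> (z i)\<bar> \<le> \<Delta>"
    and Delta_nonneg: "0 \<le> \<Delta>"
begin

section \<open>Means over index tuples and their distance from \<open>Q_pi\<close>\<close>

abbreviation "N \<equiv> real (card J)"

abbreviation "debias_all xs \<equiv> foldr (\<lambda>i. debias \<gamma> \<pi> \<tau> (z i)) xs Q"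

text \<open>Repetitions are allowed on purpose: the outermost index then ranges over all of
  \<open>J\<close>, whatever the others are.\<close>

definition tuple_mean :: "nat \<Rightarrow> 'a \<Rightarrow> 's \<Rightarrow> real" where
  "tuple_mean l a s = (\<Sum>xs\<in>{xs. set xs \<subseteq> J \<and> length xs = l}. debias_all xs a s) / N ^ l"

lemma C_nonneg: "0 \<le> C"
  using Q_bound[of undefined undefined] by linarith

lemma N_pos: "0 < N"
  using finite_J J_nonempty by (simp add: card_gt_0_iff)

lemma debias_all_bounded:
  "set xs \<subseteq> J \<Longrightarrow> bounded_on_support (debias_all xs) (debias_bound C (length xs))"
proof (induction xs)
  case (Cons i xs)
  then have IH: "bounded_on_support (debias_all xs) (debias_bound C (length xs))" and i: "i \<in> J" by auto
  show ?case
    unfolding bounded_on_support_def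
  proof safe
    fix a s assume as: "(a, s) \<in> set_pmf p_lim"
    have "\<bar>1 / (1 - \<gamma>) * td (\<lambda>x. \<tau> (fst x) (snd x) a s) (debias_all xs) (z i)\<bar>
      \<le> 1 / (1 - \<gamma>) * (C * (Cr + 2 * debias_bound C (length xs)))"
      unfolding abs_mult[of "1 / (1 - \<gamma>)"] using gamma_less_1
      by (intro mult_mono abs_td_le[OF regular[OF i] _ IH] \<tau>_bound) auto
    then show "\<bar>debias_all (i # xs) a s\<bar> \<le> debias_bound C (length (i # xs))"
      using bounded_on_supportD[OF IH as] unfolding foldr_Cons comp_apply debias_eq_td by (simp add: abs_if split: if_splits)
  qed
qed (simp add: bounded_on_support_def Q_bound)

lemma tuple_mean_bounded: "bounded_on_support (tuple_mean l) (debias_bound C l)"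
  unfolding bounded_on_support_def
proof safe
  fix a s assume as: "(a, s) \<in> set_pmf p_lim"
  have "\<bar>\<Sum>xs\<in>{xs. set xs \<subseteq> J \<and> length xs = l}. debias_all xs a s\<bar>
    \<le> (\<Sum>xs\<in>{xs. set xs \<subseteq> J \<and> length xs = l}. debias_bound C l)"
    using bounded_on_supportD[OF debias_all_bounded as]
    by (intro order_trans[OF sum_abs] sum_mono) auto
  also have "\<dots> = debias_bound C l * N ^ l"
    by (simp add: card_lists_length_eq[OF finite_J])
  finally show "\<bar>tuple_mean l a s\<bar> \<le> debias_bound C l"
    using N_pos by (simp add: tuple_mean_def divide_le_eq)
qed

text \<open>\<open>td\<close> is affine in \<open>Q\<close>, so it commutes with means over a
  nonempty set. The next state must be a successor state, where \<open>state_value\<close> is a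
  finite sum.\<close>

lemma td_mean:
  fixes I :: "'k set"
  assumes "regular_obs y" and that: "finite I" "I \<noteq> {}"
  shows "td g (\<lambda>a s. (\<Sum>i\<in>I. f i a s) / real (card I)) y = (\<Sum>i\<in>I. td g (f i) y) / real (card I)"
proof -
  obtain s a r' s' where y: "y = (s, a, r', s')" by (cases y)
  have s': "s' \<in> succ_states" using assms by (simp add: regular_obs_def y)
  have "card I \<noteq> 0" using that by simp
  then show ?thesis
    by (simp add: td_def y state_value_mean[OF s'] sum.distrib sum_subtractf field_simps sum_distrib_left)
qed

text \<open>Split off the outermost index and use \<open>td_mean\<close> to average over the others
  first: the averaged operator is applied to the averaged function.\<close>

lemma tuple_mean_Suc:
  "tuple_mean (Suc l) a s = tuple_mean l a s
     + 1 / (1 - \<gamma>) * ((\<Sum>i\<in>J. td (\<lambda>x. \<tau> (fst x) (snd x) a s) (tuple_mean l) (z i)) / N)"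
proof -
  let ?L = "{xs. set xs \<subseteq> J \<and> length xs = l}"
  let ?g = "\<lambda>x. \<tau> (fst x) (snd x) a s"
  have L: "finite ?L" "?L \<noteq> {}" and cL: "real (card ?L) = N ^ l"
    using finite_lists_length_eq[OF finite_J] J_nonempty
    by (auto simp: card_lists_length_eq[OF finite_J] intro!: exI[of _ "replicate l (SOME i. i \<in> J)"] some_in_eq[THEN iffD2])
  have tm: "tuple_mean l = (\<lambda>a s. (\<Sum>xs\<in>?L. debias_all xs a s) / real (card ?L))"
    by (simp add: tuple_mean_def cL fun_eq_iff)
  have "(\<Sum>xs\<in>{xs. set xs \<subseteq> J \<and> length xs = Suc l}. debias_all xs a s)
    = (\<Sum>(xs, i)\<in>?L \<times> J. debias_all (i # xs) a s)"
    unfolding lists_length_Suc_eq by (subst sum.reindex) (auto simp: inj_on_def case_prod_beta')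
  also have "\<dots> = (\<Sum>i\<in>J. \<Sum>xs\<in>?L. debias_all (i # xs) a s)"
    by (subst sum.swap) (simp add: sum.cartesian_product)
  also have "\<dots> = (\<Sum>i\<in>J. N ^ l * tuple_mean l a s + 1 / (1 - \<gamma>) * (N ^ l * td ?g (tuple_mean l) (z i)))"
  proof (rule sum.cong[OF refl])
    fix i assume i: "i \<in> J"
    have "(\<Sum>xs\<in>?L. debias_all (i # xs) a s)
      = (\<Sum>xs\<in>?L. debias_all xs a s) + 1 / (1 - \<gamma>) * (\<Sum>xs\<in>?L. td ?g (debias_all xs) (z i))"
      by (simp add: debias_eq_td sum.distrib sum_distrib_left)
    moreover have "(\<Sum>xs\<in>?L. td ?g (debias_all xs) (z i)) = N ^ l * td ?g (tuple_mean l) (z i)"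
    proof -
      have "td ?g (tuple_mean l) (z i) = (\<Sum>xs\<in>?L. td ?g (debias_all xs) (z i)) / N ^ l"
        by (subst tm) (subst td_mean[OF regular[OF i] L], simp only: cL)
      then show ?thesis using N_pos by simp
    qed
    moreover have "(\<Sum>xs\<in>?L. debias_all xs a s) = N ^ l * tuple_mean l a s"
      unfolding tuple_mean_def using N_pos by simp
    ultimately show "(\<Sum>xs\<in>?L. debias_all (i # xs) a s)
      = N ^ l * tuple_mean l a s + 1 / (1 - \<gamma>) * (N ^ l * td ?g (tuple_mean l) (z i))" by simp
  qed
  also have "\<dots> = N ^ Suc l * (tuple_mean l a s
     + 1 / (1 - \<gamma>) * ((\<Sum>i\<in>J. td ?g (tuple_mean l) (z i)) / N))"
  proof -
    \<comment> \<open>Keeping this factor opaque stops the simplifier from clearing its denominator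
      along with \<open>N\<close>.\<close>
    define c where "c = 1 / (1 - \<gamma>)"
    show ?thesis
      unfolding c_def[symmetric] using N_pos
      by (simp add: sum.distrib distrib_left mult_ac flip: sum_distrib_left)
  qed
  finally show ?thesis
    unfolding tuple_mean_def[of "Suc l"] using N_pos by simp
qed

lemma mean_td_close:
  assumes g: "\<And>x. \<bar>g x\<bar> \<le> C" and q: "bounded_on_support q (debias_bound C l)"
  shows "\<bar>1 / (1 - \<gamma>) * ((\<Sum>i\<in>J. td g q (z i)) / N) - 1 / (1 - \<gamma>) * mean_residual g q\<bar>
    \<le> noise_factor C l * (\<Delta> / N)"
proof -
  have "\<bar>(\<Sum>i\<in>J. td g q (z i)) - N * mean_residual g q\<bar> \<le> real (card (set_pmf p_lim)) *
      (C * (1 + real (card succ_states) * debias_bound C l + (Cr + 2 * debias_bound C l))) * \<Delta>"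
    by (rule sum_td_close) (use g q in \<open>auto intro: finite_J regular noise_bound C_nonneg debias_bound_nonneg Delta_nonneg\<close>)
  then have "\<bar>(\<Sum>i\<in>J. td g q (z i)) - N * mean_residual g q\<bar> * (1 / (1 - \<gamma>) / N) \<le>
     real (card (set_pmf p_lim)) *
      (C * (1 + real (card succ_states) * debias_bound C l + (Cr + 2 * debias_bound C l))) * \<Delta> * (1 / (1 - \<gamma>) / N)"
    using N_pos gamma_less_1 by (intro mult_right_mono) auto
  moreover have "1 / (1 - \<gamma>) * ((\<Sum>i\<in>J. td g q (z i)) / N) - 1 / (1 - \<gamma>) * mean_residual g q
    = ((\<Sum>i\<in>J. td g q (z i)) - N * mean_residual g q) * (1 / (1 - \<gamma>) / N)"
  proof -
    define c where "c = 1 / (1 - \<gamma>)"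
    show ?thesis unfolding c_def[symmetric] using N_pos by (simp add: field_simps)
  qed
  ultimately show ?thesis
    using N_pos gamma_less_1 by (simp add: abs_mult noise_factor_def mult_ac)
qed

lemma tuple_mean_step:
  assumes x: "x \<in> set_pmf p_lim"
  shows "\<bar>tuple_mean (Suc l) (fst x) (snd x) - (tuple_mean l (fst x) (snd x)
    + 1 / (1 - \<gamma>) * mean_residual (\<lambda>y. \<tau> (fst y) (snd y) (fst x) (snd x)) (tuple_mean l))\<bar>
    \<le> noise_factor C l * (\<Delta> / N)"
  using mean_td_close[of "\<lambda>y. \<tau> (fst y) (snd y) (fst x) (snd x)", OF \<tau>_bound tuple_mean_bounded[of l]]
  by (simp add: tuple_mean_Suc)

text \<open>\<open>Q_pi\<close> is a fixed point of the population map for every weight, so an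
  initial error is only amplified, by at most \<open>1 + 2 * C / (1 - \<gamma>)\<close> per step,
  and noise is added.\<close>

lemma tuple_mean_close_Q:
  assumes e: "bounded_on_support (\<lambda>a s. Q a s - Q_pi a s) e" and e0: "0 \<le> e"
  shows "bounded_on_support (\<lambda>a s. tuple_mean l a s - Q_pi a s) (debias_factor C l * (\<Delta> / N + e))"
proof (induction l)
  case 0
  have "0 \<le> \<Delta> / N" using Delta_nonneg by simp
  moreover have "{xs. set xs \<subseteq> J \<and> length xs = 0} = {[]}" by auto
  ultimately show ?case using e by (fastforce simp: bounded_on_support_def tuple_mean_def)
next
  case (Suc l)
  define d where "d = \<Delta> / N + e"
  have d: "0 \<le> \<Delta> / N" "\<Delta> / N \<le> d" "0 \<le> d" using Delta_nonneg e0 by (auto simp: d_def)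
  show ?case
    unfolding bounded_on_support_def d_def[symmetric]
  proof safe
    fix a s assume as: "(a, s) \<in> set_pmf p_lim"
    let ?g = "\<lambda>y. \<tau> (fst y) (snd y) a s"
    have 1: "\<bar>tuple_mean (Suc l) a s - (tuple_mean l a s + 1 / (1 - \<gamma>) * mean_residual ?g (tuple_mean l))\<bar>
      \<le> noise_factor C l * d"
      using tuple_mean_step[OF as, of l] mult_left_mono[OF d(2) noise_factor_nonneg[OF C_nonneg], of l] by simp
    have 2: "\<bar>tuple_mean l a s - Q_pi a s\<bar> \<le> debias_factor C l * d"
      using bounded_on_supportD[OF Suc as] by (simp add: d_def)
    have "\<bar>mean_residual ?g (tuple_mean l)\<bar> \<le> 2 * C * (debias_factor C l * d)"
      using mean_residual_diff[of ?g C, OF \<tau>_bound Suc] by (simp add: mean_residual_Q_pi d_def)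
    then have 3: "\<bar>1 / (1 - \<gamma>) * mean_residual ?g (tuple_mean l)\<bar> \<le> 1 / (1 - \<gamma>) * (2 * C * (debias_factor C l * d))"
      unfolding abs_mult[of "1 / (1 - \<gamma>)"] using gamma_less_1 by (intro mult_mono) auto
    \<comment> \<open>This is the summand of \<open>debias_factor\<close> that belongs to the case
      of \<tau>; being nonnegative, it can be added for the sake of a common constant.\<close>
    have 4: "0 \<le> 1 / (1 - \<gamma>) * (Cr + 2 * debias_bound C l) * d"
      using gamma_less_1 Cr_nonneg debias_bound_nonneg[OF C_nonneg, of l] d by (intro mult_nonneg_nonneg) auto
    have "\<bar>tuple_mean (Suc l) a s - Q_pi a s\<bar> \<le> noise_factor C l * d + debias_factor C l * d
      + 1 / (1 - \<gamma>) * (2 * C * (debias_factor C l * d)) + 1 / (1 - \<gamma>) * (Cr + 2 * debias_bound C l) * d"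
      using 1 2 3 4 by linarith
    also have "\<dots> = debias_factor C (Suc l) * d" by (simp add: algebra_simps)
    finally show "\<bar>tuple_mean (Suc l) a s - Q_pi a s\<bar> \<le> debias_factor C (Suc l) * d" .
  qed
qed

lemma tuple_mean_close_tau:
  assumes e: "\<And>x y. x \<in> set_pmf p_lim \<Longrightarrow> y \<in> set_pmf p_lim \<Longrightarrow>
      \<bar>\<tau> (fst x) (snd x) (fst y) (snd y) - tau_ratio p \<gamma> \<pi> p_lim (fst x) (snd x) (fst y) (snd y)\<bar> \<le> e"
    and e0: "0 \<le> e"
  shows "bounded_on_support (\<lambda>a s. tuple_mean (Suc l) a s - Q_pi a s) (debias_factor C (Suc l) * (\<Delta> / N + e))"
  unfolding bounded_on_support_def
proof safe
  fix a s assume as: "(a, s) \<in> set_pmf p_lim"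
  define d where "d = \<Delta> / N + e"
  have d: "0 \<le> \<Delta> / N" "\<Delta> / N \<le> d" "0 \<le> d" "e \<le> d" using Delta_nonneg e0 by (auto simp: d_def)
  let ?g = "\<lambda>y. \<tau> (fst y) (snd y) a s"
  let ?h = "\<lambda>y. tau_ratio p \<gamma> \<pi> p_lim (fst y) (snd y) a s"
  have 1: "\<bar>tuple_mean (Suc l) a s - (tuple_mean l a s + 1 / (1 - \<gamma>) * mean_residual ?g (tuple_mean l))\<bar>
    \<le> noise_factor C l * d"
    using tuple_mean_step[OF as, of l] mult_left_mono[OF d(2) noise_factor_nonneg[OF C_nonneg], of l] by simp
  have 2: "tuple_mean l a s + 1 / (1 - \<gamma>) * mean_residual ?h (tuple_mean l) = Q_pi a s"
    using mean_residual_tau[OF as] by simp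
  have "\<bar>mean_residual ?g (tuple_mean l) - mean_residual ?h (tuple_mean l)\<bar> \<le> e * (Cr + 2 * debias_bound C l)"
    by (rule mean_residual_weight_diff[OF _ tuple_mean_bounded]) (use e[OF _ as] in auto)
  also have "\<dots> \<le> d * (Cr + 2 * debias_bound C l)"
    using d Cr_nonneg debias_bound_nonneg[OF C_nonneg, of l] by (intro mult_right_mono) auto
  finally have "\<bar>1 / (1 - \<gamma>) * (mean_residual ?g (tuple_mean l) - mean_residual ?h (tuple_mean l))\<bar>
    \<le> 1 / (1 - \<gamma>) * (d * (Cr + 2 * debias_bound C l))"
    unfolding abs_mult[of "1 / (1 - \<gamma>)"] using gamma_less_1 by (intro mult_mono) auto
  then have 3: "\<bar>1 / (1 - \<gamma>) * mean_residual ?g (tuple_mean l) - 1 / (1 - \<gamma>) * mean_residual ?h (tuple_mean l)\<bar>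
    \<le> 1 / (1 - \<gamma>) * (d * (Cr + 2 * debias_bound C l))"
    by (simp add: right_diff_distrib)
  have 4: "0 \<le> (1 + 2 * C / (1 - \<gamma>)) * debias_factor C l * d"
    using gamma_less_1 C_nonneg debias_factor_ge_0[OF C_nonneg, of l] d by (intro mult_nonneg_nonneg) auto
  have "\<bar>tuple_mean (Suc l) a s - Q_pi a s\<bar> \<le> noise_factor C l * d
    + 1 / (1 - \<gamma>) * (d * (Cr + 2 * debias_bound C l)) + (1 + 2 * C / (1 - \<gamma>)) * debias_factor C l * d"
    using 1 2 3 4 by linarith
  also have "\<dots> = debias_factor C (Suc l) * d" by (simp add: algebra_simps)
  finally show "\<bar>tuple_mean (Suc l) a s - Q_pi a s\<bar> \<le> debias_factor C (Suc l) * (\<Delta> / N + e)"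
    unfolding d_def .
qed

text \<open>For \<open>J = I \<times> {..<T}\<close> and \<open>l = m - 1\<close> this is
  \<open>debiased_Q\<close>.\<close>

definition distinct_mean :: "nat \<Rightarrow> 'a \<Rightarrow> 's \<Rightarrow> real" where
  "distinct_mean l a s =
     (\<Sum>xs\<in>{xs. length xs = l \<and> distinct xs \<and> set xs \<subseteq> J}. debias_all xs a s)
       / real (card {xs. length xs = l \<and> distinct xs \<and> set xs \<subseteq> J})"

lemma distinct_mean_close:
  assumes l: "l \<le> card J"
  shows "bounded_on_support (\<lambda>a s. distinct_mean l a s - tuple_mean l a s) (2 * debias_bound C l * real l ^ 2 / N)"
  unfolding bounded_on_support_def
proof safe
  fix a s assume as: "(a, s) \<in> set_pmf p_lim"
  let ?A = "{xs. length xs = l \<and> distinct xs \<and> set xs \<subseteq> J}" and ?B = "{xs. set xs \<subseteq> J \<and> length xs = l}"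
  have "card ?A \<noteq> 0"
    unfolding card_lists_distinct_length_eq[OF finite_J l] using l by auto
  then have ne: "?A \<noteq> {}" by (metis card.empty)
  have cB: "real (card ?B) = N ^ l" by (simp add: card_lists_length_eq[OF finite_J])
  have "\<bar>distinct_mean l a s - tuple_mean l a s\<bar> \<le> 2 * debias_bound C l * (1 - real (card ?A) / real (card ?B))"
    unfolding distinct_mean_def tuple_mean_def cB[symmetric]
    by (rule mean_subset_diff[OF finite_lists_length_eq[OF finite_J] _ ne])
      (use bounded_on_supportD[OF debias_all_bounded as] in auto)
  also have "\<dots> \<le> 2 * debias_bound C l * (real l ^ 2 / N)"
    using card_distinct_lists_ge[OF finite_J l] debias_bound_nonneg[OF C_nonneg, of l]
    unfolding cB by (intro mult_left_mono) auto
  finally show "\<bar>distinct_mean l a s - tuple_mean l a s\<bar> \<le> 2 * debias_bound C l * real l ^ 2 / N" by simp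
qed

lemma distinct_mean_bounded:
  assumes l: "l \<le> card J"
  shows "bounded_on_support (distinct_mean l) (debias_bound C l)"
  unfolding bounded_on_support_def
proof safe
  fix a s assume as: "(a, s) \<in> set_pmf p_lim"
  let ?A = "{xs. length xs = l \<and> distinct xs \<and> set xs \<subseteq> J}"
  have c: "card ?A \<noteq> 0"
    unfolding card_lists_distinct_length_eq[OF finite_J l] using l by auto
  have "\<bar>\<Sum>xs\<in>?A. debias_all xs a s\<bar> \<le> (\<Sum>xs\<in>?A. debias_bound C l)"
    using bounded_on_supportD[OF debias_all_bounded as]
    by (intro order_trans[OF sum_abs] sum_mono) auto
  then show "\<bar>distinct_mean l a s\<bar> \<le> debias_bound C l"
    using c by (simp add: distinct_mean_def divide_le_eq mult.commute)
qed

text \<open>If the weight is near \<omega>, the value functional is nearly constant and any bounded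
  function will do. In the other two cases the debiased function is near \<open>Q_pi\<close>, where
  the population functional is correct for every weight.\<close>

lemma mean_psi_close:
  assumes l: "0 < l" "l \<le> card J" and e0: "0 \<le> e"
    and e: "bounded_on_support (\<lambda>a s. Q a s - Q_pi a s) e
      \<or> (\<forall>x\<in>set_pmf p_lim. \<forall>y\<in>set_pmf p_lim. \<bar>\<tau> (fst x) (snd x) (fst y) (snd y)
          - tau_ratio p \<gamma> \<pi> p_lim (fst x) (snd x) (fst y) (snd y)\<bar> \<le> e)
      \<or> bounded_on_support (\<lambda>a s. w a s - omega_ratio p \<gamma> \<pi> \<G> p_lim a s) e"
  shows "\<bar>(\<Sum>i\<in>J. psi \<gamma> \<pi> \<G> w (distinct_mean l) (z i)) / N - policy_value p r \<gamma> \<pi> \<G>\<bar>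
    \<le> value_factor C l * (\<Delta> / N + 1 / N + e)"
proof -
  define d where "d = \<Delta> / N + 1 / N + e"
  have d: "0 \<le> \<Delta> / N" "0 \<le> 1 / N" "\<Delta> / N + e \<le> d" "\<Delta> / N \<le> d" "1 / N \<le> d" "e \<le> d" "0 \<le> d"
    using Delta_nonneg e0 N_pos by (auto simp: d_def)
  let ?q = "distinct_mean l"
  let ?g = "\<lambda>x. w (fst x) (snd x)"
  let ?h = "\<lambda>x. omega_ratio p \<gamma> \<pi> \<G> p_lim (fst x) (snd x)"
  define \<eta> where "\<eta> = policy_value p r \<gamma> \<pi> \<G>"
  note q = distinct_mean_bounded[OF l(2)]
  have bnd: "0 \<le> debias_bound C l" by (rule debias_bound_nonneg[OF C_nonneg])
  have psi: "(\<Sum>i\<in>J. psi \<gamma> \<pi> \<G> w ?q (z i)) / N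
    = 1 / (1 - \<gamma>) * ((\<Sum>i\<in>J. td ?g ?q (z i)) / N) + initial_value ?q"
    using N_pos by (simp add: psi_eq_td sum.distrib add_divide_distrib sum_distrib_left sum_divide_distrib)
  have 1: "\<bar>(\<Sum>i\<in>J. psi \<gamma> \<pi> \<G> w ?q (z i)) / N - (1 / (1 - \<gamma>) * mean_residual ?g ?q + initial_value ?q)\<bar>
    \<le> noise_factor C l * d"
    using mean_td_close[of ?g ?q l, OF w_bound q] mult_left_mono[OF d(4) noise_factor_nonneg[OF C_nonneg], of l]
    unfolding psi by linarith
  have a: "0 \<le> 1 / (1 - \<gamma>) * (Cr + 2 * debias_bound C l) * d"
    and b: "0 \<le> (1 + 2 * C / (1 - \<gamma>)) * (debias_factor C l + 2 * debias_bound C l * real l ^ 2) * d"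
    using gamma_less_1 Cr_nonneg bnd d(7) C_nonneg debias_factor_ge_0[OF C_nonneg, of l]
    by (auto intro!: mult_nonneg_nonneg add_nonneg_nonneg)
  have 2: "\<bar>1 / (1 - \<gamma>) * mean_residual ?g ?q + initial_value ?q - \<eta>\<bar>
    \<le> 1 / (1 - \<gamma>) * (Cr + 2 * debias_bound C l) * d
      + (1 + 2 * C / (1 - \<gamma>)) * (debias_factor C l + 2 * debias_bound C l * real l ^ 2) * d"
  proof (cases "bounded_on_support (\<lambda>a s. w a s - omega_ratio p \<gamma> \<pi> \<G> p_lim a s) e")
    case True
    have "\<bar>mean_residual ?g ?q - mean_residual ?h ?q\<bar> \<le> e * (Cr + 2 * debias_bound C l)"
      by (rule mean_residual_weight_diff[OF _ q]) (rule bounded_on_supportD[OF True])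
    also have "\<dots> \<le> d * (Cr + 2 * debias_bound C l)"
      using d Cr_nonneg bnd by (intro mult_right_mono) auto
    finally have "\<bar>1 / (1 - \<gamma>) * (mean_residual ?g ?q - mean_residual ?h ?q)\<bar>
      \<le> 1 / (1 - \<gamma>) * (d * (Cr + 2 * debias_bound C l))"
      unfolding abs_mult[of "1 / (1 - \<gamma>)"] using gamma_less_1 by (intro mult_mono) auto
    moreover have "1 / (1 - \<gamma>) * mean_residual ?g ?q + initial_value ?q - \<eta>
      = 1 / (1 - \<gamma>) * (mean_residual ?g ?q - mean_residual ?h ?q)"
      using mean_residual_omega[of ?q] by (simp add: \<eta>_def right_diff_distrib)
    ultimately show ?thesis using b by (simp add: mult_ac)
  next
    case False
    obtain l' where l': "l = Suc l'" using l(1) by (cases l) auto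
    have tm: "bounded_on_support (\<lambda>a s. tuple_mean l a s - Q_pi a s) (debias_factor C l * (\<Delta> / N + e))"
      using e False tuple_mean_close_Q[OF _ e0, of l] tuple_mean_close_tau[OF _ e0, of l'] unfolding l' by blast
    define e' where "e' = (debias_factor C l + 2 * debias_bound C l * real l ^ 2) * d"
    have e': "bounded_on_support (\<lambda>a s. ?q a s - Q_pi a s) e'"
      unfolding bounded_on_support_def
    proof safe
      fix a s assume as: "(a, s) \<in> set_pmf p_lim"
      have "\<bar>?q a s - tuple_mean l a s\<bar> \<le> 2 * debias_bound C l * real l ^ 2 * (1 / N)"
        using bounded_on_supportD[OF distinct_mean_close[OF l(2)] as] by simp
      also have "\<dots> \<le> 2 * debias_bound C l * real l ^ 2 * d"
        using bnd d by (intro mult_left_mono) auto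
      finally have i: "\<bar>?q a s - tuple_mean l a s\<bar> \<le> 2 * debias_bound C l * real l ^ 2 * d" .
      have "\<bar>tuple_mean l a s - Q_pi a s\<bar> \<le> debias_factor C l * (\<Delta> / N + e)"
        using bounded_on_supportD[OF tm as] by simp
      also have "\<dots> \<le> debias_factor C l * d"
        using d debias_factor_ge_0[OF C_nonneg] by (intro mult_left_mono) auto
      finally show "\<bar>?q a s - Q_pi a s\<bar> \<le> e'"
        using i unfolding e'_def by (simp add: distrib_right)
    qed
    have i: "\<bar>initial_value ?q - \<eta>\<bar> \<le> e'"
      unfolding \<eta>_def policy_value_eq by (rule initial_value_diff[OF e'])
    have "\<bar>mean_residual ?g ?q\<bar> \<le> 2 * C * e'"
      using mean_residual_diff[of ?g C, OF w_bound e'] by (simp add: mean_residual_Q_pi)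
    then have "\<bar>1 / (1 - \<gamma>) * mean_residual ?g ?q\<bar> \<le> 1 / (1 - \<gamma>) * (2 * C * e')"
      unfolding abs_mult[of "1 / (1 - \<gamma>)"] using gamma_less_1 by (intro mult_mono) auto
    with i have "\<bar>1 / (1 - \<gamma>) * mean_residual ?g ?q + initial_value ?q - \<eta>\<bar> \<le> 1 / (1 - \<gamma>) * (2 * C * e') + e'"
      by linarith
    also have "\<dots> = (1 + 2 * C / (1 - \<gamma>)) * e'" by (simp add: algebra_simps)
    finally show ?thesis using a unfolding e'_def by (simp add: mult.assoc)
  qed
  have "\<bar>(\<Sum>i\<in>J. psi \<gamma> \<pi> \<G> w ?q (z i)) / N - \<eta>\<bar> \<le> value_factor C l * d"
    unfolding value_factor_def distrib_right using 1 2 by (simp only: distrib_right)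
  then show ?thesis unfolding d_def \<eta>_def .
qed

end

section \<open>Second moments of the noises along one trajectory\<close>

text \<open>A further term adds its own second moment and twice its covariances with the past, at
  most \<open>\<kappa> 0 + 2 * (\<Sum>u<T. \<kappa> (T - u))\<close>. Every lag occurs once, so the
  increment is at most \<open>2 * suminf \<kappa>\<close>.\<close>

lemma (in prob_space) second_moment_sum_le:
  fixes Y :: "nat \<Rightarrow> 'a \<Rightarrow> real"
  assumes meas [measurable]: "\<And>t. Y t \<in> borel_measurable M"
    and bounded: "\<And>t. AE w in M. \<bar>Y t w\<bar> \<le> B"
    and cov: "\<And>u t. u \<le> t \<Longrightarrow> \<bar>expectation (\<lambda>w. Y u w * Y t w)\<bar> \<le> \<kappa> (t - u)"
    and summable: "summable \<kappa>"
  shows "expectation (\<lambda>w. (\<Sum>t<T. Y t w)\<^sup>2) \<le> 2 * suminf \<kappa> * real T"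
proof (induction T)
  case (Suc T)
  have nonneg: "0 \<le> \<kappa> q" for q using order_trans[OF abs_ge_zero cov[of 0 q]] by simp
  have int: "integrable M (\<lambda>w. Y u w * Y t w)" for u t
  proof (rule integrable_const_bound[of _ "B * B"])
    show "AE w in M. norm (Y u w * Y t w) \<le> B * B"
      using bounded[of u] bounded[of t] by eventually_elim (auto simp: abs_mult intro!: mult_mono)
  qed simp
  have sq: "(\<lambda>w. (\<Sum>t<T. Y t w)\<^sup>2) = (\<lambda>w. \<Sum>u<T. \<Sum>t<T. Y u w * Y t w)" for T
    by (simp add: power2_eq_square sum_product)
  have int_sq: "integrable M (\<lambda>w. (\<Sum>t<T. Y t w)\<^sup>2)" for T
    unfolding sq by (intro Bochner_Integration.integrable_sum int)
  have cross: "expectation (\<lambda>w. (\<Sum>u<T. Y u w * Y T w)) \<le> (\<Sum>u<T. \<kappa> (T - u))"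
    by (subst Bochner_Integration.integral_sum[OF int]) (use cov[of _ T, THEN abs_le_D1] in \<open>auto intro!: sum_mono\<close>)
  have diag: "expectation (\<lambda>w. Y T w * Y T w) \<le> \<kappa> 0"
    using cov[of T T] by simp
  have "expectation (\<lambda>w. (\<Sum>t<Suc T. Y t w)\<^sup>2)
    = expectation (\<lambda>w. (\<Sum>t<T. Y t w)\<^sup>2 + (2 * (\<Sum>u<T. Y u w * Y T w) + Y T w * Y T w))"
    by (simp add: power2_sum flip: sum_distrib_right) (simp add: power2_eq_square ac_simps)
  also have "\<dots> = expectation (\<lambda>w. (\<Sum>t<T. Y t w)\<^sup>2)
      + (2 * expectation (\<lambda>w. (\<Sum>u<T. Y u w * Y T w)) + expectation (\<lambda>w. Y T w * Y T w))"
    using int int_sq by simp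
  also have "\<dots> \<le> 2 * suminf \<kappa> * real T + (2 * (\<Sum>u<T. \<kappa> (T - u)) + \<kappa> 0)"
    using Suc cross diag by linarith
  also have "2 * (\<Sum>u<T. \<kappa> (T - u)) + \<kappa> 0 \<le> 2 * suminf \<kappa>"
  proof -
    have "(\<Sum>u<T. \<kappa> (T - u)) = (\<Sum>q\<in>{1..T}. \<kappa> q)"
      by (rule sum.reindex_bij_witness[of _ "\<lambda>q. T - q" "\<lambda>u. T - u"]) auto
    moreover have "{..<Suc T} = insert 0 {1..T}" by auto
    ultimately have "(\<Sum>u<T. \<kappa> (T - u)) + \<kappa> 0 = (\<Sum>q<Suc T. \<kappa> q)" by simp
    also have "\<dots> \<le> suminf \<kappa>"
      by (rule sum_le_suminf[OF summable]) (use nonneg in auto)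
    finally show ?thesis using nonneg[of 0] by linarith
  qed
  finally show ?case by (simp add: algebra_simps)
qed simp

section \<open>Mixing coefficients and conditional expectations\<close>

context prob_space
begin

lemma sum_partition_measure_Int:
  assumes "finite V" "partition_on (space M) V" "V \<subseteq> events" "A \<in> events"
  shows "(\<Sum>B\<in>V. prob (A \<inter> B)) = prob A"
proof -
  have "prob A = prob (\<Union>B\<in>V. A \<inter> B)"
    using assms sets.sets_into_space[of A M] by (intro arg_cong[where f = prob]) (auto simp: partition_on_def)
  also have "\<dots> = (\<Sum>B\<in>V. prob (A \<inter> B))"
    using assms by (intro finite_measure_finite_Union)
      (auto simp: disjoint_family_on_def dest: partition_onD2 disjointD)
  finally show ?thesis by simp
qed

lemma sum_partition_measure:
  assumes "finite V" "partition_on (space M) V" "V \<subseteq> events"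
  shows "(\<Sum>B\<in>V. prob B) = 1"
proof -
  have "(\<Sum>B\<in>V. prob (space M \<inter> B)) = 1"
    using sum_partition_measure_Int[OF assms sets.top] by (simp add: prob_space)
  moreover have "space M \<inter> B = B" if "B \<in> V" for B
    using that assms sets.sets_into_space by blast
  ultimately show ?thesis by simp
qed

lemma beta_sum_le_1:
  assumes U: "finite U" "partition_on (space M) U" "U \<subseteq> events"
    and V: "finite V" "partition_on (space M) V" "V \<subseteq> events"
  shows "(1 / 2) * (\<Sum>A\<in>U. \<Sum>B\<in>V. \<bar>prob (A \<inter> B) - prob A * prob B\<bar>) \<le> 1"
proof -
  have "(\<Sum>A\<in>U. \<Sum>B\<in>V. \<bar>prob (A \<inter> B) - prob A * prob B\<bar>) \<le> (\<Sum>A\<in>U. \<Sum>B\<in>V. prob (A \<inter> B) + prob A * prob B)"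
    by (intro sum_mono) (auto simp: abs_le_iff add_nonneg_nonneg)
  also have "\<dots> = (\<Sum>A\<in>U. prob A) + (\<Sum>A\<in>U. prob A) * (\<Sum>B\<in>V. prob B)"
    using U(3) by (simp add: sum.distrib sum_partition_measure_Int[OF V] subset_iff sum_product)
  also have "\<dots> = 2" by (simp add: sum_partition_measure[OF U] sum_partition_measure[OF V])
  finally show ?thesis by simp
qed

text \<open>For the covariance bound take the partitions into \<open>A\<close>, \<open>B\<close> and
  their complements: all four cells have the same absolute covariance \<open>d\<close>, so half of
  the sum is \<open>2 * d\<close>.\<close>

lemma beta_coeff_bounds:
  assumes F: "subalgebra M F" and G: "subalgebra M G"
  shows abs_cov_le_beta_coeff: "A \<in> sets F \<Longrightarrow> B \<in> sets G \<Longrightarrow> \<bar>prob (A \<inter> B) - prob A * prob B\<bar> \<le> beta_coeff M F G"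
    and beta_coeff_le_1: "beta_coeff M F G \<le> 1"
    and beta_coeff_nonneg: "0 \<le> beta_coeff M F G"
proof -
  define P where "P = {(U, V). finite U \<and> U \<subseteq> sets F \<and> partition_on (space M) U \<and>
                           finite V \<and> V \<subseteq> sets G \<and> partition_on (space M) V}"
  define h where "h = (\<lambda>(U, V). (1 / 2) * (\<Sum>A\<in>U. \<Sum>B\<in>V. \<bar>prob (A \<inter> B) - prob A * prob B\<bar>))"
  have beta: "beta_coeff M F G = (SUP x\<in>P. h x)"
    unfolding beta_coeff_def P_def h_def ..
  have sub: "sets F \<subseteq> events" "sets G \<subseteq> events" "space F = space M" "space G = space M"
    using F G by (auto simp: subalgebra_def)
  have le1: "h x \<le> 1" if "x \<in> P" for x
  proof -
    obtain U V where x: "x = (U, V)" by (cases x)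
    show ?thesis
      using that sub beta_sum_le_1[of U V] unfolding P_def h_def x by auto
  qed
  then have bdd: "bdd_above (h ` P)" by (rule bdd_aboveI2)
  have triv: "({space M}, {space M}) \<in> P"
    using not_empty sub sets.top[of F] sets.top[of G] by (auto simp: P_def partition_on_def)
  show "beta_coeff M F G \<le> 1"
    unfolding beta using triv le1 by (intro cSUP_least) auto
  show nonneg: "0 \<le> beta_coeff M F G"
  proof -
    have "0 \<le> h ({space M}, {space M})" by (simp add: h_def)
    also have "\<dots> \<le> beta_coeff M F G" unfolding beta by (rule cSUP_upper[OF triv bdd])
    finally show ?thesis .
  qed
  show "\<bar>prob (A \<inter> B) - prob A * prob B\<bar> \<le> beta_coeff M F G" if A: "A \<in> sets F" and B: "B \<in> sets G"
  proof -
    have ev: "A \<in> events" "B \<in> events" using A B sub by auto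
    have AB: "A \<subseteq> space M" "B \<subseteq> space M" using ev sets.sets_into_space by auto
    \<comment> \<open>A block of a partition must be nonempty, so trivial events are treated apart;
      their covariance is 0.\<close>
    consider "A = {}" | "A = space M" | "B = {}" | "B = space M"
      | "A \<noteq> {}" "A \<noteq> space M" "B \<noteq> {}" "B \<noteq> space M" by blast
    then show ?thesis
    proof cases
      case 5
      have ne: "A \<noteq> space M - A" "B \<noteq> space M - B" using 5 by auto
      have in_P: "({A, space M - A}, {B, space M - B}) \<in> P"
        using A B 5 AB sub sets.compl_sets[OF A] sets.compl_sets[OF B]
        by (auto simp: P_def partition_on_def disjoint_def)
      define d where "d = \<bar>prob (A \<inter> B) - prob A * prob B\<bar>"
      have cA: "prob (space M - A) = 1 - prob A" and cB: "prob (space M - B) = 1 - prob B"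
        using ev by (auto simp: prob_compl)
      have 1: "prob (A \<inter> (space M - B)) = prob A - prob (A \<inter> B)"
      proof -
        have "A \<inter> (space M - B) = A - B" using AB by auto
        then show ?thesis using finite_measure_Diff'[OF ev] by simp
      qed
      have 2: "prob ((space M - A) \<inter> B) = prob B - prob (A \<inter> B)"
      proof -
        have "(space M - A) \<inter> B = B - A" using AB by auto
        then show ?thesis using finite_measure_Diff'[OF ev(2) ev(1)] by (simp add: Int_commute)
      qed
      have 3: "prob ((space M - A) \<inter> (space M - B)) = 1 - prob A - prob B + prob (A \<inter> B)"
      proof -
        have "(space M - A) \<inter> (space M - B) = (space M - A) - B" by auto
        then show ?thesis using finite_measure_Diff'[OF sets.compl_sets[OF ev(1)] ev(2)] 2 cA by simp
      qed
      have "h ({A, space M - A}, {B, space M - B}) = (1 / 2) * (d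
        + \<bar>prob (A \<inter> (space M - B)) - prob A * prob (space M - B)\<bar>
        + (\<bar>prob ((space M - A) \<inter> B) - prob (space M - A) * prob B\<bar>
          + \<bar>prob ((space M - A) \<inter> (space M - B)) - prob (space M - A) * prob (space M - B)\<bar>))"
        using ne by (simp add: h_def d_def)
      moreover have "prob (A \<inter> (space M - B)) - prob A * prob (space M - B) = - (prob (A \<inter> B) - prob A * prob B)"
        unfolding 1 cB by (simp add: algebra_simps)
      moreover have "prob ((space M - A) \<inter> B) - prob (space M - A) * prob B = - (prob (A \<inter> B) - prob A * prob B)"
        unfolding 2 cA by (simp add: algebra_simps)
      moreover have "prob ((space M - A) \<inter> (space M - B)) - prob (space M - A) * prob (space M - B)
          = prob (A \<inter> B) - prob A * prob B"
        unfolding 3 cA cB by (simp add: algebra_simps)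
      ultimately have "h ({A, space M - A}, {B, space M - B}) = (1 / 2) * (d + d + (d + d))"
        by (simp only: abs_minus_cancel d_def)
      then have "h ({A, space M - A}, {B, space M - B}) = 2 * d" by simp
      moreover have "h ({A, space M - A}, {B, space M - B}) \<le> beta_coeff M F G"
        unfolding beta by (rule cSUP_upper[OF in_P bdd])
      moreover have "0 \<le> d" by (simp add: d_def)
      ultimately have "d \<le> beta_coeff M F G" by linarith
      then show ?thesis unfolding d_def .
    qed (use nonneg in \<open>simp_all add: prob_space Int_absorb1 Int_absorb2 AB\<close>)
  qed
qed

lemma subalgebra_vimage_algebra:
  assumes "f \<in> measurable M N"
  shows "subalgebra M (vimage_algebra (space M) f N)"
  using assms measurable_space[OF assms] unfolding subalgebra_def
  by (auto simp: sets_vimage_algebra2 measurable_sets)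

text \<open>A factor measurable with respect to \<open>F\<close> can be pulled out of the
  conditional expectation, so \<open>g\<close> and \<open>k\<close> have the same mean against
  \<open>V\<close>.\<close>

lemma cond_exp_orthogonal:
  fixes g :: "'a \<Rightarrow> real"
  assumes F: "subalgebra M F" and V: "V \<in> borel_measurable F" and V_bound: "AE w in M. \<bar>V w\<bar> \<le> B"
    and g [measurable]: "g \<in> borel_measurable M" and g_bound: "AE w in M. \<bar>g w\<bar> \<le> C"
    and k [measurable]: "k \<in> borel_measurable M"
    and cond: "AE w in M. real_cond_exp M F g w = k w"
  shows "expectation (\<lambda>w. V w * (g w - k w)) = 0"
proof -
  interpret finite_measure_subalgebra M F by unfold_locales (rule F)
  have V' [measurable]: "V \<in> borel_measurable M" by (rule measurable_from_subalg[OF F V])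
  have int: "integrable M (\<lambda>w. V w * g w)"
  proof (rule integrable_const_bound[of _ "B * C"])
    show "AE w in M. norm (V w * g w) \<le> B * C"
      using V_bound g_bound by eventually_elim (auto simp: abs_mult intro!: mult_mono)
  qed simp
  have 1: "integrable M (\<lambda>w. V w * real_cond_exp M F g w)"
    and 2: "expectation (\<lambda>w. V w * real_cond_exp M F g w) = expectation (\<lambda>w. V w * g w)"
    using real_cond_exp_intg[OF int V g] by auto
  have ae: "AE w in M. V w * real_cond_exp M F g w = V w * k w"
    using cond by eventually_elim simp
  have "integrable M (\<lambda>w. V w * k w)"
    by (rule integrable_cong_AE_imp[OF 1]) (use ae in auto)
  moreover have "expectation (\<lambda>w. V w * k w) = expectation (\<lambda>w. V w * g w)"
    unfolding 2[symmetric] by (rule integral_cong_AE) (use ae in auto)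
  ultimately show ?thesis using int by (simp add: right_diff_distrib)
qed

end

section \<open>A single trajectory of the data process\<close>

lemma measurable_St [measurable]: "St \<in> measurable step_space (count_space UNIV)"
  and measurable_Ac [measurable]: "Ac \<in> measurable step_space (count_space UNIV)"
  and measurable_Rw [measurable]: "Rw \<in> borel_measurable step_space"
  unfolding step_space_def by measurable

lemma measurable_state_action:
  fixes f :: "'a::countable \<Rightarrow> 's::countable \<Rightarrow> real"
  assumes [measurable]: "Z \<in> measurable N step_space"
  shows "(\<lambda>w. f (Ac (Z w)) (St (Z w))) \<in> borel_measurable N"
proof -
  have "(\<lambda>w. f (Ac (Z w)) s) \<in> borel_measurable N" for s
    by (rule measurable_compose_countable[of "\<lambda>a w. f a s"]) measurable
  then show ?thesis
    by (rule measurable_compose_countable[of "\<lambda>s w. f (Ac (Z w)) s"]) measurable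
qed

definition obs_at :: "(nat \<Rightarrow> 'w \<Rightarrow> ('s, 'a) step) \<Rightarrow> nat \<Rightarrow> 'w \<Rightarrow> ('s, 'a) obs" where
  "obs_at X t w = (St (X t w), Ac (X t w), Rw (X t w), St (X (Suc t) w))"

lemma abs_of_bool_diff_pmf_le: "\<bar>of_bool P - pmf q y\<bar> \<le> 1"
proof -
  have "0 \<le> pmf q y" "pmf q y \<le> 1" by (auto simp: pmf_le_1)
  then show ?thesis by (cases P; simp only: of_bool_eq; linarith)
qed

locale mdp_data = finite_support_evaluation p r \<gamma> \<pi> \<G> p_lim Cr + prob_space M
  for p :: "'a::countable \<Rightarrow> 's::countable \<Rightarrow> 's pmf" and r \<gamma> \<pi> \<G> p_lim Cr and M :: "'w measure" +
  fixes b :: "nat \<Rightarrow> (nat \<Rightarrow> ('s, 'a) step) \<Rightarrow> 's \<Rightarrow> 'a pmf"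
    and X :: "nat \<Rightarrow> 'w \<Rightarrow> ('s, 'a) step"
  assumes mdp: "mdp_trajectory M p r b X"
    and reward_bound: "\<And>t. AE w in M. \<bar>Rw (X t w)\<bar> \<le> Cr"
    and stationary: "strictly_stationary M X"
    and mixing: "exponentially_beta_mixing M X"
    and limiting: "limiting_sa_distribution M X p_lim"
begin

lemma measurable_X [measurable]: "X t \<in> measurable M step_space"
  using mdp by (simp add: mdp_trajectory_def)

text \<open>By stationarity the visit probability is constant in time, so it already equals its
  limit.\<close>

lemma prob_visit: "prob {w \<in> space M. Ac (X t w) = a \<and> St (X t w) = s} = pmf p_lim (a, s)"
proof -
  let ?P = "\<Pi>\<^sub>M t\<in>(UNIV :: nat set). (step_space :: ('s, 'a) step measure)"
  \<comment> \<open>A cylinder event at time 0: under the path shifted by \<open>h\<close> it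
    describes a visit at time \<open>h\<close>.\<close>
  define A where "A = {x \<in> space ?P. Ac (x 0) = a \<and> St (x 0) = s}"
  have A: "A \<in> sets ?P" unfolding A_def by measurable
  have shift: "(\<lambda>w t. X (t + h) w) \<in> measurable M ?P" for h
    by (rule measurable_PiM_single') (auto dest: measurable_space[OF measurable_X])
  have eq: "prob {w \<in> space M. Ac (X h w) = a \<and> St (X h w) = s} = measure (distr M ?P (\<lambda>w t. X (t + h) w)) A" for h
    using measurable_space[OF shift, of _ h]
    by (subst measure_distr[OF shift A]) (auto simp: A_def intro!: arg_cong[where f = prob])
  have const: "prob {w \<in> space M. Ac (X h w) = a \<and> St (X h w) = s}
    = prob {w \<in> space M. Ac (X 0 w) = a \<and> St (X 0 w) = s}" for h
    using stationary[unfolded strictly_stationary_def] unfolding eq by simp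
  have lim: "(\<lambda>h. prob {w \<in> space M. Ac (X h w) = a \<and> St (X h w) = s}) \<longlonglongrightarrow> pmf p_lim (a, s)"
    using limiting unfolding limiting_sa_distribution_def by blast
  have "(\<lambda>h. prob {w \<in> space M. Ac (X h w) = a \<and> St (X h w) = s})
    \<longlonglongrightarrow> prob {w \<in> space M. Ac (X 0 w) = a \<and> St (X 0 w) = s}"
    by (rule tendsto_eventually) (intro always_eventually allI const)
  from LIMSEQ_unique[OF this lim] show ?thesis by (subst const)
qed

lemma AE_in_support: "AE w in M. (Ac (X t w), St (X t w)) \<in> set_pmf p_lim"
proof -
  have "AE w in M. (a, s) \<notin> set_pmf p_lim \<longrightarrow> (Ac (X t w), St (X t w)) \<noteq> (a, s)" for a s
  proof (cases "(a, s) \<in> set_pmf p_lim")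
    case False
    then have "prob {w \<in> space M. Ac (X t w) = a \<and> St (X t w) = s} = 0"
      by (simp add: prob_visit set_pmf_iff)
    then have "AE w in M. \<not> (Ac (X t w) = a \<and> St (X t w) = s)"
      by (subst (asm) prob_eq_0) auto
    then show ?thesis by eventually_elim auto
  qed auto
  then have "AE w in M. \<forall>x. x \<notin> set_pmf p_lim \<longrightarrow> (Ac (X t w), St (X t w)) \<noteq> x"
    unfolding AE_all_countable by (auto simp: split_paired_all)
  then show ?thesis by eventually_elim blast
qed

lemma steps_measurable: "(\<lambda>w. \<lambda>j\<in>J. X j w) \<in> measurable M (Pi\<^sub>M J (\<lambda>_. step_space))"
  by (rule measurable_restrict) measurable

lemma subalgebra_steps: "subalgebra M (sigma_steps M X J)"
  unfolding sigma_steps_def by (rule subalgebra_vimage_algebra) (rule steps_measurable)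

lemma subalgebra_hist_SA: "subalgebra M (sigma_hist_SA M X t)"
  unfolding sigma_hist_SA_def
proof (rule subalgebra_vimage_algebra)
  have [measurable]: "(\<lambda>w. \<lambda>j\<in>{..<t}. X j w) \<in> measurable M (Pi\<^sub>M {..<t} (\<lambda>_. step_space))"
    by (rule steps_measurable)
  show "(\<lambda>w. ((St (X t w), Ac (X t w)), \<lambda>j\<in>{..<t}. X j w))
    \<in> measurable M ((count_space UNIV \<Otimes>\<^sub>M count_space UNIV) \<Otimes>\<^sub>M Pi\<^sub>M {..<t} (\<lambda>_. step_space))"
    by measurable
qed

lemma X_measurable_steps:
  assumes "j \<in> J"
  shows "X j \<in> measurable (sigma_steps M X J) step_space"
proof -
  have "(\<lambda>w. \<lambda>j\<in>J. X j w) \<in> measurable (sigma_steps M X J) (Pi\<^sub>M J (\<lambda>_. step_space))"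
    unfolding sigma_steps_def using measurable_space[OF steps_measurable]
    by (intro measurable_vimage_algebra1) auto
  from measurable_compose[OF this measurable_component_singleton[OF assms]]
  show ?thesis using assms by simp
qed

lemma hist_SA_measurable:
  "(\<lambda>w. ((St (X t w), Ac (X t w)), \<lambda>j\<in>{..<t}. X j w)) \<in> measurable (sigma_hist_SA M X t)
     ((count_space UNIV \<Otimes>\<^sub>M count_space UNIV) \<Otimes>\<^sub>M Pi\<^sub>M {..<t} (\<lambda>_. step_space))"
  unfolding sigma_hist_SA_def using measurable_space[OF steps_measurable]
  by (intro measurable_vimage_algebra1) (auto simp: space_pair_measure)

lemma X_measurable_hist_SA:
  assumes "j < t"
  shows "X j \<in> measurable (sigma_hist_SA M X t) step_space"
  using measurable_compose[OF measurable_compose[OF hist_SA_measurable measurable_snd]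
      measurable_component_singleton[of j "{..<t}"]] assms by simp

lemma SA_measurable_hist_SA:
  "(\<lambda>w. Ac (X t w)) \<in> measurable (sigma_hist_SA M X t) (count_space UNIV)"
  "(\<lambda>w. St (X t w)) \<in> measurable (sigma_hist_SA M X t) (count_space UNIV)"
  using measurable_compose[OF measurable_compose[OF hist_SA_measurable measurable_fst] measurable_snd]
    measurable_compose[OF measurable_compose[OF hist_SA_measurable measurable_fst] measurable_fst]
  by simp_all

lemma cond_reward:
  "AE w in M. real_cond_exp M (sigma_hist_SA M X t) (\<lambda>w. Rw (X t w)) w = r (Ac (X t w)) (St (X t w))"
  using mdp by (simp add: mdp_trajectory_def)

lemma cond_transition:
  "AE w in M. real_cond_exp M (sigma_steps M X {..t}) (indicator {w \<in> space M. St (X (Suc t) w) = s}) w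
     = pmf (p (Ac (X t w)) (St (X t w))) s"
  using mdp by (simp add: mdp_trajectory_def)

lemma reward_orthogonal:
  assumes V: "V \<in> borel_measurable (sigma_hist_SA M X t)" and V_bound: "AE w in M. \<bar>V w\<bar> \<le> B"
  shows "expectation (\<lambda>w. V w * (Rw (X t w) - r (Ac (X t w)) (St (X t w)))) = 0"
  by (rule cond_exp_orthogonal[OF subalgebra_hist_SA V V_bound _ reward_bound _ cond_reward])
    (auto intro: measurable_state_action)

lemma transition_orthogonal:
  assumes V: "V \<in> borel_measurable (sigma_steps M X {..t})" and V_bound: "AE w in M. \<bar>V w\<bar> \<le> B"
  shows "expectation (\<lambda>w. V w * (of_bool (St (X (Suc t) w) = s) - pmf (p (Ac (X t w)) (St (X t w))) s)) = 0"
proof -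
  have "expectation (\<lambda>w. V w * (indicator {w \<in> space M. St (X (Suc t) w) = s} w - pmf (p (Ac (X t w)) (St (X t w))) s)) = 0"
    by (rule cond_exp_orthogonal[OF subalgebra_steps V V_bound _ _ _ cond_transition, where C = 1])
      (auto intro: measurable_state_action simp: indicator_def)
  also have "expectation (\<lambda>w. V w * (indicator {w \<in> space M. St (X (Suc t) w) = s} w - pmf (p (Ac (X t w)) (St (X t w))) s))
    = expectation (\<lambda>w. V w * (of_bool (St (X (Suc t) w) = s) - pmf (p (Ac (X t w)) (St (X t w))) s))"
    by (rule Bochner_Integration.integral_cong) (auto simp: indicator_def)
  finally show ?thesis .
qed

text \<open>Orthogonality with the constant 1 equates the probability of the next state
  \<open>s\<close> with the mean of the kernel at \<open>s\<close>. For \<open>s\<close> outside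
  \<open>succ_states\<close> the kernel vanishes at almost every current pair.\<close>

lemma AE_succ_states: "AE w in M. St (X (Suc t) w) \<in> succ_states"
proof -
  have "AE w in M. s \<notin> succ_states \<longrightarrow> St (X (Suc t) w) \<noteq> s" for s
  proof (cases "s \<in> succ_states")
    case False
    have [measurable]: "(\<lambda>w. pmf (p (Ac (X t w)) (St (X t w))) s) \<in> borel_measurable M"
      by (rule measurable_state_action) measurable
    have "AE w in M. pmf (p (Ac (X t w)) (St (X t w))) s = 0"
      using AE_in_support[of t] by eventually_elim (use False in \<open>force simp: succ_states_def set_pmf_iff\<close>)
    then have "expectation (\<lambda>w. 1 * (of_bool (St (X (Suc t) w) = s) - pmf (p (Ac (X t w)) (St (X t w))) s))
      = expectation (\<lambda>w. indicator {w \<in> space M. St (X (Suc t) w) = s} w)"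
      by (intro integral_cong_AE) (auto simp: indicator_def elim!: eventually_mono)
    moreover have "expectation (\<lambda>w. 1 * (of_bool (St (X (Suc t) w) = s) - pmf (p (Ac (X t w)) (St (X t w))) s)) = 0"
      by (rule transition_orthogonal[where B = 1]) auto
    ultimately have "prob {w \<in> space M. St (X (Suc t) w) = s} = 0" by simp
    then have "AE w in M. \<not> St (X (Suc t) w) = s"
      by (subst (asm) prob_eq_0) auto
    then show ?thesis by eventually_elim auto
  qed auto
  then have "AE w in M. \<forall>s. s \<notin> succ_states \<longrightarrow> St (X (Suc t) w) \<noteq> s"
    unfolding AE_all_countable by auto
  then show ?thesis by eventually_elim blast
qed

lemma AE_regular_obs: "AE w in M. regular_obs (obs_at X t w)"
  using AE_in_support[of t] AE_succ_states[of t] reward_bound[of t]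
  by eventually_elim (simp add: regular_obs_def obs_at_def)

text \<open>The measurable space is left open because the noises are needed over \<open>M\<close>,
  over the sigma-algebras of the past and over path space.\<close>

lemma noise_measurable_gen:
  fixes Z Z' :: "'c \<Rightarrow> ('s, 'a) step"
  assumes "Z \<in> measurable N step_space" and "Z' \<in> measurable N step_space"
  shows "(\<lambda>w. reward_noise x (St (Z w), Ac (Z w), Rw (Z w), St (Z' w))) \<in> borel_measurable N"
    and "(\<lambda>w. transition_noise x y (St (Z w), Ac (Z w), Rw (Z w), St (Z' w))) \<in> borel_measurable N"
    and "(\<lambda>w. visit_noise x (St (Z w), Ac (Z w), Rw (Z w), St (Z' w))) \<in> borel_measurable N"
proof -
  note [measurable] = assms
  have [measurable]: "(\<lambda>w. of_bool ((Ac (Z w), St (Z w)) = x) :: real) \<in> borel_measurable N"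
    by (rule measurable_state_action[where f = "\<lambda>a s. of_bool ((a, s) = x)"]) measurable
  have [measurable]: "(\<lambda>w. r (Ac (Z w)) (St (Z w))) \<in> borel_measurable N"
    by (rule measurable_state_action) measurable
  have [measurable]: "(\<lambda>w. pmf (p (Ac (Z w)) (St (Z w))) y) \<in> borel_measurable N"
    by (rule measurable_state_action) measurable
  show "(\<lambda>w. reward_noise x (St (Z w), Ac (Z w), Rw (Z w), St (Z' w))) \<in> borel_measurable N"
    unfolding reward_noise_def prod.case by measurable
  have [measurable]: "(\<lambda>w. of_bool (St (Z' w) = y) :: real) \<in> borel_measurable N"
    by (rule measurable_state_action[OF assms(2), where f = "\<lambda>a s. of_bool (s = y)"])
  show "(\<lambda>w. transition_noise x y (St (Z w), Ac (Z w), Rw (Z w), St (Z' w))) \<in> borel_measurable N"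
    unfolding transition_noise_def prod.case by measurable
  show "(\<lambda>w. visit_noise x (St (Z w), Ac (Z w), Rw (Z w), St (Z' w))) \<in> borel_measurable N"
    unfolding visit_noise_def prod.case by measurable
qed

section \<open>Means and covariances of the noises\<close>

definition noise_bound :: real where "noise_bound = 2 * Cr + 1"

text \<open>Reward noise is at most \<open>2 * Cr\<close>, the other two are at most 1.\<close>

lemma noise_le:
  assumes "regular_obs z" "\<phi> \<in> noises"
  shows "\<bar>\<phi> z\<bar> \<le> noise_bound"
proof -
  obtain s a r' s' where z: "z = (s, a, r', s')" by (cases z)
  have "\<bar>r'\<bar> \<le> Cr" using assms(1) by (simp add: regular_obs_def z)
  then have 1: "\<bar>r' - r a s\<bar> \<le> noise_bound" using r_bound[of a s] by (simp add: noise_bound_def)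
  have 2: "\<bar>of_bool P * (of_bool P' - pmf q y)\<bar> \<le> noise_bound" for P P' q and y :: 's
    using order_trans[OF mult_left_le_one_le[of "\<bar>of_bool P' - pmf q y\<bar>" "of_bool P"] abs_of_bool_diff_pmf_le] Cr_nonneg
    by (simp add: noise_bound_def abs_mult)
  have 3: "\<bar>of_bool P - pmf p_lim x\<bar> \<le> noise_bound" for P x
    using abs_of_bool_diff_pmf_le[of P p_lim x] Cr_nonneg by (simp add: noise_bound_def)
  have 4: "\<bar>of_bool P * (r' - r a s)\<bar> \<le> noise_bound" for P
    using 1 by (cases P) auto
  from assms(2) consider x where "\<phi> = reward_noise x" | x y where "\<phi> = transition_noise x y" | x where "\<phi> = visit_noise x"
    by (auto simp: noises_def)
  then show ?thesis
    using 2 3 4 by cases (simp_all only: z reward_noise_def transition_noise_def visit_noise_def prod.case)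
qed

lemma AE_noise_le:
  assumes "\<phi> \<in> noises" shows "AE w in M. \<bar>\<phi> (obs_at X t w)\<bar> \<le> noise_bound"
  using AE_regular_obs[of t] by eventually_elim (rule noise_le[OF _ assms])

lemma measurable_noise:
  assumes "\<phi> \<in> noises" shows "(\<lambda>w. \<phi> (obs_at X t w)) \<in> borel_measurable M"
  using assms unfolding noises_def obs_at_def by (auto intro!: noise_measurable_gen measurable_X)

text \<open>\<open>sigma_hist_SA\<close> at time \<open>t\<close> contains the current pair and all
  earlier steps. The visit indicator and the earlier noise are thus pulled out, and the centred
  reward has conditional mean zero.\<close>

lemma reward_noise_orthogonal:
  assumes x: "x \<in> set_pmf p_lim"
  shows "u < t \<Longrightarrow> expectation (\<lambda>w. reward_noise x (obs_at X u w) * reward_noise x (obs_at X t w)) = 0"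
    and "expectation (\<lambda>w. reward_noise x (obs_at X t w)) = 0"
proof -
  have eq: "reward_noise x (obs_at X t w)
    = of_bool ((Ac (X t w), St (X t w)) = x) * (Rw (X t w) - r (Ac (X t w)) (St (X t w)))" for t w
    by (simp add: obs_at_def reward_noise_def)
  have mem: "reward_noise x \<in> noises" using x by (simp add: noises_def)
  have ind: "(\<lambda>w. of_bool ((Ac (X t w), St (X t w)) = x) :: real) \<in> borel_measurable (sigma_hist_SA M X t)"
  proof -
    note [measurable] = SA_measurable_hist_SA[of t]
    have "(\<lambda>w. of_bool (Ac (X t w) = fst x) * of_bool (St (X t w) = snd x) :: real) \<in> borel_measurable (sigma_hist_SA M X t)"
      by measurable
    moreover have "of_bool ((Ac (X t w), St (X t w)) = x) = of_bool (Ac (X t w) = fst x) * (of_bool (St (X t w) = snd x) :: real)" for w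
      by (auto simp: of_bool_def prod_eq_iff)
    ultimately show ?thesis by simp
  qed
  show "expectation (\<lambda>w. reward_noise x (obs_at X u w) * reward_noise x (obs_at X t w)) = 0" if u: "u < t"
  proof -
    have past: "(\<lambda>w. reward_noise x (obs_at X u w)) \<in> borel_measurable (sigma_hist_SA M X t)"
    proof -
      \<comment> \<open>For \<open>Suc u = t\<close> the full step \<open>X t\<close>, with its
        reward, lies outside this history. Reward noise ignores the next state, so
        \<open>X u\<close> can stand in for it.\<close>
      have "(\<lambda>w. reward_noise x (St (X u w), Ac (X u w), Rw (X u w), St (X u w))) \<in> borel_measurable (sigma_hist_SA M X t)"
        by (intro noise_measurable_gen X_measurable_hist_SA u)
      then show ?thesis by (simp add: reward_noise_def obs_at_def)
    qed
    have "expectation (\<lambda>w. (reward_noise x (obs_at X u w) * of_bool ((Ac (X t w), St (X t w)) = x))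
        * (Rw (X t w) - r (Ac (X t w)) (St (X t w)))) = 0"
    proof (rule reward_orthogonal)
      show "(\<lambda>w. reward_noise x (obs_at X u w) * of_bool ((Ac (X t w), St (X t w)) = x)) \<in> borel_measurable (sigma_hist_SA M X t)"
        by (intro borel_measurable_times past ind)
      show "AE w in M. \<bar>reward_noise x (obs_at X u w) * of_bool ((Ac (X t w), St (X t w)) = x)\<bar> \<le> noise_bound"
        using AE_noise_le[OF mem, of u] by eventually_elim (auto simp: of_bool_def)
    qed
    then show ?thesis
      unfolding eq[of t] by (simp only: mult.assoc)
  qed
  have "expectation (\<lambda>w. of_bool ((Ac (X t w), St (X t w)) = x) * (Rw (X t w) - r (Ac (X t w)) (St (X t w)))) = 0"
    by (rule reward_orthogonal[OF ind, of 1]) auto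
  then show "expectation (\<lambda>w. reward_noise x (obs_at X t w)) = 0"
    unfolding eq .
qed

text \<open>Conditioning is on all steps up to \<open>t\<close>. The noise at \<open>u\<close>
  involves the state at \<open>Suc u\<close>, and \<open>u < t\<close> just keeps it among those
  steps.\<close>

lemma transition_noise_orthogonal:
  assumes x: "x \<in> set_pmf p_lim" and y: "y \<in> succ_states"
  shows "u < t \<Longrightarrow> expectation (\<lambda>w. transition_noise x y (obs_at X u w) * transition_noise x y (obs_at X t w)) = 0"
    and "expectation (\<lambda>w. transition_noise x y (obs_at X t w)) = 0"
proof -
  have eq: "transition_noise x y (obs_at X t w) = of_bool ((Ac (X t w), St (X t w)) = x)
    * (of_bool (St (X (Suc t) w) = y) - pmf (p (Ac (X t w)) (St (X t w))) y)" for t w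
    by (simp add: obs_at_def transition_noise_def)
  have mem: "transition_noise x y \<in> noises" using x y by (auto simp: noises_def)
  have ind: "(\<lambda>w. of_bool ((Ac (X t w), St (X t w)) = x) :: real) \<in> borel_measurable (sigma_steps M X {..t})"
    by (rule measurable_state_action[where f = "\<lambda>a s. of_bool ((a, s) = x)"]) (simp add: X_measurable_steps)
  show "expectation (\<lambda>w. transition_noise x y (obs_at X u w) * transition_noise x y (obs_at X t w)) = 0" if u: "u < t"
  proof -
    have past: "(\<lambda>w. transition_noise x y (obs_at X u w)) \<in> borel_measurable (sigma_steps M X {..t})"
      unfolding obs_at_def using u by (intro noise_measurable_gen X_measurable_steps) auto
    have "expectation (\<lambda>w. (transition_noise x y (obs_at X u w) * of_bool ((Ac (X t w), St (X t w)) = x))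
        * (of_bool (St (X (Suc t) w) = y) - pmf (p (Ac (X t w)) (St (X t w))) y)) = 0"
    proof (rule transition_orthogonal)
      show "(\<lambda>w. transition_noise x y (obs_at X u w) * of_bool ((Ac (X t w), St (X t w)) = x)) \<in> borel_measurable (sigma_steps M X {..t})"
        by (intro borel_measurable_times past ind)
      show "AE w in M. \<bar>transition_noise x y (obs_at X u w) * of_bool ((Ac (X t w), St (X t w)) = x)\<bar> \<le> noise_bound"
        using AE_noise_le[OF mem, of u] by eventually_elim (auto simp: of_bool_def)
    qed
    then show ?thesis
      unfolding eq[of t] by (simp only: mult.assoc)
  qed
  have "expectation (\<lambda>w. of_bool ((Ac (X t w), St (X t w)) = x)
    * (of_bool (St (X (Suc t) w) = y) - pmf (p (Ac (X t w)) (St (X t w))) y)) = 0"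
    by (rule transition_orthogonal[OF ind, where B = 1]) auto
  then show "expectation (\<lambda>w. transition_noise x y (obs_at X t w)) = 0"
    unfolding eq .
qed

lemma beta_mixing_ge: "beta_coeff M (sigma_steps M X {..t}) (sigma_steps M X {t + q..}) \<le> beta_mixing M X q"
  unfolding beta_mixing_def
  by (rule cSUP_upper) (auto intro!: bdd_aboveI2[where M = 1] beta_coeff_le_1 subalgebra_steps)

lemma summable_beta_mixing: "summable (beta_mixing M X)"
proof -
  obtain \<rho> where \<rho>: "0 < \<rho>" "\<rho> < 1" "beta_mixing M X \<in> O(\<lambda>q. \<rho> ^ q)"
    using mixing by (auto simp: exponentially_beta_mixing_def)
  then show ?thesis
    by (intro summable_comparison_test_bigo[OF _ \<rho>(3)]) (simp add: summable_geometric)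
qed

text \<open>By \<open>prob_visit\<close> the visit noise is a centred indicator, so its products
  have as mean the covariance of one event from the steps up to \<open>u\<close> and one from the
  steps from \<open>t\<close> on.\<close>

lemma visit_noise_cov:
  assumes "u \<le> t"
  shows "\<bar>expectation (\<lambda>w. visit_noise x (obs_at X u w) * visit_noise x (obs_at X t w))\<bar> \<le> beta_mixing M X (t - u)"
    and "expectation (\<lambda>w. visit_noise x (obs_at X t w)) = 0"
proof -
  define A where "A t = {w \<in> space M. Ac (X t w) = fst x \<and> St (X t w) = snd x}" for t
  have A_in: "A t \<in> sets (sigma_steps M X J)" if "t \<in> J" for t J
  proof -
    note [measurable] = X_measurable_steps[OF that]
    have "space (sigma_steps M X J) = space M" by (simp add: sigma_steps_def)
    moreover have "{w \<in> space (sigma_steps M X J). Ac (X t w) = fst x \<and> St (X t w) = snd x} \<in> sets (sigma_steps M X J)"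
      by measurable
    ultimately show ?thesis by (simp add: A_def)
  qed
  have A_ev [measurable, simp]: "A t \<in> events" for t unfolding A_def by measurable
  have int [simp]: "integrable M (indicator B :: 'w \<Rightarrow> real)" if "B \<in> events" for B
    using that by (intro integrable_const_bound[of _ 1]) auto
  have PA: "prob (A t) = pmf p_lim x" for t unfolding A_def prob_visit by simp
  have vis: "visit_noise x (obs_at X t w) = indicator (A t) w - pmf p_lim x" if "w \<in> space M" for t w
    using that by (auto simp: visit_noise_def obs_at_def A_def indicator_def prod_eq_iff)
  have "expectation (\<lambda>w. visit_noise x (obs_at X t w)) = expectation (\<lambda>w. indicator (A t) w - pmf p_lim x)"
    by (rule Bochner_Integration.integral_cong) (auto simp: vis)
  then show "expectation (\<lambda>w. visit_noise x (obs_at X t w)) = 0"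
    by (simp add: PA prob_space)
  have "expectation (\<lambda>w. visit_noise x (obs_at X u w) * visit_noise x (obs_at X t w))
    = expectation (\<lambda>w. indicator (A u \<inter> A t) w - pmf p_lim x * indicator (A u) w - pmf p_lim x * indicator (A t) w
        + pmf p_lim x * pmf p_lim x)"
    by (rule Bochner_Integration.integral_cong) (auto simp: vis indicator_def algebra_simps)
  also have "\<dots> = prob (A u \<inter> A t) - prob (A u) * prob (A t)"
    by (simp add: PA prob_space)
  finally have eq: "expectation (\<lambda>w. visit_noise x (obs_at X u w) * visit_noise x (obs_at X t w))
    = prob (A u \<inter> A t) - prob (A u) * prob (A t)" .
  have "\<bar>prob (A u \<inter> A t) - prob (A u) * prob (A t)\<bar>
    \<le> beta_coeff M (sigma_steps M X {..u}) (sigma_steps M X {u + (t - u)..})"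
    using assms by (intro abs_cov_le_beta_coeff subalgebra_steps A_in) auto
  then show "\<bar>expectation (\<lambda>w. visit_noise x (obs_at X u w) * visit_noise x (obs_at X t w))\<bar> \<le> beta_mixing M X (t - u)"
    unfolding eq using beta_mixing_ge[of u "t - u"] by linarith
qed

lemma noises_cases:
  assumes "\<phi> \<in> noises"
  obtains (reward) x where "x \<in> set_pmf p_lim" "\<phi> = reward_noise x"
    | (transition) x y where "x \<in> set_pmf p_lim" "y \<in> succ_states" "\<phi> = transition_noise x y"
    | (visit) x where "\<phi> = visit_noise x"
  using assms by (auto simp: noises_def)

lemma noise_mean: "\<phi> \<in> noises \<Longrightarrow> expectation (\<lambda>w. \<phi> (obs_at X t w)) = 0"
  by (erule noises_cases)
    (simp_all only: reward_noise_orthogonal(2) transition_noise_orthogonal(2) visit_noise_cov(2)[OF order.refl])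

lemma noise_second_moment:
  assumes \<phi>: "\<phi> \<in> noises"
  shows "\<exists>c\<ge>0. \<forall>T. expectation (\<lambda>w. (\<Sum>t<T. \<phi> (obs_at X t w))\<^sup>2) \<le> c * real T"
proof -
  \<comment> \<open>Lag 0 is covered by the square of the noise bound and positive lags by the
    mixing coefficient, which also dominates the zero covariances of the two martingale
    noises.\<close>
  define \<kappa> where "\<kappa> q = (if q = 0 then noise_bound * noise_bound else 0) + beta_mixing M X q" for q :: nat
  have beta_nonneg: "0 \<le> beta_mixing M X q" for q
    using beta_coeff_nonneg[OF subalgebra_steps subalgebra_steps] beta_mixing_ge order_trans by blast
  have kappa: "summable \<kappa>"
    unfolding \<kappa>_def by (intro summable_add summable_beta_mixing) (rule summable_finite[of "{0}"], auto)
  have nonneg: "0 \<le> \<kappa> q" for q using beta_nonneg[of q] by (simp add: \<kappa>_def)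
  have diag: "\<bar>expectation (\<lambda>w. \<phi> (obs_at X t w) * \<phi> (obs_at X t w))\<bar> \<le> noise_bound * noise_bound" for t
  proof -
    have [measurable]: "(\<lambda>w. \<phi> (obs_at X t w)) \<in> borel_measurable M" by (rule measurable_noise[OF \<phi>])
    have ae: "AE w in M. \<bar>\<phi> (obs_at X t w) * \<phi> (obs_at X t w)\<bar> \<le> noise_bound * noise_bound"
      using AE_noise_le[OF \<phi>, of t] by eventually_elim (unfold abs_mult, rule mult_mono, auto)
    have int: "integrable M (\<lambda>w. \<phi> (obs_at X t w) * \<phi> (obs_at X t w))"
      by (rule integrable_const_bound[of _ "noise_bound * noise_bound"]) (use ae in auto)
    have "expectation (\<lambda>w. \<phi> (obs_at X t w) * \<phi> (obs_at X t w)) \<le> expectation (\<lambda>_. noise_bound * noise_bound)"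
      by (rule integral_mono_AE[OF int]) (use ae in auto)
    then show ?thesis by (simp add: prob_space)
  qed
  have cov: "\<bar>expectation (\<lambda>w. \<phi> (obs_at X u w) * \<phi> (obs_at X t w))\<bar> \<le> \<kappa> (t - u)" if "u \<le> t" for u t
  proof (cases "u = t")
    case True
    then show ?thesis using diag[of t] beta_nonneg[of 0] by (simp add: \<kappa>_def)
  next
    case False
    then have less: "u < t" using that by simp
    from \<phi> show ?thesis
    proof (cases rule: noises_cases)
      case (reward x)
      then show ?thesis using reward_noise_orthogonal(1)[OF _ less] nonneg by simp
    next
      case (transition x y)
      then show ?thesis using transition_noise_orthogonal(1)[OF _ _ less] nonneg by simp
    next
      case (visit x)
      then show ?thesis using visit_noise_cov(1)[OF that, of x] less by (simp add: \<kappa>_def)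
    qed
  qed
  show ?thesis
  proof (intro exI conjI allI)
    show "0 \<le> 2 * suminf \<kappa>" using suminf_nonneg[OF kappa nonneg] by simp
    show "expectation (\<lambda>w. (\<Sum>t<T. \<phi> (obs_at X t w))\<^sup>2) \<le> 2 * suminf \<kappa> * real T" for T
      by (rule second_moment_sum_le[where B = noise_bound, OF measurable_noise[OF \<phi>] AE_noise_le[OF \<phi>] cov kappa])
  qed
qed

end

section \<open>Convergence in mean square\<close>

lemma ennreal_tendsto_0_le:
  fixes f g :: "nat \<Rightarrow> ennreal"
  assumes le: "\<And>j. f j \<le> ennreal c * g j" and g: "g \<longlonglongrightarrow> 0"
  shows "f \<longlonglongrightarrow> 0"
proof -
  have "(\<lambda>j. ennreal c * g j) \<longlonglongrightarrow> ennreal c * 0"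
    by (rule ennreal_tendsto_cmult[OF _ g]) simp
  then have lim: "(\<lambda>j. ennreal c * g j) \<longlonglongrightarrow> 0" by simp
  show ?thesis
    by (rule tendsto_sandwich[OF _ _ tendsto_const lim]) (simp_all add: le)
qed

text \<open>The extended integral allows finite sums to be handled without integrability
  conditions.\<close>

definition L2_null :: "'w measure \<Rightarrow> (nat \<Rightarrow> 'w \<Rightarrow> real) \<Rightarrow> bool" where
  "L2_null M Y \<longleftrightarrow> (\<forall>j. Y j \<in> borel_measurable M)
     \<and> (\<lambda>j. \<integral>\<^sup>+ w. ennreal ((Y j w)\<^sup>2) \<partial>M) \<longlonglongrightarrow> 0"

lemma L2_nullI:
  assumes "\<And>j. Y j \<in> borel_measurable M" and "\<And>j. (\<integral>\<^sup>+ w. ennreal ((Y j w)\<^sup>2) \<partial>M) \<le> u j" and "u \<longlonglongrightarrow> 0"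
  shows "L2_null M Y"
  unfolding L2_null_def
proof (intro conjI allI assms(1))
  show "(\<lambda>j. \<integral>\<^sup>+ w. ennreal ((Y j w)\<^sup>2) \<partial>M) \<longlonglongrightarrow> 0"
    by (rule tendsto_sandwich[OF _ _ tendsto_const assms(3)]) (simp_all add: assms(2))
qed

lemma L2_null_abs: "L2_null M Y \<Longrightarrow> L2_null M (\<lambda>j w. \<bar>Y j w\<bar>)"
  by (auto simp: L2_null_def intro: borel_measurable_abs)

lemma L2_null_add:
  assumes Y: "L2_null M Y" and Z: "L2_null M Z"
  shows "L2_null M (\<lambda>j w. Y j w + Z j w)"
proof (rule L2_nullI)
  have [measurable]: "Y j \<in> borel_measurable M" "Z j \<in> borel_measurable M" for j
    using Y Z by (auto simp: L2_null_def)
  show "(\<lambda>w. Y j w + Z j w) \<in> borel_measurable M" for j by measurable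
  show "(\<integral>\<^sup>+ w. ennreal ((Y j w + Z j w)\<^sup>2) \<partial>M)
    \<le> 2 * (\<integral>\<^sup>+ w. ennreal ((Y j w)\<^sup>2) \<partial>M) + 2 * (\<integral>\<^sup>+ w. ennreal ((Z j w)\<^sup>2) \<partial>M)" for j
  proof -
    have "(y + z)\<^sup>2 \<le> 2 * y\<^sup>2 + 2 * z\<^sup>2" for y z :: real
      using sum_squares_ge_zero[of "y - z" 0] by (simp add: power2_eq_square algebra_simps)
    then have "ennreal ((Y j w + Z j w)\<^sup>2) \<le> 2 * ennreal ((Y j w)\<^sup>2) + 2 * ennreal ((Z j w)\<^sup>2)" for w
      by (simp add: ennreal_leI flip: ennreal_plus ennreal_numeral ennreal_mult)
    then have "(\<integral>\<^sup>+ w. ennreal ((Y j w + Z j w)\<^sup>2) \<partial>M)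
      \<le> (\<integral>\<^sup>+ w. 2 * ennreal ((Y j w)\<^sup>2) + 2 * ennreal ((Z j w)\<^sup>2) \<partial>M)"
      by (intro nn_integral_mono) auto
    then show ?thesis by (simp add: nn_integral_add nn_integral_cmult)
  qed
  have "(\<lambda>j. 2 * (\<integral>\<^sup>+ w. ennreal ((Y j w)\<^sup>2) \<partial>M) + 2 * (\<integral>\<^sup>+ w. ennreal ((Z j w)\<^sup>2) \<partial>M)) \<longlonglongrightarrow> 2 * 0 + 2 * 0"
    using Y Z unfolding L2_null_def by (intro tendsto_add ennreal_tendsto_cmult) auto
  then show "(\<lambda>j. 2 * (\<integral>\<^sup>+ w. ennreal ((Y j w)\<^sup>2) \<partial>M) + 2 * (\<integral>\<^sup>+ w. ennreal ((Z j w)\<^sup>2) \<partial>M)) \<longlonglongrightarrow> 0"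
    by simp
qed

lemma L2_null_sum:
  assumes "finite A" and "\<And>a. a \<in> A \<Longrightarrow> L2_null M (Y a)"
  shows "L2_null M (\<lambda>j w. \<Sum>a\<in>A. Y a j w)"
  using assms
proof (induction A rule: finite_induct)
  case empty
  then show ?case by (simp add: L2_null_def)
next
  case (insert a A)
  then show ?case using L2_null_add[of M "Y a" "\<lambda>j w. \<Sum>a\<in>A. Y a j w"] by simp
qed

lemma (in prob_space) L2_null_const:
  assumes "c \<longlonglongrightarrow> 0"
  shows "L2_null M (\<lambda>j w. c j)"
proof -
  have "(\<lambda>j. ennreal ((c j)\<^sup>2)) \<longlonglongrightarrow> ennreal (0\<^sup>2)"
    by (intro tendsto_ennrealI tendsto_power assms)
  then show ?thesis by (simp add: L2_null_def emeasure_space_1)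
qed

text \<open>Chebyshev's inequality, with the threshold written as
  \<open>1 \<le> L / \<epsilon> * Y j w\<close> so that nothing is divided by \<open>L\<close>,
  which may be 0.\<close>

lemma (in prob_space) converges_in_probabilityI:
  assumes meas [measurable]: "\<And>j. Z j \<in> borel_measurable M" and Y: "L2_null M Y" and L: "0 \<le> L"
    and le: "\<And>j. AE w in M. \<bar>Z j w - c\<bar> \<le> L * Y j w"
  shows "converges_in_probability M Z c"
  unfolding converges_in_probability_def
proof (intro conjI allI impI meas)
  fix \<epsilon> :: real assume \<epsilon>: "0 < \<epsilon>"
  have [measurable]: "Y j \<in> borel_measurable M" for j using Y by (simp add: L2_null_def)
  define K where "K = (L / \<epsilon>)\<^sup>2"
  have "emeasure M {w \<in> space M. \<bar>Z j w - c\<bar> > \<epsilon>} \<le> ennreal K * (\<integral>\<^sup>+ w. ennreal ((Y j w)\<^sup>2) \<partial>M)" for j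
  proof -
    have "emeasure M {w \<in> space M. \<bar>Z j w - c\<bar> > \<epsilon>} \<le> emeasure M {w \<in> space M. 1 \<le> ennreal K * ennreal ((Y j w)\<^sup>2)}"
    proof (rule emeasure_mono_AE)
      show "AE w in M. w \<in> {w \<in> space M. \<bar>Z j w - c\<bar> > \<epsilon>} \<longrightarrow> w \<in> {w \<in> space M. 1 \<le> ennreal K * ennreal ((Y j w)\<^sup>2)}"
        using le[of j]
      proof eventually_elim
        case (elim w)
        show ?case
        proof safe
          assume "\<epsilon> < \<bar>Z j w - c\<bar>"
          then have "1 \<le> L / \<epsilon> * Y j w" using elim \<epsilon> by (simp add: field_simps)
          then have "1\<^sup>2 \<le> (L / \<epsilon> * Y j w)\<^sup>2" by (intro power_mono) auto
          then have "ennreal 1 \<le> ennreal (K * (Y j w)\<^sup>2)"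
            unfolding K_def by (intro ennreal_leI) (simp only: power_mult_distrib one_power2)
          then show "1 \<le> ennreal K * ennreal ((Y j w)\<^sup>2)" by (simp add: ennreal_mult K_def)
        qed
      qed
    qed measurable
    also have "\<dots> \<le> ennreal K * (\<integral>\<^sup>+ w. ennreal ((Y j w)\<^sup>2) * indicator (space M) w \<partial>M)"
      by (rule nn_integral_Markov_inequality) auto
    also have "\<dots> = ennreal K * (\<integral>\<^sup>+ w. ennreal ((Y j w)\<^sup>2) \<partial>M)"
      by (intro arg_cong2[where f = "(*)"] refl nn_integral_cong) auto
    finally show ?thesis .
  qed
  then have "(\<lambda>j. emeasure M {w \<in> space M. \<bar>Z j w - c\<bar> > \<epsilon>}) \<longlonglongrightarrow> 0"
    using Y unfolding L2_null_def by (elim conjE) (rule ennreal_tendsto_0_le)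
  then have "(\<lambda>j. enn2real (emeasure M {w \<in> space M. \<bar>Z j w - c\<bar> > \<epsilon>})) \<longlonglongrightarrow> enn2real 0"
    by (intro tendsto_enn2real) auto
  then show "(\<lambda>j. prob {w \<in> space M. \<bar>Z j w - c\<bar> > \<epsilon>}) \<longlonglongrightarrow> 0"
    by (simp add: measure_def)
qed

section \<open>From convergence under \<open>p_lim\<close> to convergence at its atoms\<close>

lemma nn_integral_pmf_ge: "ennreal (pmf p x) * f x \<le> (\<integral>\<^sup>+ y. f y \<partial>measure_pmf p)"
proof -
  have "ennreal (pmf p x) * f x = (\<integral>\<^sup>+ y. f x * indicator {x} y \<partial>measure_pmf p)"
    by (subst nn_integral_cmult_indicator) (auto simp: emeasure_pmf_single mult.commute)
  also have "\<dots> \<le> (\<integral>\<^sup>+ y. f y \<partial>measure_pmf p)"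
    by (rule nn_integral_mono) (auto simp: indicator_def)
  finally show ?thesis .
qed

text \<open>An atom contributes its mass times the value there to the integral, so the integral
  divided by that mass bounds the value.\<close>

lemma tendsto_0_of_nn_integral_pmf:
  assumes lim: "(\<lambda>j. \<integral>\<^sup>+ y. f j y \<partial>measure_pmf p) \<longlonglongrightarrow> 0" and x: "x \<in> set_pmf p"
  shows "(\<lambda>j. f j x) \<longlonglongrightarrow> 0"
proof -
  have pos: "0 < pmf p x" using x by (rule pmf_positive)
  have "f j x \<le> ennreal (1 / pmf p x) * (\<integral>\<^sup>+ y. f j y \<partial>measure_pmf p)" for j
  proof -
    have "f j x = ennreal (1 / pmf p x) * (ennreal (pmf p x) * f j x)"
      using pos by (simp add: mult.assoc[symmetric] flip: ennreal_mult)
    also have "\<dots> \<le> ennreal (1 / pmf p x) * (\<integral>\<^sup>+ y. f j y \<partial>measure_pmf p)"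
      by (intro mult_left_mono nn_integral_pmf_ge) auto
    finally show ?thesis .
  qed
  then show ?thesis by (rule ennreal_tendsto_0_le[OF _ lim])
qed

lemma L2_convergesD:
  assumes "L2_converges M p_lim f g" and "(a, s) \<in> set_pmf p_lim" and "\<And>j. (\<lambda>w. f j w a s) \<in> borel_measurable M"
  shows "L2_null M (\<lambda>j w. f j w a s - g a s)"
  using tendsto_0_of_nn_integral_pmf[OF assms(1)[unfolded L2_converges_def] assms(2)] assms(3)
  by (simp add: L2_null_def)

lemma L2_converges_pairD:
  assumes "L2_converges_pair M p_lim f g" and as: "(a, s) \<in> set_pmf p_lim" and as': "(a', s') \<in> set_pmf p_lim"
    and "\<And>j. (\<lambda>w. f j w a s a' s') \<in> borel_measurable M"
  shows "L2_null M (\<lambda>j w. f j w a s a' s' - g a s a' s')"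
proof -
  have "(\<lambda>j. \<integral>\<^sup>+ y. (case y of (a', s') \<Rightarrow>
          \<integral>\<^sup>+ \<omega>. ennreal (\<bar>f j \<omega> a s a' s' - g a s a' s'\<bar>\<^sup>2) \<partial>M) \<partial>measure_pmf p_lim) \<longlonglongrightarrow> 0"
    using tendsto_0_of_nn_integral_pmf[OF assms(1)[unfolded L2_converges_pair_def] as] by simp
  from tendsto_0_of_nn_integral_pmf[OF this as'] show ?thesis
    using assms(4) by (simp add: L2_null_def)
qed

section \<open>Independent trajectories and random folds\<close>

text \<open>\<open>random_division\<close> states independence of generated sigma-algebras, whereas
  the product rule for expectations is applied to real random variables.\<close>

lemma (in prob_space) indep_var_compose_vimage:
  fixes g :: "'b \<Rightarrow> real" and h :: "'c \<Rightarrow> real"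
  assumes indep: "indep_set (sets (vimage_algebra (space M) F N)) (sets (vimage_algebra (space M) Y L))"
    and F: "F \<in> measurable M N" and Y: "Y \<in> measurable M L"
    and g: "g \<in> borel_measurable N" and h: "h \<in> borel_measurable L"
  shows "indep_var borel (\<lambda>w. g (F w)) borel (\<lambda>w. h (Y w))"
proof -
  have "(\<lambda>w. g (F w)) \<in> borel_measurable (vimage_algebra (space M) F N)"
    using measurable_space[OF F] by (intro measurable_compose[OF measurable_vimage_algebra1 g]) auto
  then have sub_F: "sigma_sets (space M) {(\<lambda>w. g (F w)) -` A \<inter> space M |A. A \<in> sets borel} \<subseteq> sets (vimage_algebra (space M) F N)"
    by (intro sets.sigma_sets_subset[of _ "vimage_algebra (space M) F N", unfolded space_vimage_algebra])
      (auto dest: measurable_sets)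
  have "(\<lambda>w. h (Y w)) \<in> borel_measurable (vimage_algebra (space M) Y L)"
    using measurable_space[OF Y] by (intro measurable_compose[OF measurable_vimage_algebra1 h]) auto
  then have sub_Y: "sigma_sets (space M) {(\<lambda>w. h (Y w)) -` A \<inter> space M |A. A \<in> sets borel} \<subseteq> sets (vimage_algebra (space M) Y L)"
    by (intro sets.sigma_sets_subset[of _ "vimage_algebra (space M) Y L", unfolded space_vimage_algebra])
      (auto dest: measurable_sets)
  show ?thesis
    unfolding indep_var_eq
    using indep sub_F sub_Y measurable_compose[OF F g] measurable_compose[OF Y h]
    unfolding indep_sets2_eq by blast
qed

lemma finite_fold_assignments: "finite (fold_assignments n K)"
  unfolding fold_assignments_def by (rule finite_subset[OF Collect_subset]) (simp add: finite_PiE)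

locale iid_mdp_data = finite_support_evaluation p r \<gamma> \<pi> \<G> p_lim Cr + prob_space M
  for p :: "'a::countable \<Rightarrow> 's::countable \<Rightarrow> 's pmf" and r \<gamma> \<pi> \<G> p_lim Cr and M :: "'w measure" +
  fixes b :: "nat \<Rightarrow> (nat \<Rightarrow> ('s, 'a) step) \<Rightarrow> 's \<Rightarrow> 'a pmf"
    and X :: "nat \<Rightarrow> nat \<Rightarrow> 'w \<Rightarrow> ('s, 'a) step"
  assumes iid: "iid_trajectories M X"
    and trajectory: "\<And>i. mdp_data p r \<gamma> \<pi> \<G> p_lim Cr M b (X i)"
begin

text \<open>A function of the path, so that independence and equality of the path laws carry over by
  composition.\<close>

definition noise_sum :: "(('s, 'a) obs \<Rightarrow> real) \<Rightarrow> nat \<Rightarrow> (nat \<Rightarrow> ('s, 'a) step) \<Rightarrow> real" where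
  "noise_sum \<phi> T x = (\<Sum>t<T. \<phi> (St (x t), Ac (x t), Rw (x t), St (x (Suc t))))"

abbreviation "trajectory_space \<equiv> (\<Pi>\<^sub>M t\<in>(UNIV :: nat set). (step_space :: ('s, 'a) step measure))"

lemma noise_sum_obs: "noise_sum \<phi> T (\<lambda>t. X i t w) = (\<Sum>t<T. \<phi> (obs_at (X i) t w))"
  by (simp add: noise_sum_def obs_at_def)

lemma measurable_X: "X i t \<in> measurable M step_space"
  by (rule mdp_data.measurable_X[OF trajectory])

lemma measurable_trajectory: "(\<lambda>w t. X i t w) \<in> measurable M trajectory_space"
  by (rule measurable_PiM_single') (auto intro: measurable_X dest: measurable_space[OF measurable_X])

lemma measurable_noise_sum:
  assumes "\<phi> \<in> noises"
  shows "noise_sum \<phi> T \<in> borel_measurable trajectory_space"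
proof -
  have "(\<lambda>x. \<phi> (St (x t), Ac (x t), Rw (x t), St (x (Suc t)))) \<in> borel_measurable trajectory_space" for t
    using assms
    by (rule mdp_data.noises_cases[OF trajectory])
      (auto intro!: mdp_data.noise_measurable_gen[OF trajectory] measurable_component_singleton)
  then show ?thesis unfolding noise_sum_def[abs_def] by (intro borel_measurable_sum)
qed

lemma measurable_noise_sum_X:
  assumes "\<phi> \<in> noises"
  shows "(\<lambda>w. noise_sum \<phi> T (\<lambda>t. X i t w)) \<in> borel_measurable M"
  by (rule measurable_compose[OF measurable_trajectory measurable_noise_sum[OF assms]])

lemma AE_noise_sum_le:
  assumes "\<phi> \<in> noises"
  shows "AE w in M. \<bar>noise_sum \<phi> T (\<lambda>t. X i t w)\<bar> \<le> real T * mdp_data.noise_bound Cr"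
proof -
  have "AE w in M. \<forall>t. \<bar>\<phi> (obs_at (X i) t w)\<bar> \<le> mdp_data.noise_bound Cr"
    unfolding AE_all_countable using mdp_data.AE_noise_le[OF trajectory assms] by blast
  then show ?thesis
  proof eventually_elim
    case (elim w)
    have "\<bar>noise_sum \<phi> T (\<lambda>t. X i t w)\<bar> \<le> (\<Sum>t<T. mdp_data.noise_bound Cr)"
      unfolding noise_sum_obs using elim by (intro order_trans[OF sum_abs] sum_mono) auto
    then show ?case by simp
  qed
qed

lemma integrable_noise_sum_mult:
  assumes "\<phi> \<in> noises"
  shows "integrable M (\<lambda>w. noise_sum \<phi> T (\<lambda>t. X i t w) * noise_sum \<phi> T (\<lambda>t. X i' t w))"
proof (rule integrable_const_bound)
  let ?B = "real T * mdp_data.noise_bound Cr"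
  show "AE w in M. norm (noise_sum \<phi> T (\<lambda>t. X i t w) * noise_sum \<phi> T (\<lambda>t. X i' t w)) \<le> ?B * ?B"
    using AE_noise_sum_le[OF assms, of T i] AE_noise_sum_le[OF assms, of T i']
    by eventually_elim (unfold real_norm_def abs_mult, rule mult_mono, auto)
qed (intro borel_measurable_times measurable_noise_sum_X assms)

lemma integrable_noise_sum:
  assumes "\<phi> \<in> noises"
  shows "integrable M (\<lambda>w. noise_sum \<phi> T (\<lambda>t. X i t w))"
  by (rule integrable_const_bound[OF _ measurable_noise_sum_X[OF assms]])
    (use AE_noise_sum_le[OF assms, of T i] in simp)

lemma noise_sum_mean:
  assumes "\<phi> \<in> noises"
  shows "expectation (\<lambda>w. noise_sum \<phi> T (\<lambda>t. X i t w)) = 0"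
proof -
  have int: "integrable M (\<lambda>w. \<phi> (obs_at (X i) t w))" for t
    by (rule integrable_const_bound[of _ "mdp_data.noise_bound Cr"])
      (use mdp_data.AE_noise_le[OF trajectory assms] mdp_data.measurable_noise[OF trajectory assms] in auto)
  show ?thesis
    unfolding noise_sum_obs using mdp_data.noise_mean[OF trajectory assms]
    by (subst Bochner_Integration.integral_sum[OF int]) simp
qed

text \<open>The mixing rate comes with each trajectory separately; taking \<open>c\<close> from
  trajectory 0 and using equality of the laws makes it uniform in \<open>i\<close>.\<close>

lemma noise_sum_second_moment:
  assumes \<phi>: "\<phi> \<in> noises"
  obtains c where "0 \<le> c"
    "\<And>T i. expectation (\<lambda>w. (noise_sum \<phi> T (\<lambda>t. X i t w))\<^sup>2) \<le> c * real T"
proof -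
  obtain c where c: "0 \<le> c" "\<And>T. expectation (\<lambda>w. (\<Sum>t<T. \<phi> (obs_at (X 0) t w))\<^sup>2) \<le> c * real T"
    using mdp_data.noise_second_moment[OF trajectory \<phi>] by blast
  have eq: "expectation (\<lambda>w. (noise_sum \<phi> T (\<lambda>t. X i t w))\<^sup>2)
    = (\<integral>x. (noise_sum \<phi> T x)\<^sup>2 \<partial>distr M trajectory_space (\<lambda>w t. X i t w))" for T i
    using measurable_noise_sum[OF \<phi>] measurable_trajectory by (subst integral_distr) auto
  have same: "distr M trajectory_space (\<lambda>w t. X i t w) = distr M trajectory_space (\<lambda>w t. X 0 t w)" for i
    using iid unfolding iid_trajectories_def by blast
  have "expectation (\<lambda>w. (noise_sum \<phi> T (\<lambda>t. X i t w))\<^sup>2) \<le> c * real T" for T i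
    using c(2)[of T] unfolding noise_sum_obs[symmetric] eq same[of i] .
  then show ?thesis using that c(1) by blast
qed

lemma noise_sum_uncorrelated:
  assumes \<phi>: "\<phi> \<in> noises" and ne: "i \<noteq> i'"
  shows "expectation (\<lambda>w. noise_sum \<phi> T (\<lambda>t. X i t w) * noise_sum \<phi> T (\<lambda>t. X i' t w)) = 0"
proof -
  have "indep_vars (\<lambda>_. trajectory_space) (\<lambda>i w t. X i t w) UNIV"
    using iid by (simp add: iid_trajectories_def)
  then have "indep_vars (\<lambda>_. borel) (\<lambda>i w. noise_sum \<phi> T (\<lambda>t. X i t w)) UNIV"
    by (rule indep_vars_compose2) (rule measurable_noise_sum[OF \<phi>])
  then have "indep_vars (\<lambda>_. borel) (\<lambda>i w. noise_sum \<phi> T (\<lambda>t. X i t w)) {i, i'}"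
    by (rule indep_vars_subset) simp
  from indep_vars_lebesgue_integral[OF _ this] show ?thesis
    using ne integrable_noise_sum[OF \<phi>] by (simp add: noise_sum_mean[OF \<phi>])
qed

lemma noise_sum_trajectories_moment:
  assumes \<phi>: "\<phi> \<in> noises" and fin: "finite I"
    and c: "\<And>T i. expectation (\<lambda>w. (noise_sum \<phi> T (\<lambda>t. X i t w))\<^sup>2) \<le> c * real T"
  shows "expectation (\<lambda>w. (\<Sum>i\<in>I. noise_sum \<phi> T (\<lambda>t. X i t w))\<^sup>2) \<le> c * real T * real (card I)"
proof -
  define H where "H i w = noise_sum \<phi> T (\<lambda>t. X i t w)" for i w
  have int: "integrable M (\<lambda>w. H i w * H i' w)" for i i'
    unfolding H_def by (rule integrable_noise_sum_mult[OF \<phi>])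
  have "expectation (\<lambda>w. (\<Sum>i\<in>I. H i w)\<^sup>2) = expectation (\<lambda>w. \<Sum>i\<in>I. \<Sum>i'\<in>I. H i w * H i' w)"
    by (simp add: power2_eq_square sum_product)
  also have "\<dots> = (\<Sum>i\<in>I. \<Sum>i'\<in>I. expectation (\<lambda>w. H i w * H i' w))"
    by (simp add: int)
  also have "\<dots> = (\<Sum>i\<in>I. \<Sum>i'\<in>I. if i = i' then expectation (\<lambda>w. (H i w)\<^sup>2) else 0)"
    by (intro sum.cong refl) (auto simp: H_def noise_sum_uncorrelated[OF \<phi>] power2_eq_square)
  also have "\<dots> = (\<Sum>i\<in>I. expectation (\<lambda>w. (H i w)\<^sup>2))"
    using fin by simp
  also have "\<dots> \<le> (\<Sum>i\<in>I. c * real T)"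
    unfolding H_def by (intro sum_mono c)
  finally show ?thesis unfolding H_def by (simp add: mult.commute)
qed

lemma measurable_trajectories: "(\<lambda>w i t. X i t w) \<in> measurable M (\<Pi>\<^sub>M i\<in>(UNIV :: nat set). trajectory_space)"
  by (rule measurable_PiM_single') (auto intro: measurable_trajectory dest: measurable_space[OF measurable_trajectory])

text \<open>Expand over the finitely many divisions \<open>f\<close>. As the division is independent
  of the data, each term is the probability of \<open>f\<close> times a second moment over a fixed
  fold, and the probabilities add up to 1. The bound uses \<open>n\<close>, since the size of the
  fold is random.\<close>

lemma random_fold_second_moment:
  assumes \<phi>: "\<phi> \<in> noises" and div: "random_division M X n K F"
    and c: "\<And>T i. expectation (\<lambda>w. (noise_sum \<phi> T (\<lambda>t. X i t w))\<^sup>2) \<le> c * real T" and c0: "0 \<le> c"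
  shows "(\<lambda>w. \<Sum>i\<in>fold_set n (F w) k. noise_sum \<phi> T (\<lambda>t. X i t w)) \<in> borel_measurable M"
    and "(\<integral>\<^sup>+ w. ennreal ((\<Sum>i\<in>fold_set n (F w) k. noise_sum \<phi> T (\<lambda>t. X i t w))\<^sup>2) \<partial>M) \<le> ennreal (c * real T * real n)"
proof -
  let ?FA = "fold_assignments n K"
  let ?TS = "\<Pi>\<^sub>M i\<in>(UNIV :: nat set). trajectory_space"
  define H where "H f x = (\<Sum>i\<in>fold_set n f k. noise_sum \<phi> T (x i))" for f and x :: "nat \<Rightarrow> nat \<Rightarrow> ('s, 'a) step"
  have F: "F \<in> measurable M (count_space ?FA)" using div by (simp add: random_division_def)
  have F_in: "F w \<in> ?FA" if "w \<in> space M" for w using measurable_space[OF F that] by simp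
  have H: "H f \<in> borel_measurable ?TS" for f
    unfolding H_def[abs_def]
    by (intro borel_measurable_sum measurable_compose[OF _ measurable_noise_sum[OF \<phi>]] measurable_component_singleton) simp
  have HX: "(\<lambda>w. H f (\<lambda>i t. X i t w)) \<in> borel_measurable M" for f
    by (rule measurable_compose[OF measurable_trajectories H])
  show meas: "(\<lambda>w. \<Sum>i\<in>fold_set n (F w) k. noise_sum \<phi> T (\<lambda>t. X i t w)) \<in> borel_measurable M"
    using measurable_compose_countable'[OF HX F] finite_fold_assignments
    by (simp add: H_def countable_finite)
  have H2_int: "integrable M (\<lambda>w. (H f (\<lambda>i t. X i t w))\<^sup>2)" for f
    unfolding H_def power2_eq_square sum_product
    by (intro Bochner_Integration.integrable_sum integrable_noise_sum_mult \<phi>)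
  have fold: "finite (fold_set n f k)" "card (fold_set n f k) \<le> n" for f
    using card_mono[of "{..<n}" "fold_set n f k"] by (auto simp: fold_set_def)
  have H2: "expectation (\<lambda>w. (H f (\<lambda>i t. X i t w))\<^sup>2) \<le> c * real T * real n" for f
  proof -
    have "expectation (\<lambda>w. (H f (\<lambda>i t. X i t w))\<^sup>2) \<le> c * real T * real (card (fold_set n f k))"
      unfolding H_def by (rule noise_sum_trajectories_moment[OF \<phi> fold(1) c])
    also have "\<dots> \<le> c * real T * real n"
      using fold(2) c0 by (intro mult_left_mono) auto
    finally show ?thesis .
  qed
  have ind: "(\<lambda>w. of_bool (F w = f) :: real) \<in> borel_measurable M" for f
    by (rule measurable_compose[OF F, where g = "\<lambda>f'. of_bool (f' = f)"]) simp
  have ind_int: "integrable M (\<lambda>w. of_bool (F w = f) :: real)" for f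
    by (rule integrable_const_bound[of _ 1]) (auto intro: ind)
  have *: "integrable M (\<lambda>w. of_bool (F w = f) * (H f (\<lambda>i t. X i t w))\<^sup>2)"
    "expectation (\<lambda>w. of_bool (F w = f) * (H f (\<lambda>i t. X i t w))\<^sup>2)
      = expectation (\<lambda>w. of_bool (F w = f)) * expectation (\<lambda>w. (H f (\<lambda>i t. X i t w))\<^sup>2)" for f
  proof -
    have iv: "indep_var borel (\<lambda>w. of_bool (F w = f) :: real) borel (\<lambda>w. (H f (\<lambda>i t. X i t w))\<^sup>2)"
      by (rule indep_var_compose_vimage[OF _ F measurable_trajectories, where g = "\<lambda>f'. of_bool (f' = f)" and h = "\<lambda>x. (H f x)\<^sup>2"])
        (use div H in \<open>auto simp: random_division_def\<close>)
    show "integrable M (\<lambda>w. of_bool (F w = f) * (H f (\<lambda>i t. X i t w))\<^sup>2)"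
      by (rule indep_var_integrable[OF iv ind_int H2_int])
    show "expectation (\<lambda>w. of_bool (F w = f) * (H f (\<lambda>i t. X i t w))\<^sup>2)
      = expectation (\<lambda>w. of_bool (F w = f)) * expectation (\<lambda>w. (H f (\<lambda>i t. X i t w))\<^sup>2)"
      by (rule indep_var_lebesgue_integral[OF iv ind_int H2_int])
  qed
  have split: "(H (F w) x)\<^sup>2 = (\<Sum>f\<in>?FA. of_bool (F w = f) * (H f x)\<^sup>2)" if "w \<in> space M" for w x
    using F_in[OF that] finite_fold_assignments by (simp add: of_bool_def if_distrib[of "\<lambda>c. c * _"] cong: if_cong)
  have "(\<integral>\<^sup>+ w. ennreal ((H (F w) (\<lambda>i t. X i t w))\<^sup>2) \<partial>M)
    = (\<integral>\<^sup>+ w. ennreal (\<Sum>f\<in>?FA. of_bool (F w = f) * (H f (\<lambda>i t. X i t w))\<^sup>2) \<partial>M)"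
    by (intro nn_integral_cong arg_cong[where f = ennreal] split)
  also have "\<dots> = ennreal (expectation (\<lambda>w. \<Sum>f\<in>?FA. of_bool (F w = f) * (H f (\<lambda>i t. X i t w))\<^sup>2))"
    by (intro nn_integral_eq_integral Bochner_Integration.integrable_sum *) (auto intro!: sum_nonneg)
  also have "expectation (\<lambda>w. \<Sum>f\<in>?FA. of_bool (F w = f) * (H f (\<lambda>i t. X i t w))\<^sup>2)
    = (\<Sum>f\<in>?FA. expectation (\<lambda>w. of_bool (F w = f)) * expectation (\<lambda>w. (H f (\<lambda>i t. X i t w))\<^sup>2))"
    by (subst Bochner_Integration.integral_sum[OF *(1)]) (simp only: *(2))
  also have "\<dots> \<le> (\<Sum>f\<in>?FA. expectation (\<lambda>w. of_bool (F w = f)) * (c * real T * real n))"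
    by (intro sum_mono mult_left_mono H2) (auto intro!: integral_nonneg_AE)
  also have "\<dots> = expectation (\<lambda>w. \<Sum>f\<in>?FA. of_bool (F w = f)) * (c * real T * real n)"
    by (simp add: ind_int sum_distrib_right)
  also have "expectation (\<lambda>w. \<Sum>f\<in>?FA. of_bool (F w = f)) = expectation (\<lambda>w. 1)"
    using F_in finite_fold_assignments
    by (intro Bochner_Integration.integral_cong) (auto simp: of_bool_def)
  finally show "(\<integral>\<^sup>+ w. ennreal ((\<Sum>i\<in>fold_set n (F w) k. noise_sum \<phi> T (\<lambda>t. X i t w))\<^sup>2) \<partial>M) \<le> ennreal (c * real T * real n)"
    by (simp add: H_def prob_space ennreal_leI)
qed

end

section \<open>Error bound for the value estimator\<close>

context finite_support_evaluation
begin

lemma value_factor_nonneg: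
  assumes "0 \<le> C"
  shows "0 \<le> value_factor C l"
  unfolding value_factor_def
  using assms gamma_less_1 Cr_nonneg debias_bound_nonneg[OF assms, of l] noise_factor_nonneg[OF assms, of l]
    debias_factor_ge_0[OF assms, of l]
  by (intro add_nonneg_nonneg mult_nonneg_nonneg) auto

text \<open>\<open>mean_psi_close\<close> multiplied by the size of the fold. Noise and index cost
  lose their denominators, so after division by \<open>n * T\<close> a small fold does no
  harm.\<close>

lemma sum_fold_psi_close:
  fixes D :: "nat \<Rightarrow> nat \<Rightarrow> ('s, 'a) obs"
  assumes I: "I \<subseteq> {..<n}" and regular: "\<And>i t. i < n \<Longrightarrow> t < T \<Longrightarrow> regular_obs (D i t)"
    and m: "2 \<le> m" "m - 1 \<le> card I * T"
    and bounds: "\<And>a s. \<bar>Q a s\<bar> \<le> C" "\<And>a s a\<^sub>0 s\<^sub>0. \<bar>\<tau> a s a\<^sub>0 s\<^sub>0\<bar> \<le> C" "\<And>a s. \<bar>w a s\<bar> \<le> C"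
    and e0: "0 \<le> e"
    and e: "bounded_on_support (\<lambda>a s. Q a s - Q_pi a s) e
      \<or> (\<forall>x\<in>set_pmf p_lim. \<forall>y\<in>set_pmf p_lim. \<bar>\<tau> (fst x) (snd x) (fst y) (snd y)
          - tau_ratio p \<gamma> \<pi> p_lim (fst x) (snd x) (fst y) (snd y)\<bar> \<le> e)
      \<or> bounded_on_support (\<lambda>a s. w a s - omega_ratio p \<gamma> \<pi> \<G> p_lim a s) e"
  shows "\<bar>(\<Sum>i\<in>I. \<Sum>t<T. psi \<gamma> \<pi> \<G> w (debiased_Q \<gamma> \<pi> m I T D \<tau> Q) (D i t) - policy_value p r \<gamma> \<pi> \<G>)\<bar>
    \<le> value_factor C (m - 1) * ((\<Sum>\<phi>\<in>noises. \<bar>\<Sum>i\<in>I. \<Sum>t<T. \<phi> (D i t)\<bar>) + 1 + real n * real T * e)"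
proof -
  define J where "J = I \<times> {..<T}"
  define z where "z = (\<lambda>(i, t). D i t)"
  \<comment> \<open>A sum instead of a maximum, because mean-square convergence passes to finite
    sums.\<close>
  define \<Delta> where "\<Delta> = (\<Sum>\<phi>\<in>noises. \<bar>\<Sum>i\<in>I. \<Sum>t<T. \<phi> (D i t)\<bar>)"
  have finI: "finite I" using I finite_subset by blast
  have cJ: "card J = card I * T" by (simp add: J_def card_cartesian_product)
  have sumJ: "(\<Sum>i\<in>J. h (z i)) = (\<Sum>i\<in>I. \<Sum>t<T. h (D i t))" for h :: "('s, 'a) obs \<Rightarrow> real"
    unfolding J_def z_def by (simp add: sum.cartesian_product case_prod_beta')
  have C0: "0 \<le> C" using bounds(1)[of undefined undefined] by linarith
  have J_ne: "J \<noteq> {}" using m cJ by auto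
  interpret sample: evaluation_sample p r \<gamma> \<pi> \<G> p_lim Cr J z C \<Delta> \<tau> Q w
  proof unfold_locales
    show "finite J" using finI by (simp add: J_def)
    show "\<bar>\<Sum>i\<in>J. \<phi> (z i)\<bar> \<le> \<Delta>" if "\<phi> \<in> noises" for \<phi>
      unfolding sumJ \<Delta>_def by (rule member_le_sum[OF that _ finite_noises]) simp
    show "regular_obs (z i)" if "i \<in> J" for i
      using that I regular unfolding J_def z_def by auto
    show "0 \<le> \<Delta>" unfolding \<Delta>_def by (simp add: sum_nonneg)
  qed (use bounds J_ne in auto)
  let ?N = "real (card J)"
  have N: "0 < ?N" by (rule sample.N_pos)
  have dm: "sample.distinct_mean (m - 1) = debiased_Q \<gamma> \<pi> m I T D \<tau> Q"
  proof -
    have "(\<lambda>(i, t). debias \<gamma> \<pi> \<tau> (D i t)) = (\<lambda>i. debias \<gamma> \<pi> \<tau> (z i))"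
      by (auto simp: z_def)
    then show ?thesis
      by (intro ext) (simp only: sample.distinct_mean_def debiased_Q_def index_tuples_def flip: J_def)
  qed
  let ?q = "debiased_Q \<gamma> \<pi> m I T D \<tau> Q" and ?\<eta> = "policy_value p r \<gamma> \<pi> \<G>"
  have "\<bar>(\<Sum>i\<in>J. psi \<gamma> \<pi> \<G> w ?q (z i)) / ?N - ?\<eta>\<bar> \<le> value_factor C (m - 1) * (\<Delta> / ?N + 1 / ?N + e)"
    using sample.mean_psi_close[of "m - 1" e] e e0 m cJ unfolding dm by simp
  then have "?N * \<bar>(\<Sum>i\<in>J. psi \<gamma> \<pi> \<G> w ?q (z i)) / ?N - ?\<eta>\<bar> \<le> ?N * (value_factor C (m - 1) * (\<Delta> / ?N + 1 / ?N + e))"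
    by (rule mult_left_mono) simp
  also have "?N * \<bar>(\<Sum>i\<in>J. psi \<gamma> \<pi> \<G> w ?q (z i)) / ?N - ?\<eta>\<bar> = \<bar>(\<Sum>i\<in>J. psi \<gamma> \<pi> \<G> w ?q (z i) - ?\<eta>)\<bar>"
  proof -
    have "?N * \<bar>(\<Sum>i\<in>J. psi \<gamma> \<pi> \<G> w ?q (z i)) / ?N - ?\<eta>\<bar>
      = \<bar>?N * ((\<Sum>i\<in>J. psi \<gamma> \<pi> \<G> w ?q (z i)) / ?N - ?\<eta>)\<bar>"
      by (simp add: abs_mult)
    also have "?N * ((\<Sum>i\<in>J. psi \<gamma> \<pi> \<G> w ?q (z i)) / ?N - ?\<eta>) = (\<Sum>i\<in>J. psi \<gamma> \<pi> \<G> w ?q (z i) - ?\<eta>)"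
      using N by (simp add: right_diff_distrib sum_subtractf)
    finally show ?thesis .
  qed
  also have "?N * (value_factor C (m - 1) * (\<Delta> / ?N + 1 / ?N + e)) = value_factor C (m - 1) * (\<Delta> + 1 + ?N * e)"
    using N by (simp add: field_simps)
  also have "\<dots> \<le> value_factor C (m - 1) * (\<Delta> + 1 + real n * real T * e)"
  proof -
    have "card I \<le> n" using card_mono[OF _ I] by simp
    then have "?N \<le> real n * real T" by (simp add: cJ mult_right_mono)
    then show ?thesis
      by (intro mult_left_mono value_factor_nonneg C0 add_left_mono mult_right_mono e0)
  qed
  finally show ?thesis unfolding sumJ[of "\<lambda>y. psi \<gamma> \<pi> \<G> w ?q y - ?\<eta>"] \<Delta>_def .
qed

text \<open>Every trajectory lies in exactly one fold, so \<open>n * T\<close> times the error is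
  the sum of the fold errors. Each fold may use its own \<open>e k\<close> and its own robustness
  case.\<close>

lemma eta_TR_close:
  fixes D :: "nat \<Rightarrow> nat \<Rightarrow> ('s, 'a) obs"
  assumes f: "f \<in> fold_assignments n K" and nT: "0 < n" "0 < T"
    and regular: "\<And>i t. i < n \<Longrightarrow> t < T \<Longrightarrow> regular_obs (D i t)"
    and m: "2 \<le> m" "\<And>k. k < K \<Longrightarrow> m - 1 \<le> card (fold_set n f k) * T"
    and bounds: "\<And>k a s. k < K \<Longrightarrow> \<bar>Qh k a s\<bar> \<le> C" "\<And>k a s a\<^sub>0 s\<^sub>0. k < K \<Longrightarrow> \<bar>th k a s a\<^sub>0 s\<^sub>0\<bar> \<le> C"
      "\<And>k a s. k < K \<Longrightarrow> \<bar>wh k a s\<bar> \<le> C"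
    and e0: "\<And>k. k < K \<Longrightarrow> 0 \<le> e k"
    and e: "\<And>k. k < K \<Longrightarrow> bounded_on_support (\<lambda>a s. Qh k a s - Q_pi a s) (e k)
      \<or> (\<forall>x\<in>set_pmf p_lim. \<forall>y\<in>set_pmf p_lim. \<bar>th k (fst x) (snd x) (fst y) (snd y)
          - tau_ratio p \<gamma> \<pi> p_lim (fst x) (snd x) (fst y) (snd y)\<bar> \<le> e k)
      \<or> bounded_on_support (\<lambda>a s. wh k a s - omega_ratio p \<gamma> \<pi> \<G> p_lim a s) (e k)"
  shows "\<bar>eta_TR \<gamma> \<pi> \<G> m n T f D Qh th wh - policy_value p r \<gamma> \<pi> \<G>\<bar>
    \<le> value_factor C (m - 1) * (\<Sum>k<K. (\<Sum>\<phi>\<in>noises. \<bar>(\<Sum>i\<in>fold_set n f k. \<Sum>t<T. \<phi> (D i t)) / (real n * real T)\<bar>)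
        + 1 / (real n * real T) + e k)"
proof -
  let ?\<eta> = "policy_value p r \<gamma> \<pi> \<G>" and ?L = "value_factor C (m - 1)"
  define c where "c = real n * real T"
  have c: "0 < c" using nT by (simp add: c_def)
  define g where "g k i t = psi \<gamma> \<pi> \<G> (wh k) (debiased_Q \<gamma> \<pi> m (fold_set n f k) T D (th k) (Qh k)) (D i t)" for k i t
  have group: "(\<Sum>k<K. \<Sum>i\<in>fold_set n f k. h i) = (\<Sum>i<n. h i)" for h :: "nat \<Rightarrow> real"
  proof -
    have "f ` {..<n} \<subseteq> {..<K}" using f by (auto simp: fold_assignments_def)
    then have "(\<Sum>k<K. \<Sum>i\<in>{i \<in> {..<n}. f i = k}. h i) = (\<Sum>i<n. h i)"
      by (intro sum.group) auto
    then show ?thesis by (simp add: fold_set_def)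
  qed
  have "c * (eta_TR \<gamma> \<pi> \<G> m n T f D Qh th wh - ?\<eta>) = (\<Sum>i<n. \<Sum>t<T. g (f i) i t) - c * ?\<eta>"
    using c by (simp add: eta_TR_def g_def right_diff_distrib flip: c_def)
  also have "\<dots> = (\<Sum>i<n. \<Sum>t<T. g (f i) i t - ?\<eta>)"
    by (simp add: sum_subtractf c_def)
  also have "\<dots> = (\<Sum>k<K. \<Sum>i\<in>fold_set n f k. \<Sum>t<T. g (f i) i t - ?\<eta>)"
    by (rule group[symmetric])
  also have "\<dots> = (\<Sum>k<K. \<Sum>i\<in>fold_set n f k. \<Sum>t<T. g k i t - ?\<eta>)"
    by (intro sum.cong refl) (auto simp: fold_set_def)
  finally have "\<bar>c * (eta_TR \<gamma> \<pi> \<G> m n T f D Qh th wh - ?\<eta>)\<bar>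
    \<le> (\<Sum>k<K. \<bar>\<Sum>i\<in>fold_set n f k. \<Sum>t<T. g k i t - ?\<eta>\<bar>)"
    by (simp only: sum_abs)
  also have "\<dots> \<le> (\<Sum>k<K. ?L * ((\<Sum>\<phi>\<in>noises. \<bar>\<Sum>i\<in>fold_set n f k. \<Sum>t<T. \<phi> (D i t)\<bar>) + 1 + c * e k))"
  proof (rule sum_mono)
    fix k assume "k \<in> {..<K}"
    then have k: "k < K" by simp
    show "\<bar>\<Sum>i\<in>fold_set n f k. \<Sum>t<T. g k i t - ?\<eta>\<bar>
      \<le> ?L * ((\<Sum>\<phi>\<in>noises. \<bar>\<Sum>i\<in>fold_set n f k. \<Sum>t<T. \<phi> (D i t)\<bar>) + 1 + c * e k)"
      unfolding g_def c_def
      by (rule sum_fold_psi_close[OF _ regular m(1) m(2)[OF k] bounds(1)[OF k] bounds(2)[OF k] bounds(3)[OF k] e0[OF k] e[OF k]])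
        (auto simp: fold_set_def)
  qed
  finally have main: "c * \<bar>eta_TR \<gamma> \<pi> \<G> m n T f D Qh th wh - ?\<eta>\<bar>
    \<le> ?L * (\<Sum>k<K. (\<Sum>\<phi>\<in>noises. \<bar>\<Sum>i\<in>fold_set n f k. \<Sum>t<T. \<phi> (D i t)\<bar>) + 1 + c * e k)"
    using c by (simp add: abs_mult sum_distrib_left)
  have "(\<Sum>k<K. (\<Sum>\<phi>\<in>noises. \<bar>\<Sum>i\<in>fold_set n f k. \<Sum>t<T. \<phi> (D i t)\<bar>) + 1 + c * e k)
    = c * (\<Sum>k<K. (\<Sum>\<phi>\<in>noises. \<bar>(\<Sum>i\<in>fold_set n f k. \<Sum>t<T. \<phi> (D i t)) / c\<bar>) + 1 / c + e k)"
    unfolding sum_distrib_left using c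
    by (intro sum.cong refl) (simp add: abs_divide distrib_left sum_distrib_left)
  then have "c * \<bar>eta_TR \<gamma> \<pi> \<G> m n T f D Qh th wh - ?\<eta>\<bar>
    \<le> c * (?L * (\<Sum>k<K. (\<Sum>\<phi>\<in>noises. \<bar>(\<Sum>i\<in>fold_set n f k. \<Sum>t<T. \<phi> (D i t)) / c\<bar>) + 1 / c + e k))"
    using main by (simp only: mult.left_commute)
  then show ?thesis using c unfolding c_def[symmetric] by (simp only: mult_le_cancel_left_pos)
qed

end

section \<open>Measurability of the value estimator\<close>

text \<open>Over a countable type, measurability for each \<open>y\<close> gives joint
  measurability, which parametrised integration asks for.\<close>

lemma measurable_pmf_expectation:
  fixes f :: "'w \<Rightarrow> 'b::countable \<Rightarrow> real"
  assumes f: "\<And>y. (\<lambda>w. f w y) \<in> borel_measurable M"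
  shows "(\<lambda>w. measure_pmf.expectation \<mu> (f w)) \<in> borel_measurable M"
proof (rule measure_pmf.borel_measurable_lebesgue_integral)
  have "(\<lambda>x. f (fst x) (snd x)) \<in> borel_measurable (M \<Otimes>\<^sub>M measure_pmf \<mu>)"
  proof (rule measurable_compose_countable[of "\<lambda>y x. f (fst x) y" _ _ snd])
    show "(\<lambda>x. f (fst x) y) \<in> borel_measurable (M \<Otimes>\<^sub>M measure_pmf \<mu>)" for y
      by (rule measurable_compose[OF measurable_fst f])
    show "snd \<in> measurable (M \<Otimes>\<^sub>M measure_pmf \<mu>) (count_space UNIV)"
      using measurable_snd[of M "measure_pmf \<mu>"] by (simp cong: measurable_cong_sets)
  qed
  then show "case_prod f \<in> borel_measurable (M \<Otimes>\<^sub>M measure_pmf \<mu>)"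
    by (simp add: case_prod_beta')
qed

lemma measurable_apply_countable:
  fixes q :: "'w \<Rightarrow> 'a::countable \<Rightarrow> 's::countable \<Rightarrow> real"
  assumes q: "\<And>a s. (\<lambda>w. q w a s) \<in> borel_measurable M"
    and a: "a \<in> measurable M (count_space UNIV)" and s: "s \<in> measurable M (count_space UNIV)"
  shows "(\<lambda>w. q w (a w) (s w)) \<in> borel_measurable M"
proof -
  have "(\<lambda>w. q w (a w) s') \<in> borel_measurable M" for s'
    by (rule measurable_compose_countable[OF q a])
  then show ?thesis by (rule measurable_compose_countable[OF _ s])
qed

lemma measurable_state_expectation:
  fixes q :: "'w \<Rightarrow> 'a::countable \<Rightarrow> 's::countable \<Rightarrow> real"
  assumes q: "\<And>a s. (\<lambda>w. q w a s) \<in> borel_measurable M" and s: "s \<in> measurable M (count_space UNIV)"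
  shows "(\<lambda>w. measure_pmf.expectation (\<pi> (s w)) (\<lambda>a. q w a (s w))) \<in> borel_measurable M"
  by (rule measurable_compose_countable[OF measurable_pmf_expectation[OF q] s])

lemma measurable_debias:
  fixes X :: "nat \<Rightarrow> 'w \<Rightarrow> ('s::countable, 'a::countable) step"
  assumes X [measurable]: "\<And>t. X t \<in> measurable M step_space"
    and \<tau>: "\<And>a s a\<^sub>0 s\<^sub>0. (\<lambda>w. \<tau> w a s a\<^sub>0 s\<^sub>0) \<in> borel_measurable M"
    and q: "\<And>a s. (\<lambda>w. q w a s) \<in> borel_measurable M"
  shows "(\<lambda>w. debias \<gamma> \<pi> (\<tau> w) (obs_at X t w) (q w) a s) \<in> borel_measurable M"
proof -
  note [measurable] = q
  have [measurable]: "(\<lambda>w. \<tau> w (Ac (X t w)) (St (X t w)) a s) \<in> borel_measurable M"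
    by (rule measurable_apply_countable[of "\<lambda>w a' s'. \<tau> w a' s' a s"]) (auto intro: \<tau>)
  have [measurable]: "(\<lambda>w. q w (Ac (X t w)) (St (X t w))) \<in> borel_measurable M"
    by (rule measurable_apply_countable) (auto intro: q)
  have [measurable]: "(\<lambda>w. measure_pmf.expectation (\<pi> (St (X (Suc t) w))) (\<lambda>x. q w x (St (X (Suc t) w)))) \<in> borel_measurable M"
    by (rule measurable_state_expectation) (auto intro: q)
  show ?thesis unfolding debias_def obs_at_def prod.case by measurable
qed

lemma measurable_psi:
  fixes X :: "nat \<Rightarrow> 'w \<Rightarrow> ('s::countable, 'a::countable) step"
  assumes X [measurable]: "\<And>t. X t \<in> measurable M step_space"
    and v: "\<And>a s. (\<lambda>w. v w a s) \<in> borel_measurable M"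
    and q: "\<And>a s. (\<lambda>w. q w a s) \<in> borel_measurable M"
  shows "(\<lambda>w. psi \<gamma> \<pi> \<G> (v w) (q w) (obs_at X t w)) \<in> borel_measurable M"
proof -
  have [measurable]: "(\<lambda>w. v w (Ac (X t w)) (St (X t w))) \<in> borel_measurable M"
    by (rule measurable_apply_countable) (auto intro: v)
  have [measurable]: "(\<lambda>w. q w (Ac (X t w)) (St (X t w))) \<in> borel_measurable M"
    by (rule measurable_apply_countable) (auto intro: q)
  have [measurable]: "(\<lambda>w. measure_pmf.expectation (\<pi> (St (X (Suc t) w))) (\<lambda>x. q w x (St (X (Suc t) w)))) \<in> borel_measurable M"
    by (rule measurable_state_expectation) (auto intro: q)
  have [measurable]: "(\<lambda>w. measure_pmf.expectation \<G> (\<lambda>x. measure_pmf.expectation (\<pi> x) (\<lambda>y. q w y x))) \<in> borel_measurable M"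
    by (intro measurable_pmf_expectation q)
  show ?thesis unfolding psi_def obs_at_def prod.case by measurable
qed

lemma observed_eq_obs_at: "observed X w i t = obs_at (X i) t w"
  by (simp add: observed_def obs_at_def)

lemma measurable_debiased_Q:
  fixes X :: "nat \<Rightarrow> nat \<Rightarrow> 'w \<Rightarrow> ('s::countable, 'a::countable) step"
  assumes X: "\<And>i t. X i t \<in> measurable M step_space"
    and \<tau>: "\<And>a s a\<^sub>0 s\<^sub>0. (\<lambda>w. \<tau> w a s a\<^sub>0 s\<^sub>0) \<in> borel_measurable M"
    and q: "\<And>a s. (\<lambda>w. q w a s) \<in> borel_measurable M"
  shows "(\<lambda>w. debiased_Q \<gamma> \<pi> m I T (observed X w) (\<tau> w) (q w) a s) \<in> borel_measurable M"
proof -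
  have "(\<lambda>w. foldr (\<lambda>(i, t). debias \<gamma> \<pi> (\<tau> w) (observed X w i t)) xs (q w) a s) \<in> borel_measurable M" for xs a s
  proof (induction xs arbitrary: a s)
    case (Cons x xs)
    obtain i t where x: "x = (i, t)" by (cases x)
    show ?case
      unfolding foldr_Cons comp_apply x prod.case observed_eq_obs_at
      by (rule measurable_debias[OF X \<tau>]) (use Cons in \<open>simp add: observed_eq_obs_at\<close>)
  qed (simp add: q)
  then show ?thesis
    unfolding debiased_Q_def by (intro borel_measurable_divide borel_measurable_sum) auto
qed

lemma measurable_eta_TR:
  fixes X :: "nat \<Rightarrow> nat \<Rightarrow> 'w \<Rightarrow> ('s::countable, 'a::countable) step"
  assumes X: "\<And>i t. X i t \<in> measurable M step_space" and f: "f \<in> fold_assignments n K"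
    and Q: "\<And>k a s. k < K \<Longrightarrow> (\<lambda>w. Qh w k a s) \<in> borel_measurable M"
    and \<tau>: "\<And>k a s a\<^sub>0 s\<^sub>0. k < K \<Longrightarrow> (\<lambda>w. th w k a s a\<^sub>0 s\<^sub>0) \<in> borel_measurable M"
    and v: "\<And>k a s. k < K \<Longrightarrow> (\<lambda>w. wh w k a s) \<in> borel_measurable M"
  shows "(\<lambda>w. eta_TR \<gamma> \<pi> \<G> m n T f (observed X w) (Qh w) (th w) (wh w)) \<in> borel_measurable M"
proof -
  have "(\<lambda>w. psi \<gamma> \<pi> \<G> (wh w (f i)) (debiased_Q \<gamma> \<pi> m (fold_set n f (f i)) T (observed X w)
      (th w (f i)) (Qh w (f i))) (observed X w i t)) \<in> borel_measurable M" if "i < n" for i t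
  proof -
    have k: "f i < K" using f that by (auto simp: fold_assignments_def)
    show ?thesis
      unfolding observed_eq_obs_at
      by (rule measurable_psi[OF X v[OF k]])
        (rule measurable_debiased_Q[OF X \<tau>[OF k] Q[OF k], unfolded observed_eq_obs_at])
  qed
  then show ?thesis
    unfolding eta_TR_def by (intro borel_measurable_times borel_measurable_const borel_measurable_sum) auto
qed

lemma measurable_observed:
  assumes X [measurable]: "\<And>i t. X i t \<in> measurable M step_space"
  shows "(\<lambda>w. observed X w i t) \<in> measurable M obs_space"
  unfolding observed_def obs_space_def by measurable

lemma measurable_training_data:
  assumes X: "\<And>i t. X i t \<in> measurable M step_space"
  shows "(\<lambda>w. training_data n T f k (observed X w)) \<in> measurable M (training_space n T f k)"
  unfolding training_data_def training_space_def
  by (intro measurable_restrict measurable_observed X)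


text \<open>The division takes finitely many values, so measurability need only be checked for a
  fixed one.\<close>

lemma measurable_random_division:
  fixes g :: "(nat \<Rightarrow> nat) \<Rightarrow> 'w \<Rightarrow> real"
  assumes "random_division M X n K F"
    and g: "\<And>f. f \<in> fold_assignments n K \<Longrightarrow> g f \<in> borel_measurable M"
  shows "(\<lambda>w. g (F w) w) \<in> borel_measurable M"
proof (rule measurable_compose_countable'[where f = g and I = "fold_assignments n K"])
  show "(\<lambda>w. g f w) \<in> borel_measurable M" if "f \<in> fold_assignments n K" for f
    using g[OF that] .
  show "F \<in> measurable M (count_space (fold_assignments n K))"
    using assms(1) by (simp add: random_division_def)
  show "countable (fold_assignments n K)"
    by (rule countable_finite[OF finite_fold_assignments])
qed

section \<open>Consistency\<close>

theorem theorem1: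
  fixes M :: "'w measure"
    and p :: "'a::countable \<Rightarrow> 's::countable \<Rightarrow> 's pmf"
    and r :: "'a \<Rightarrow> 's \<Rightarrow> real"
    and \<gamma> :: real
    and b :: "nat \<Rightarrow> (nat \<Rightarrow> ('s, 'a) step) \<Rightarrow> 's \<Rightarrow> 'a pmf"
    and \<pi> :: "'s \<Rightarrow> 'a pmf"
    and \<G> :: "'s pmf"
    and p_lim :: "('a \<times> 's) pmf"
    and X :: "nat \<Rightarrow> nat \<Rightarrow> 'w \<Rightarrow> ('s, 'a) step"
    and K m :: nat
    and n T :: "nat \<Rightarrow> nat"
    and F :: "nat \<Rightarrow> 'w \<Rightarrow> nat \<Rightarrow> nat"
    and Qhat :: "nat \<Rightarrow> nat \<Rightarrow> (nat \<Rightarrow> nat) \<Rightarrow> (nat \<Rightarrow> nat \<Rightarrow> ('s, 'a) obs) \<Rightarrow> 'a \<Rightarrow> 's \<Rightarrow> real"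
    and \<tau>hat :: "nat \<Rightarrow> nat \<Rightarrow> (nat \<Rightarrow> nat) \<Rightarrow> (nat \<Rightarrow> nat \<Rightarrow> ('s, 'a) obs)
                    \<Rightarrow> 'a \<Rightarrow> 's \<Rightarrow> 'a \<Rightarrow> 's \<Rightarrow> real"
    and \<omega>hat :: "nat \<Rightarrow> nat \<Rightarrow> (nat \<Rightarrow> nat) \<Rightarrow> (nat \<Rightarrow> nat \<Rightarrow> ('s, 'a) obs) \<Rightarrow> 'a \<Rightarrow> 's \<Rightarrow> real"
  assumes "prob_space M"
    and "0 < \<gamma>" and "\<gamma> < 1"
    and "iid_trajectories M X"
    and "\<And>i. mdp_trajectory M p r b (X i)"
    and "\<exists>C. (\<forall>a s. \<bar>r a s\<bar> \<le> C) \<and> (\<forall>i t. AE w in M. \<bar>Rw (X i t w)\<bar> \<le> C)"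
    and "\<And>i. strictly_stationary M (X i)"
    and "\<And>i. exponentially_beta_mixing M (X i)"
    and "\<And>i. limiting_sa_distribution M (X i) p_lim"
    and "genuine_density_ratios p \<gamma> \<pi> \<G> p_lim"
    and "\<exists>C. \<forall>a s a\<^sub>0 s\<^sub>0. \<bar>tau_ratio p \<gamma> \<pi> p_lim a s a\<^sub>0 s\<^sub>0\<bar> \<le> C"
    and "\<exists>C. \<forall>a s. \<bar>omega_ratio p \<gamma> \<pi> \<G> p_lim a s\<bar> \<le> C"
    and "K \<ge> 2" and "m \<ge> 2"
    and "\<And>j. random_division M X (n j) K (F j)"
    and "\<And>j k w. k < K \<Longrightarrow> w \<in> space M \<Longrightarrow> card (fold_set (n j) (F j w) k) * T j \<ge> m - 1"
    and "\<And>j k f a s. k < K \<Longrightarrow> f \<in> fold_assignments (n j) K \<Longrightarrow>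
           (\<lambda>d. Qhat j k f d a s) \<in> borel_measurable (training_space (n j) (T j) f k)"
    and "\<And>j k f a s a\<^sub>0 s\<^sub>0. k < K \<Longrightarrow> f \<in> fold_assignments (n j) K \<Longrightarrow>
           (\<lambda>d. \<tau>hat j k f d a s a\<^sub>0 s\<^sub>0) \<in> borel_measurable (training_space (n j) (T j) f k)"
    and "\<And>j k f a s. k < K \<Longrightarrow> f \<in> fold_assignments (n j) K \<Longrightarrow>
           (\<lambda>d. \<omega>hat j k f d a s) \<in> borel_measurable (training_space (n j) (T j) f k)"
    and "\<exists>C. \<forall>j. \<forall>k<K. AE w in M. (\<forall>a s. \<bar>fitted n T F X Qhat k j w a s\<bar> \<le> C) \<and>
           (\<forall>a s a\<^sub>0 s\<^sub>0. \<bar>fitted n T F X \<tau>hat k j w a s a\<^sub>0 s\<^sub>0\<bar> \<le> C) \<and> (\<forall>a s. \<bar>fitted n T F X \<omega>hat k j w a s\<bar> \<le> C)"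
    and "\<And>k. k < K \<Longrightarrow>
           L2_converges M p_lim (fitted n T F X Qhat k) (Q_fun p r \<gamma> \<pi>) \<or>
           L2_converges_pair M p_lim (fitted n T F X \<tau>hat k) (tau_ratio p \<gamma> \<pi> p_lim) \<or>
           L2_converges M p_lim (fitted n T F X \<omega>hat k) (omega_ratio p \<gamma> \<pi> \<G> p_lim)"
    and "filterlim n at_top sequentially \<or> filterlim T at_top sequentially"
  shows "converges_in_probability M
           (\<lambda>j w. eta_TR \<gamma> \<pi> \<G> m (n j) (T j) (F j w) (observed X w)
                    (\<lambda>k. fitted n T F X Qhat k j w) (\<lambda>k. fitted n T F X \<tau>hat k j w) (\<lambda>k. fitted n T F X \<omega>hat k j w))
           (policy_value p r \<gamma> \<pi> \<G>)"
proof -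
  interpret prob_space M by fact
  obtain Cr where r: "\<And>a s. \<bar>r a s\<bar> \<le> Cr" and R: "\<And>i t. AE w in M. \<bar>Rw (X i t w)\<bar> \<le> Cr"
    using assms(6) by blast
  interpret finite_support_evaluation p r \<gamma> \<pi> \<G> p_lim Cr
    by unfold_locales (use assms(2,3,10,11) r in auto)
  interpret iid_mdp_data p r \<gamma> \<pi> \<G> p_lim Cr M b X
  proof (intro iid_mdp_data.intro iid_mdp_data_axioms.intro)
    show "finite_support_evaluation p r \<gamma> \<pi> \<G> p_lim Cr" by unfold_locales
    show "prob_space M" "iid_trajectories M X" by fact+
    show "mdp_data p r \<gamma> \<pi> \<G> p_lim Cr M b (X i)" for i
      by unfold_locales (use assms(5,7-9) R in auto)
  qed
  note div = assms(15) and sizes = assms(16)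
  have X: "X i t \<in> measurable M step_space" for i t by (rule measurable_X)
  let ?\<eta> = "policy_value p r \<gamma> \<pi> \<G>"
  let ?Q = "fitted n T F X Qhat" and ?\<tau> = "fitted n T F X \<tau>hat" and ?\<omega> = "fitted n T F X \<omega>hat"
  obtain C where C: "\<And>j k. k < K \<Longrightarrow> AE w in M. (\<forall>a s. \<bar>?Q k j w a s\<bar> \<le> C) \<and>
      (\<forall>a s a\<^sub>0 s\<^sub>0. \<bar>?\<tau> k j w a s a\<^sub>0 s\<^sub>0\<bar> \<le> C) \<and> (\<forall>a s. \<bar>?\<omega> k j w a s\<bar> \<le> C)"
    using assms(20) by blast
  have F_in: "F j w \<in> fold_assignments (n j) K" if "w \<in> space M" for j w
    using measurable_space[of "F j" M "count_space (fold_assignments (n j) K)" w] div[of j] that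
    by (simp add: random_division_def)
  \<comment> \<open>The size condition with \<open>m - 1 \<ge> 1\<close> makes fold 0 nonempty and
    \<open>T j\<close> positive; it can be evaluated because a probability space has a
    point.\<close>
  have nT: "0 < n j" "0 < T j" for j
  proof -
    obtain w where w: "w \<in> space M" using not_empty by blast
    have "0 < card (fold_set (n j) (F j w) 0) * T j"
      using sizes[OF _ w, of 0 j] assms(13,14) by linarith
    then have "fold_set (n j) (F j w) 0 \<noteq> {}" "0 < T j" by (auto simp: card_gt_0_iff)
    then show "0 < n j" "0 < T j" by (auto simp: fold_set_def)
  qed
  note data = measurable_training_data[OF X]
  have Q_meas: "(\<lambda>w. ?Q k j w a s) \<in> borel_measurable M" if "k < K" for k j a s
    unfolding fitted_def
    by (rule measurable_random_division[OF div]) (rule measurable_compose[OF data assms(17)[OF that]])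
  have \<tau>_meas: "(\<lambda>w. ?\<tau> k j w a s a\<^sub>0 s\<^sub>0) \<in> borel_measurable M" if "k < K" for k j a s a\<^sub>0 s\<^sub>0
    unfolding fitted_def
    by (rule measurable_random_division[OF div]) (rule measurable_compose[OF data assms(18)[OF that]])
  have \<omega>_meas: "(\<lambda>w. ?\<omega> k j w a s) \<in> borel_measurable M" if "k < K" for k j a s
    unfolding fitted_def
    by (rule measurable_random_division[OF div]) (rule measurable_compose[OF data assms(19)[OF that]])

  define A where "A = set_pmf p_lim"
  have finA: "finite A" by (simp add: A_def finite_support)
  \<comment> \<open>Summed over the finite support, the errors dominate each pointwise error and can
    serve as \<open>e\<close> in \<open>eta_TR_close\<close>.\<close>
  define errQ where "errQ k j w = (\<Sum>x\<in>A. \<bar>?Q k j w (fst x) (snd x) - Q_pi (fst x) (snd x)\<bar>)" for k j w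
  define err\<tau> where "err\<tau> k j w = (\<Sum>x\<in>A. \<Sum>y\<in>A. \<bar>?\<tau> k j w (fst x) (snd x) (fst y) (snd y)
    - tau_ratio p \<gamma> \<pi> p_lim (fst x) (snd x) (fst y) (snd y)\<bar>)" for k j w
  define err\<omega> where "err\<omega> k j w = (\<Sum>x\<in>A. \<bar>?\<omega> k j w (fst x) (snd x)
    - omega_ratio p \<gamma> \<pi> \<G> p_lim (fst x) (snd x)\<bar>)" for k j w
  \<comment> \<open>The case may change with the fold but not with \<open>j\<close>, so a single
    error sequence can be chosen for each fold.\<close>
  have "\<exists>e. L2_null M e \<and> (e = errQ k \<or> e = err\<tau> k \<or> e = err\<omega> k)" if k: "k < K" for k
    using assms(21)[OF k]
  proof (elim disjE)
    assume lim: "L2_converges M p_lim (?Q k) Q_pi"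
    have "L2_null M (errQ k)"
      unfolding errQ_def[abs_def] A_def
      by (intro L2_null_sum L2_null_abs L2_convergesD[OF lim] finite_support) (simp_all add: Q_meas k)
    then show ?thesis by (intro exI[of _ "errQ k"]) simp
  next
    assume lim: "L2_converges_pair M p_lim (?\<tau> k) (tau_ratio p \<gamma> \<pi> p_lim)"
    have "L2_null M (err\<tau> k)"
      unfolding err\<tau>_def[abs_def] A_def
      by (intro L2_null_sum L2_null_abs L2_converges_pairD[OF lim] finite_support) (simp_all add: \<tau>_meas k)
    then show ?thesis by (intro exI[of _ "err\<tau> k"]) simp
  next
    assume lim: "L2_converges M p_lim (?\<omega> k) (omega_ratio p \<gamma> \<pi> \<G> p_lim)"
    have "L2_null M (err\<omega> k)"
      unfolding err\<omega>_def[abs_def] A_def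
      by (intro L2_null_sum L2_null_abs L2_convergesD[OF lim] finite_support) (simp_all add: \<omega>_meas k)
    then show ?thesis by (intro exI[of _ "err\<omega> k"]) simp
  qed
  then obtain e where e_null: "\<And>k. k < K \<Longrightarrow> L2_null M (e k)"
    and e: "\<And>k. k < K \<Longrightarrow> e k = errQ k \<or> e k = err\<tau> k \<or> e k = err\<omega> k"
    by metis

  have rate: "(\<lambda>j. 1 / (real (n j) * real (T j))) \<longlonglongrightarrow> 0"
  proof -
    \<comment> \<open>Both factors are at least 1, so the product dominates whichever of them
      diverges.\<close>
    have "filterlim (\<lambda>j. n j * T j) at_top sequentially"
      using assms(22)
    proof
      assume "filterlim n at_top sequentially"
      then show ?thesis
        by (rule filterlim_at_top_mono) (use nT in \<open>simp add: Suc_leI\<close>)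
    next
      assume "filterlim T at_top sequentially"
      then show ?thesis
        by (rule filterlim_at_top_mono) (use nT in \<open>simp add: Suc_leI\<close>)
    qed
    then have "filterlim (\<lambda>j. real (n j * T j)) at_top sequentially"
      by (rule filterlim_compose[OF filterlim_real_sequentially])
    then show ?thesis
      by (intro tendsto_divide_0[OF tendsto_const] filterlim_at_top_imp_at_infinity) simp
  qed
  define S where "S \<phi> k j w = (\<Sum>i\<in>fold_set (n j) (F j w) k. \<Sum>t<T j. \<phi> (observed X w i t)) / (real (n j) * real (T j))"
    for \<phi> k j w
  have S_null: "L2_null M (S \<phi> k)" if \<phi>: "\<phi> \<in> noises" for \<phi> k
  proof -
    obtain c where c: "0 \<le> c" "\<And>T i. expectation (\<lambda>w. (noise_sum \<phi> T (\<lambda>t. X i t w))\<^sup>2) \<le> c * real T"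
      by (rule noise_sum_second_moment[OF \<phi>]) blast
    define D where "D j w = (\<Sum>i\<in>fold_set (n j) (F j w) k. noise_sum \<phi> (T j) (\<lambda>t. X i t w))" for j w
    have D: "D j \<in> borel_measurable M" "(\<integral>\<^sup>+ w. ennreal ((D j w)\<^sup>2) \<partial>M) \<le> ennreal (c * real (T j) * real (n j))" for j
      unfolding D_def[abs_def] using random_fold_second_moment[OF \<phi> div c(2) c(1)] by auto
    have S_D: "S \<phi> k j w = D j w / (real (n j) * real (T j))" for j w
      by (simp add: S_def D_def noise_sum_obs observed_eq_obs_at)
    show ?thesis
    proof (rule L2_nullI)
      show "S \<phi> k j \<in> borel_measurable M" for j
        unfolding S_D[abs_def] using D(1) by (intro borel_measurable_divide) auto
      show "(\<integral>\<^sup>+ w. ennreal ((S \<phi> k j w)\<^sup>2) \<partial>M) \<le> ennreal (c * (1 / (real (n j) * real (T j))))" for j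
      proof -
        \<comment> \<open>A second moment of order \<open>n * T\<close>, divided by
          \<open>N\<^sup>2\<close>, leaves \<open>c / N\<close>.\<close>
        define N where "N = real (n j) * real (T j)"
        have N: "0 < N" using nT[of j] by (simp add: N_def)
        have "(\<integral>\<^sup>+ w. ennreal ((S \<phi> k j w)\<^sup>2) \<partial>M) = (\<integral>\<^sup>+ w. ennreal (1 / N\<^sup>2) * ennreal ((D j w)\<^sup>2) \<partial>M)"
          unfolding S_D N_def[symmetric] by (simp add: power_divide flip: ennreal_mult)
        also have "\<dots> = ennreal (1 / N\<^sup>2) * (\<integral>\<^sup>+ w. ennreal ((D j w)\<^sup>2) \<partial>M)"
          using D(1)[of j] by (intro nn_integral_cmult) measurable
        also have "\<dots> \<le> ennreal (1 / N\<^sup>2) * ennreal (c * real (T j) * real (n j))"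
          by (intro mult_left_mono D(2)) auto
        also have "\<dots> = ennreal (1 / N\<^sup>2 * (c * real (T j) * real (n j)))"
          using c(1) by (intro ennreal_mult[symmetric]) auto
        also have "1 / N\<^sup>2 * (c * real (T j) * real (n j)) = c * (1 / N)"
          using N by (simp add: N_def power2_eq_square field_simps)
        finally show ?thesis unfolding N_def .
      qed
      have "(\<lambda>j. c * (1 / (real (n j) * real (T j)))) \<longlonglongrightarrow> c * 0"
        by (intro tendsto_mult_left rate)
      then show "(\<lambda>j. ennreal (c * (1 / (real (n j) * real (T j))))) \<longlonglongrightarrow> 0"
        by (auto dest: tendsto_ennrealI)
    qed
  qed

  \<comment> \<open>The right-hand side of \<open>eta_TR_close\<close> without its constant: a
    finite sum of null sequences.\<close>
  define Y where "Y j w = (\<Sum>k<K. (\<Sum>\<phi>\<in>noises. \<bar>S \<phi> k j w\<bar>) + 1 / (real (n j) * real (T j)) + e k j w)" for j w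
  have "L2_null M Y"
    unfolding Y_def[abs_def]
    by (intro L2_null_sum L2_null_add L2_null_abs S_null L2_null_const rate e_null finite_noises) auto
  moreover have "AE w in M. \<bar>eta_TR \<gamma> \<pi> \<G> m (n j) (T j) (F j w) (observed X w)
      (\<lambda>k. ?Q k j w) (\<lambda>k. ?\<tau> k j w) (\<lambda>k. ?\<omega> k j w) - ?\<eta>\<bar> \<le> value_factor C (m - 1) * Y j w" for j
  proof -
    have regular: "AE w in M. \<forall>i t. regular_obs (observed X w i t)"
      unfolding AE_all_countable observed_eq_obs_at using mdp_data.AE_regular_obs[OF trajectory] by blast
    have bounds: "AE w in M. \<forall>k. k < K \<longrightarrow> (\<forall>a s. \<bar>?Q k j w a s\<bar> \<le> C) \<and>
      (\<forall>a s a\<^sub>0 s\<^sub>0. \<bar>?\<tau> k j w a s a\<^sub>0 s\<^sub>0\<bar> \<le> C) \<and> (\<forall>a s. \<bar>?\<omega> k j w a s\<bar> \<le> C)"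
      unfolding AE_all_countable
    proof
      fix k
      show "AE w in M. k < K \<longrightarrow> (\<forall>a s. \<bar>?Q k j w a s\<bar> \<le> C) \<and>
        (\<forall>a s a\<^sub>0 s\<^sub>0. \<bar>?\<tau> k j w a s a\<^sub>0 s\<^sub>0\<bar> \<le> C) \<and> (\<forall>a s. \<bar>?\<omega> k j w a s\<bar> \<le> C)"
        using C[of k j] by (cases "k < K") auto
    qed
    show ?thesis
      using regular bounds AE_space
    proof eventually_elim
      case (elim w)
      show ?case
        unfolding Y_def S_def
      proof (rule eta_TR_close[OF F_in nT])
        fix k assume k: "k < K"
        show "m - 1 \<le> card (fold_set (n j) (F j w) k) * T j" by (rule sizes[OF k elim(3)])
        show "0 \<le> e k j w"
          using e[OF k] by (auto simp: errQ_def err\<tau>_def err\<omega>_def intro!: sum_nonneg)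
        have le: "h x \<le> (\<Sum>x\<in>A. h x)" if "x \<in> A" "\<And>x. 0 \<le> h x" for h :: "'a \<times> 's \<Rightarrow> real" and x
          by (rule member_le_sum) (use that finA in auto)
        show "bounded_on_support (\<lambda>a s. ?Q k j w a s - Q_pi a s) (e k j w)
          \<or> (\<forall>x\<in>set_pmf p_lim. \<forall>y\<in>set_pmf p_lim. \<bar>?\<tau> k j w (fst x) (snd x) (fst y) (snd y)
              - tau_ratio p \<gamma> \<pi> p_lim (fst x) (snd x) (fst y) (snd y)\<bar> \<le> e k j w)
          \<or> bounded_on_support (\<lambda>a s. ?\<omega> k j w a s - omega_ratio p \<gamma> \<pi> \<G> p_lim a s) (e k j w)"
          using e[OF k]
        proof (elim disjE)
          assume "e k = errQ k"
          then have "bounded_on_support (\<lambda>a s. ?Q k j w a s - Q_pi a s) (e k j w)"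
            using le[of _ "\<lambda>x. \<bar>?Q k j w (fst x) (snd x) - Q_pi (fst x) (snd x)\<bar>"]
            by (force simp: bounded_on_support_def errQ_def A_def)
          then show ?thesis by blast
        next
          assume ek: "e k = err\<tau> k"
          have "\<bar>?\<tau> k j w (fst x) (snd x) (fst y) (snd y)
              - tau_ratio p \<gamma> \<pi> p_lim (fst x) (snd x) (fst y) (snd y)\<bar> \<le> e k j w"
            if "x \<in> A" "y \<in> A" for x y
          proof -
            let ?h = "\<lambda>x y. \<bar>?\<tau> k j w (fst x) (snd x) (fst y) (snd y)
              - tau_ratio p \<gamma> \<pi> p_lim (fst x) (snd x) (fst y) (snd y)\<bar>"
            have "?h x y \<le> (\<Sum>y\<in>A. ?h x y)" by (rule le[OF that(2)]) simp
            also have "\<dots> \<le> (\<Sum>x\<in>A. \<Sum>y\<in>A. ?h x y)" by (rule le[OF that(1)]) (simp add: sum_nonneg)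
            finally show ?thesis by (simp add: ek err\<tau>_def)
          qed
          then show ?thesis by (auto simp: A_def)
        next
          assume "e k = err\<omega> k"
          then have "bounded_on_support (\<lambda>a s. ?\<omega> k j w a s - omega_ratio p \<gamma> \<pi> \<G> p_lim a s) (e k j w)"
            using le[of _ "\<lambda>x. \<bar>?\<omega> k j w (fst x) (snd x) - omega_ratio p \<gamma> \<pi> \<G> p_lim (fst x) (snd x)\<bar>"]
            by (force simp: bounded_on_support_def err\<omega>_def A_def)
          then show ?thesis by blast
        qed
      qed (use elim assms(14) in auto)
    qed
  qed
  moreover have "0 \<le> value_factor C (m - 1)"
  proof -
    \<comment> \<open>\<open>C\<close> is known only through almost sure bounds, so its sign is read
      off at almost every point for one existing fold.\<close>
    have "0 < K" using assms(13) by simp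
    have "AE w in M. 0 \<le> C"
      using C[OF \<open>0 < K\<close>, of 0] by eventually_elim (meson abs_ge_zero order_trans)
    then have "0 \<le> C" by (simp add: AE_const)
    then show ?thesis by (rule value_factor_nonneg)
  qed
  moreover have "(\<lambda>w. eta_TR \<gamma> \<pi> \<G> m (n j) (T j) (F j w) (observed X w)
      (\<lambda>k. ?Q k j w) (\<lambda>k. ?\<tau> k j w) (\<lambda>k. ?\<omega> k j w)) \<in> borel_measurable M" for j
    unfolding fitted_def
    by (rule measurable_random_division[OF div], rule measurable_eta_TR[OF X, where K = K], assumption)
      (intro measurable_compose[OF data] assms(17-19); assumption)+
  ultimately show ?thesis by (intro converges_in_probabilityI[where L = "value_factor C (m - 1)" and Y = Y])
qed

end
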